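(* Let $\theta>0$, let $0<H<3/4$, and let $X$ be the sub-fractional Ornstein–Uhlenbeck process described in the context. Define $$\sigma_H^2:=2\rho_H(0)^2+2\sum_{i\in\mathbb Z\setminus\{0\}}\rho_H(i)^2 .$$ Then there is a constant $C>0$, not depending on $n$, such that $$|E[V_n(X)^2]-\sigma_H^2|\le C\,\psi_H(n).$$ In particular, $E[V_n(X)^2]\to\sigma_H^2>0$ as $n\to\infty$. If instead $H=3/4$, then there is a constant $C>0$ such that for all $n>1$ $$\left|\frac{E[V_n(X)^2]}{\log(n)}-\frac{9}{16\theta^4}\right|\le C\log(n)^{-1}.$$
   Context: The sub-fractional Brownian motion $S^H=\{S^H_t\}_{t\ge0}$ with parameter $H\in(0,1)$ is the mean-zero continuous Gaussian process with covariance $E(S^H_tS^H_s)=t^{2H}+s^{2H}-\frac12\left((t+s)^{2H}+|t-s|^{2H}\right)$. The process $X$ solves $dX_t=-\theta X_tdt+dS^H_t$, $X_0=0$, i.e. $X_t=e^{-\theta t}\int_0^te^{\theta s}dS^H_s=S^H_t-\theta e^{-\theta t}\int_0^te^{\theta s}S^H_sds$ (Young/Wiener integral). For $n\ge1$, $V_n(X):=\frac1{\sqrt n}\sum_{i=1}^n(X_i^2-E[X_i^2])$. For $\alpha\in(0,1)$ let $Z^\alpha_t:=e^{-\theta t}\int_{-\infty}^te^{\theta u}dB^\alpha_u$, $t\in\mathbb R$, where $B^\alpha$ is a two-sided fractional Brownian motion with Hurst parameter $\alpha$; $Z^\alpha$ is a stationary Gaussian process. Put $\rho_H(k):=E[Z^H_kZ^H_0]$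 for $k\in\mathbb Z$ (an even function of $k$); $\rho_H(0)=H\Gamma(2H)/\theta^{2H}$. Finally $$\psi_\alpha(n):=\begin{cases}n^{-1}&\text{if }0<\alpha<1/2,\\ n^{4\alpha-3}&\text{if }1/2\le\alpha<3/4.\end{cases}$$ *)

theory Defs
  imports "HOL-Probability.Probability"
begin

section \<open>Gaussian processes\<close>

text \<open>Constants count as (degenerate) Gaussian random variables.\<close>

definition gaussian_rv :: "'a measure \<Rightarrow> ('a \<Rightarrow> real) \<Rightarrow> bool" where
  "gaussian_rv M Y \<longleftrightarrow>
     (\<exists>\<mu> \<sigma>. 0 < \<sigma> \<and> distributed M lborel Y (\<lambda>x. ennreal (normal_density \<mu> \<sigma> x))) \<or>
     (Y \<in> borel_measurable M \<and> (\<exists>\<mu>. AE \<omega> in M. Y \<omega> = \<mu>))"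

definition gaussian_process :: "'a measure \<Rightarrow> 't set \<Rightarrow> ('t \<Rightarrow> 'a \<Rightarrow> real) \<Rightarrow> bool" where
  "gaussian_process M T Y \<longleftrightarrow>
     (\<forall>J c. finite J \<and> J \<subseteq> T \<longrightarrow> gaussian_rv M (\<lambda>\<omega>. \<Sum>t\<in>J. c t * Y t \<omega>))"

definition sub_fBm :: "'a measure \<Rightarrow> real \<Rightarrow> (real \<Rightarrow> 'a \<Rightarrow> real) \<Rightarrow> bool" where
  "sub_fBm M H S \<longleftrightarrow>
     prob_space M \<and> 0 < H \<and> H < 1 \<and>
     gaussian_process M {0..} S \<and>
     (\<forall>\<omega>\<in>space M. continuous_on {0..} (\<lambda>t. S t \<omega>)) \<and>
     (\<forall>t\<ge>0. integral\<^sup>L M (S t) = 0) \<and>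
     (\<forall>t\<ge>0. \<forall>s\<ge>0. integral\<^sup>L M (\<lambda>\<omega>. S t \<omega> * S s \<omega>) =
        t powr (2 * H) + s powr (2 * H) - (1 / 2) * ((t + s) powr (2 * H) + \<bar>t - s\<bar> powr (2 * H)))"

definition two_sided_fBm :: "'a measure \<Rightarrow> real \<Rightarrow> (real \<Rightarrow> 'a \<Rightarrow> real) \<Rightarrow> bool" where
  "two_sided_fBm M \<alpha> B \<longleftrightarrow>
     prob_space M \<and> 0 < \<alpha> \<and> \<alpha> < 1 \<and>
     gaussian_process M UNIV B \<and>
     (\<forall>\<omega>\<in>space M. continuous_on UNIV (\<lambda>t. B t \<omega>)) \<and>
     (\<forall>t. integral\<^sup>L M (B t) = 0) \<and>
     (\<forall>t s. integral\<^sup>L M (\<lambda>\<omega>. B t \<omega> * B s \<omega>) =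
        (1 / 2) * (\<bar>t\<bar> powr (2 * \<alpha>) + \<bar>s\<bar> powr (2 * \<alpha>) - \<bar>t - s\<bar> powr (2 * \<alpha>)))"


section \<open>The Young integral\<close>

text \<open>
  The integral of \<open>f\<close> against \<open>g\<close> over \<open>[a, b]\<close>, as the limit of the Riemann--Stieltjes sums
  when the mesh of the partition tends to zero. For \<open>f = exp (\<theta> \<cdot>)\<close> and any continuous
  path \<open>g\<close> it exists, see \<open>has_young_integral_by_parts\<close>.
\<close>

definition has_young_integral ::
    "(real \<Rightarrow> real) \<Rightarrow> (real \<Rightarrow> real) \<Rightarrow> real \<Rightarrow> real \<Rightarrow> real \<Rightarrow> bool" where
  "has_young_integral f g a b I \<longleftrightarrow>
     (\<forall>e>0. \<exists>d>0. \<forall>p. p tagged_division_of {a..b} \<and> (\<forall>(x, K)\<in>p. Sup K - Inf K < d) \<longrightarrow>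
        \<bar>(\<Sum>(x, K)\<in>p. f x * (g (Sup K) - g (Inf K))) - I\<bar> < e)"

definition young_integral ::
    "(real \<Rightarrow> real) \<Rightarrow> (real \<Rightarrow> real) \<Rightarrow> real \<Rightarrow> real \<Rightarrow> real" where
  "young_integral f g a b = (THE I. has_young_integral f g a b I)"

lemma has_young_integral_unique:
  assumes "has_young_integral f g a b I" "has_young_integral f g a b J"
  shows "I = J"
proof (rule ccontr)
  assume "I \<noteq> J"
  define e where "e = \<bar>I - J\<bar> / 2"
  have e: "e > 0" using \<open>I \<noteq> J\<close> by (simp add: e_def)
  obtain d1 where d1: "d1 > 0" "\<And>p. p tagged_division_of {a..b} \<Longrightarrow> (\<forall>(x, K)\<in>p. Sup K - Inf K < d1)
      \<Longrightarrow> \<bar>(\<Sum>(x, K)\<in>p. f x * (g (Sup K) - g (Inf K))) - I\<bar> < e"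
    using assms(1) e unfolding has_young_integral_def by meson
  obtain d2 where d2: "d2 > 0" "\<And>p. p tagged_division_of {a..b} \<Longrightarrow> (\<forall>(x, K)\<in>p. Sup K - Inf K < d2)
      \<Longrightarrow> \<bar>(\<Sum>(x, K)\<in>p. f x * (g (Sup K) - g (Inf K))) - J\<bar> < e"
    using assms(2) e unfolding has_young_integral_def by meson
  define d where "d = min d1 d2"
  have "d > 0" using d1 d2 by (simp add: d_def)
  then obtain p where p: "p tagged_division_of {a..b}" "(\<lambda>x. ball x (d / 3)) fine p"
    using fine_division_exists_real[of "\<lambda>x. ball x (d / 3)" a b] gauge_ball_dependent[of "\<lambda>_. d / 3"]
    by auto
  have "Sup K - Inf K < d" if xK: "(x, K) \<in> p" for x K
  proof -
    obtain u v where K: "K = {u..v}" using tagged_division_ofD(4)[OF p(1) xK] by auto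
    have "x \<in> K" using tagged_division_ofD(2)[OF p(1) xK] .
    hence uv: "u \<le> v" using K by auto
    have "K \<subseteq> ball x (d / 3)" using p(2) xK by (auto simp: fine_def)
    hence "u \<in> ball x (d / 3)" "v \<in> ball x (d / 3)" using K uv by auto
    thus ?thesis using K uv \<open>d > 0\<close> by (auto simp: dist_real_def abs_if split: if_splits)
  qed
  hence m: "\<forall>(x, K)\<in>p. Sup K - Inf K < d1" "\<forall>(x, K)\<in>p. Sup K - Inf K < d2"
    by (fastforce simp: d_def)+
  show False using d1(2)[OF p(1) m(1)] d2(2)[OF p(1) m(2)] by (simp add: e_def abs_if split: if_splits)
qed

lemma young_integral_eqI:
  "has_young_integral f g a b I \<Longrightarrow> young_integral f g a b = I"
  unfolding young_integral_def by (blast intro: the_equality has_young_integral_unique)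

lemma has_young_integral_by_parts:
  fixes f f' g :: "real \<Rightarrow> real"
  assumes ab: "a \<le> b"
    and f: "\<And>x. x \<in> {a..b} \<Longrightarrow> (f has_real_derivative f' x) (at x within {a..b})"
    and f': "continuous_on {a..b} f'"
    and g: "continuous_on {a..b} g"
  shows "has_young_integral f g a b (f b * g b - f a * g a - integral {a..b} (\<lambda>s. f' s * g s))"
proof -
  obtain L where L: "L > 0" "\<And>x. x \<in> {a..b} \<Longrightarrow> \<bar>f' x\<bar> \<le> L"
  proof -
    have "bounded (f' ` {a..b})"
      using compact_continuous_image[OF f'] compact_imp_bounded by blast
    thus ?thesis using that by (auto simp: bounded_pos)
  qed
  have int: "(\<lambda>s. f' s * g s) integrable_on {p..q}" "(\<lambda>s. f' s * c) integrable_on {p..q}"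
    if "{p..q} \<subseteq> {a..b}" for p q c
    using that by (intro integrable_continuous_interval continuous_intros continuous_on_subset[OF f']
                    continuous_on_subset[OF g]; simp)+
  define \<Phi> where "\<Phi> x = f x * g x - integral {a..x} (\<lambda>s. f' s * g s)" for x
  have piece: "\<bar>(f q - f p) * c - integral {p..q} (\<lambda>s. f' s * g s)\<bar> \<le> L * \<eta> * (q - p)"
    if pq: "a \<le> p" "p \<le> q" "q \<le> b" and c: "\<And>s. s \<in> {p..q} \<Longrightarrow> \<bar>g s - c\<bar> \<le> \<eta>" for p q c \<eta>
  proof -
    have sub: "{p..q} \<subseteq> {a..b}" using pq by auto
    have "(f' has_integral (f q - f p)) {p..q}"
    proof (rule fundamental_theorem_of_calculus[OF pq(2)])
      fix x assume "x \<in> {p..q}"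
      hence "(f has_real_derivative f' x) (at x within {p..q})"
        using DERIV_subset[OF f sub] sub by blast
      thus "(f has_vector_derivative f' x) (at x within {p..q})"
        by (simp add: has_real_derivative_iff_has_vector_derivative)
    qed
    hence "((\<lambda>s. f' s * c) has_integral (f q - f p) * c) {p..q}"
      by (rule has_integral_mult_left)
    moreover have "((\<lambda>s. f' s * g s) has_integral integral {p..q} (\<lambda>s. f' s * g s)) {p..q}"
      using int(1)[OF sub] by (rule integrable_integral)
    ultimately have hi: "((\<lambda>s. f' s * c - f' s * g s) has_integral
        (f q - f p) * c - integral {p..q} (\<lambda>s. f' s * g s)) {p..q}"
      by (rule has_integral_diff)
    have "\<eta> \<ge> 0" using c[of p] pq by force
    have "norm ((f q - f p) * c - integral {p..q} (\<lambda>s. f' s * g s)) \<le> L * \<eta> * measure lborel {p..q}"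
    proof (rule has_integral_bound_real[OF _ _ hi])
      show "0 \<le> L * \<eta>" using L \<open>\<eta> \<ge> 0\<close> by simp
      show "finite {}" by simp
      fix s assume "s \<in> {p..q} - {}"
      hence s: "s \<in> {p..q}" by simp
      have "\<bar>f' s\<bar> * \<bar>g s - c\<bar> \<le> L * \<eta>"
        using L(2)[of s] c[OF s] s sub \<open>\<eta> \<ge> 0\<close> L(1) by (intro mult_mono) auto
      thus "norm (f' s * c - f' s * g s) \<le> L * \<eta>"
        by (simp add: abs_mult[symmetric] algebra_simps abs_minus_commute)
    qed
    thus ?thesis using pq by simp
  qed
  have split: "integral {a..v} (\<lambda>s. f' s * g s) - integral {a..u} (\<lambda>s. f' s * g s) =
      integral {u..v} (\<lambda>s. f' s * g s)" if "a \<le> u" "u \<le> v" "v \<le> b" for u v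
    using Henstock_Kurzweil_Integration.integral_combine[of a u v "\<lambda>s. f' s * g s"] that int(1)[of a v]
    by (auto simp: algebra_simps)
  have term_bound: "\<bar>f x * (g v - g u) - (\<Phi> v - \<Phi> u)\<bar> \<le> L * \<eta> * (v - u)"
    if x: "a \<le> u" "u \<le> x" "x \<le> v" "v \<le> b"
      and osc: "\<And>s t. s \<in> {u..v} \<Longrightarrow> t \<in> {u..v} \<Longrightarrow> \<bar>g s - g t\<bar> \<le> \<eta>" for u v x \<eta>
  proof -
    have A: "\<bar>(f v - f x) * g v - integral {x..v} (\<lambda>s. f' s * g s)\<bar> \<le> L * \<eta> * (v - x)"
      by (rule piece) (use x osc in auto)
    have B: "\<bar>(f x - f u) * g u - integral {u..x} (\<lambda>s. f' s * g s)\<bar> \<le> L * \<eta> * (x - u)"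
      by (rule piece) (use x osc in auto)
    have "f x * (g v - g u) - (\<Phi> v - \<Phi> u) =
       - ((f v - f x) * g v - integral {x..v} (\<lambda>s. f' s * g s))
       - ((f x - f u) * g u - integral {u..x} (\<lambda>s. f' s * g s))"
      using split[of u x] split[of x v] x unfolding \<Phi>_def by (simp add: algebra_simps)
    hence "\<bar>f x * (g v - g u) - (\<Phi> v - \<Phi> u)\<bar> \<le> L * \<eta> * (v - x) + L * \<eta> * (x - u)"
      using A B by linarith
    thus ?thesis by (simp add: algebra_simps)
  qed
  show ?thesis
    unfolding has_young_integral_def
  proof (intro allI impI)
    fix e :: real assume e: "e > 0"
    define \<eta> where "\<eta> = e / (2 * L * (b - a + 1))"
    have \<eta>: "\<eta> > 0" using e L ab by (simp add: \<eta>_def)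
    have "uniformly_continuous_on {a..b} g"
      using compact_uniformly_continuous[OF g] by simp
    then obtain d where d: "d > 0" "\<And>s t. s \<in> {a..b} \<Longrightarrow> t \<in> {a..b} \<Longrightarrow> \<bar>s - t\<bar> < d \<Longrightarrow> \<bar>g s - g t\<bar> < \<eta>"
      using \<eta> unfolding uniformly_continuous_on_def dist_real_def by metis
    show "\<exists>d>0. \<forall>p. p tagged_division_of {a..b} \<and> (\<forall>(x, K)\<in>p. Sup K - Inf K < d) \<longrightarrow>
        \<bar>(\<Sum>(x, K)\<in>p. f x * (g (Sup K) - g (Inf K))) -
          (f b * g b - f a * g a - integral {a..b} (\<lambda>s. f' s * g s))\<bar> < e"
    proof (intro exI[of _ d] conjI allI impI d(1))
      fix p assume "p tagged_division_of {a..b} \<and> (\<forall>(x, K)\<in>p. Sup K - Inf K < d)"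
      hence p: "p tagged_division_of {a..b}" and mesh: "\<And>x K. (x, K) \<in> p \<Longrightarrow> Sup K - Inf K < d"
        by auto
      have tot: "(\<Sum>(x, K)\<in>p. \<Phi> (Sup K) - \<Phi> (Inf K)) = f b * g b - f a * g a - integral {a..b} (\<lambda>s. f' s * g s)"
        using additive_tagged_division_1[OF ab p, of \<Phi>] by (simp add: \<Phi>_def)
      have len: "(\<Sum>(x, K)\<in>p. Sup K - Inf K) = b - a"
        using additive_tagged_division_1[OF ab p, of "\<lambda>x. x"] by simp
      have "\<bar>(\<Sum>(x, K)\<in>p. f x * (g (Sup K) - g (Inf K))) - (\<Sum>(x, K)\<in>p. \<Phi> (Sup K) - \<Phi> (Inf K))\<bar>
          = \<bar>\<Sum>(x, K)\<in>p. f x * (g (Sup K) - g (Inf K)) - (\<Phi> (Sup K) - \<Phi> (Inf K))\<bar>"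
        by (simp add: sum_subtractf split_def)
      also have "\<dots> \<le> (\<Sum>(x, K)\<in>p. L * \<eta> * (Sup K - Inf K))"
      proof (rule order_trans[OF sum_abs sum_mono])
        fix y assume y: "y \<in> p"
        obtain x K where xK: "y = (x, K)" by (cases y)
        with y have xp: "(x, K) \<in> p" by simp
        obtain u v where K: "K = {u..v}" using tagged_division_ofD(4)[OF p xp] by auto
        have x: "x \<in> {u..v}" using tagged_division_ofD(2)[OF p xp] K by simp
        have sub: "{u..v} \<subseteq> {a..b}" using tagged_division_ofD(3)[OF p xp] K by simp
        have uv: "u \<le> v" using x by simp
        have SI: "Sup K = v" "Inf K = u" using K uv by auto
        have "\<bar>f x * (g v - g u) - (\<Phi> v - \<Phi> u)\<bar> \<le> L * \<eta> * (v - u)"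
        proof (rule term_bound)
          fix s t assume st: "s \<in> {u..v}" "t \<in> {u..v}"
          hence "\<bar>s - t\<bar> < d" using mesh[OF xp] SI by auto
          thus "\<bar>g s - g t\<bar> \<le> \<eta>" using d(2)[of s t] st sub by auto
        qed (use x sub uv in auto)
        thus "\<bar>case y of (x, K) \<Rightarrow> f x * (g (Sup K) - g (Inf K)) - (\<Phi> (Sup K) - \<Phi> (Inf K))\<bar>
            \<le> (case y of (x, K) \<Rightarrow> L * \<eta> * (Sup K - Inf K))"
          by (simp add: xK SI)
      qed
      also have "\<dots> = L * \<eta> * (b - a)"
        unfolding len[symmetric] by (simp add: sum_distrib_left split_def)
      also have "\<dots> = (e / 2) * ((b - a) / (b - a + 1))"
        using L by (simp add: \<eta>_def)
      also have "\<dots> \<le> (e / 2) * 1"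
        using e ab by (intro mult_left_mono) (auto simp: field_simps)
      also have "\<dots> < e" using e by simp
      finally show "\<bar>(\<Sum>(x, K)\<in>p. f x * (g (Sup K) - g (Inf K))) -
          (f b * g b - f a * g a - integral {a..b} (\<lambda>s. f' s * g s))\<bar> < e"
        using tot by simp
    qed
  qed
qed

lemma young_integral_exp:
  fixes g :: "real \<Rightarrow> real"
  assumes "a \<le> b" "continuous_on {a..b} g"
  shows "young_integral (\<lambda>s. exp (\<theta> * s)) g a b =
           exp (\<theta> * b) * g b - exp (\<theta> * a) * g a - \<theta> * integral {a..b} (\<lambda>s. exp (\<theta> * s) * g s)"
proof -
  have "has_young_integral (\<lambda>s. exp (\<theta> * s)) g a b
      (exp (\<theta> * b) * g b - exp (\<theta> * a) * g a - integral {a..b} (\<lambda>s. (\<theta> * exp (\<theta> * s)) * g s))"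
    by (rule has_young_integral_by_parts)
       (use assms in \<open>auto intro!: derivative_eq_intros continuous_intros\<close>)
  thus ?thesis by (simp add: young_integral_eqI mult.assoc)
qed


section \<open>Ornstein--Uhlenbeck processes\<close>

definition OU :: "real \<Rightarrow> (real \<Rightarrow> 'a \<Rightarrow> real) \<Rightarrow> real \<Rightarrow> 'a \<Rightarrow> real" where
  "OU \<theta> S t \<omega> = exp (- \<theta> * t) * young_integral (\<lambda>s. exp (\<theta> * s)) (\<lambda>s. S s \<omega>) 0 t"

text \<open>
  If \<open>S 0 \<omega> = 0\<close>, the next lemma is the formula
  \<open>X\<^sub>t = S\<^sub>t - \<theta> e\<^sup>-\<^sup>\<theta>\<^sup>t \<integral>\<^sub>0\<^sup>t e\<^sup>\<theta>\<^sup>s S\<^sub>s ds\<close>. A sub-fractional Brownian motion starts at 0 only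
  almost surely, because \<open>sub_fBm\<close> fixes just the second moment of \<open>S 0\<close>.
\<close>

lemma OU_eq:
  assumes "0 \<le> t" "continuous_on {0..} (\<lambda>s. S s \<omega>)"
  shows "OU \<theta> S t \<omega> = S t \<omega> - exp (- \<theta> * t) * S 0 \<omega>
           - \<theta> * exp (- \<theta> * t) * integral {0..t} (\<lambda>s. exp (\<theta> * s) * S s \<omega>)"
proof -
  have "continuous_on {0..t} (\<lambda>s. S s \<omega>)"
    using assms(2) by (rule continuous_on_subset) auto
  from young_integral_exp[OF assms(1) this] show ?thesis
    by (simp add: OU_def right_diff_distrib flip: exp_add mult.assoc)
qed

text \<open>
  The Wiener integral over \<open>]-\<infinity>, t]\<close> is the mean-square limit, as \<open>a\<close> tends to \<open>-\<infinity>\<close>, of the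
  integrals over \<open>[a, t]\<close>. It determines \<open>Z t\<close> up to a null set.
\<close>

definition stationary_fOU ::
    "'a measure \<Rightarrow> real \<Rightarrow> (real \<Rightarrow> 'a \<Rightarrow> real) \<Rightarrow> (real \<Rightarrow> 'a \<Rightarrow> real) \<Rightarrow> bool" where
  "stationary_fOU M \<theta> B Z \<longleftrightarrow>
     (\<forall>t. Z t \<in> borel_measurable M \<and>
       ((\<lambda>a. \<integral>\<^sup>+\<omega>. ennreal ((Z t \<omega> -
            exp (- \<theta> * t) * young_integral (\<lambda>u. exp (\<theta> * u)) (\<lambda>u. B u \<omega>) a t)\<^sup>2) \<partial>M)
         \<longlongrightarrow> 0) at_bot)"

definition autocov :: "'a measure \<Rightarrow> (real \<Rightarrow> 'a \<Rightarrow> real) \<Rightarrow> int \<Rightarrow> real" where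
  "autocov M Z k = integral\<^sup>L M (\<lambda>\<omega>. Z (of_int k) \<omega> * Z 0 \<omega>)"


section \<open>Quadratic functionals\<close>

definition V :: "'a measure \<Rightarrow> (real \<Rightarrow> 'a \<Rightarrow> real) \<Rightarrow> nat \<Rightarrow> 'a \<Rightarrow> real" where
  "V M X n \<omega> = 1 / sqrt (real n) *
     (\<Sum>i=1..n. (X (real i) \<omega>)\<^sup>2 - integral\<^sup>L M (\<lambda>\<omega>'. (X (real i) \<omega>')\<^sup>2))"

definition sigma_sq :: "(int \<Rightarrow> real) \<Rightarrow> real" where
  "sigma_sq \<rho> = 2 * (\<rho> 0)\<^sup>2 + 2 * (\<Sum>\<^sub>\<infinity>i\<in>UNIV - {0}. (\<rho> i)\<^sup>2)"

text \<open>Only meaningful for \<open>0 < \<alpha> < 3/4\<close>.\<close>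

definition psi :: "real \<Rightarrow> nat \<Rightarrow> real" where
  "psi \<alpha> n = (if \<alpha> < 1 / 2 then 1 / real n else real n powr (4 * \<alpha> - 3))"

end

theory Submission
  imports Defs "HOL-Real_Asymp.Real_Asymp"
begin

text \<open>
  Write \<open>X\<^sub>t = L\<^sub>t S\<close> with the linear functional
  \<open>L\<^sub>t f = f t - e\<^bsup>-\<theta>t\<^esup> f 0 - \<theta> \<integral>\<^sub>0\<^sup>t e\<^bsup>-\<theta>(t-u)\<^esup> f u du\<close>. It is a pointwise limit of finite linear
  combinations of evaluations, so \<open>X\<close> is Gaussian with covariance \<open>R(s,t)\<close> obtained by applying \<open>L\<^sub>s\<close> and
  \<open>L\<^sub>t\<close> to the covariance of \<open>S\<close>, and Wick's formula gives \<open>E[V\<^sub>n\<^sup>2] = (2/n) \<Sum>\<^sub>i\<^sub>j R(i,j)\<^sup>2\<close>.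

  The functional \<open>L\<^sub>t\<close> annihilates constants, and on a function of \<open>u \<plusminus> v\<close> it acts through the two one-sided
  filters \<open>A\<^sub>\<sigma> g w = g w - \<theta> \<integral>\<^sub>0\<^sup>\<infinity> e\<^bsup>-\<theta>x\<^esup> g (w + \<sigma> x) dx\<close>. With \<open>h w = |w|\<^bsup>2H\<^esup>\<close>,
  \<open>\<rho> = - A\<^sub>- A\<^sub>+ h / 2\<close> and \<open>\<kappa> = - A\<^sub>- A\<^sub>- h / 2\<close>, the covariance \<open>R(s,t)\<close> is
  \<open>\<rho>(s - t) + \<kappa>(s + t)\<close> up to terms that decay exponentially in \<open>s\<close> or in \<open>t\<close>, and the same computation on
  \<open>[a, t]\<close> with \<open>a \<rightarrow> -\<infinity>\<close> identifies \<open>\<rho>\<close> with the autocovariance of \<open>Z\<close>. The filters preserve the classes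
  \<open>O((1 + w\<^sup>2)\<^sup>b)\<close> and differentiate, which yields \<open>\<rho>(w) = H(2H-1) \<theta>\<^sup>-\<^sup>2 (1 + w\<^sup>2)\<^bsup>H-1\<^esup> + O((1 + w\<^sup>2)\<^bsup>H-3/2\<^esup>)\<close>
  and the same bound for \<open>\<kappa>\<close>. The rest is the summation of powers.
\<close>

section \<open>Centred Gaussian random variables\<close>

text \<open>Two obstacles shape the proof. The kernel |w|^(2H) is not smooth at 0, while the decay
  of \<rho> rests on integration by parts; hence the detour through a smooth function. And X is not
  stationary: the correction \<kappa>(s + t) is controlled only by the same power as \<rho>, so it
  has to be summed, not discarded. The weights 1 + w^2 are chosen for Peetre's inequality: a shift
  by x costs a factor polynomial in x, which the exponential of a filter absorbs. A filter is a
  smoothed derivative, so two of them turn |w|^(2H) into its second derivative, of size |w|^(2H-2).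
  With \<gamma> = 1 - H (but \<gamma> = 1 at H = 1/2) two errors remain: the nonstationary one, of
  order (sum k^(-2\<gamma>))^2 / n, and the Cesaro error of the stationary part, of order sum
  k^(1-4\<gamma>) / n. Both are O(\<open>psi H n\<close>). At H = 3/4 the first is bounded, while
  the sum of \<rho>(k)^2 grows like a logarithm; 9/16 = 2 * 2 * (3/8)^2 collects the Wick factor,
  the two signs of k, and H (2H - 1) = 3/8.\<close>

lemma integral_mult_le_of_squares:
  fixes U V :: "'a \<Rightarrow> real"
  assumes [measurable]: "U \<in> borel_measurable M" "V \<in> borel_measurable M"
    and i: "integrable M (\<lambda>\<omega>. (U \<omega>)\<^sup>2)" "integrable M (\<lambda>\<omega>. (V \<omega>)\<^sup>2)" and r: "r > 0"
  shows "integrable M (\<lambda>\<omega>. U \<omega> * V \<omega>)"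
    and "\<bar>integral\<^sup>L M (\<lambda>\<omega>. U \<omega> * V \<omega>)\<bar> \<le> (integral\<^sup>L M (\<lambda>\<omega>. (U \<omega>)\<^sup>2) / r + r * integral\<^sup>L M (\<lambda>\<omega>. (V \<omega>)\<^sup>2)) / 2"
proof -
  \<comment> \<open>Weighted AM-GM. The free weight \<open>r\<close> later allows a vanishing second
    moment to be paired with a bounded one: first the moment tends to 0 at fixed \<open>r\<close>,
    then \<open>r\<close> does.\<close>
  have pw: "\<bar>u * v\<bar> \<le> (u\<^sup>2 / r + r * v\<^sup>2) / 2" for u v :: real
  proof -
    have "2 * \<bar>u\<bar> * (r * \<bar>v\<bar>) \<le> \<bar>u\<bar>\<^sup>2 + (r * \<bar>v\<bar>)\<^sup>2" by (rule sum_squares_bound)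
    thus ?thesis using r by (simp add: abs_mult power_mult_distrib field_simps power2_eq_square)
  qed
  have iB: "integrable M (\<lambda>\<omega>. ((U \<omega>)\<^sup>2 / r + r * (V \<omega>)\<^sup>2) / 2)" using i by simp
  show int: "integrable M (\<lambda>\<omega>. U \<omega> * V \<omega>)"
  proof (rule Bochner_Integration.integrable_bound[OF iB])
    show "AE \<omega> in M. norm (U \<omega> * V \<omega>) \<le> norm (((U \<omega>)\<^sup>2 / r + r * (V \<omega>)\<^sup>2) / 2)"
      unfolding real_norm_def by (rule AE_I2) (rule order_trans[OF pw abs_ge_self])
  qed measurable
  have "\<bar>integral\<^sup>L M (\<lambda>\<omega>. U \<omega> * V \<omega>)\<bar> \<le> integral\<^sup>L M (\<lambda>\<omega>. \<bar>U \<omega> * V \<omega>\<bar>)"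
    by (rule integral_abs_bound)
  also have "\<dots> \<le> integral\<^sup>L M (\<lambda>\<omega>. ((U \<omega>)\<^sup>2 / r + r * (V \<omega>)\<^sup>2) / 2)"
    by (rule integral_mono) (use int iB pw in auto)
  finally show "\<bar>integral\<^sup>L M (\<lambda>\<omega>. U \<omega> * V \<omega>)\<bar> \<le> (integral\<^sup>L M (\<lambda>\<omega>. (U \<omega>)\<^sup>2) / r + r * integral\<^sup>L M (\<lambda>\<omega>. (V \<omega>)\<^sup>2)) / 2"
    using i by simp
qed

text \<open>Phrased by scaling a standard normal variable instead of by a density, so that
  \<open>v = 0\<close>, the point mass at 0, is included. Linear combinations of values of a process
  may degenerate in this way.\<close>

definition centred_normal :: "'a measure \<Rightarrow> ('a \<Rightarrow> real) \<Rightarrow> real \<Rightarrow> bool" where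
  "centred_normal M W v \<longleftrightarrow> W \<in> borel_measurable M \<and> 0 \<le> v \<and>
     distr M borel W = distr std_normal_distribution borel (\<lambda>x. sqrt v * x)"

lemma centred_normal_moments:
  assumes "centred_normal M W v"
  shows "integrable M (\<lambda>\<omega>. W \<omega> ^ k)"
    and "integral\<^sup>L M (\<lambda>\<omega>. W \<omega> ^ (2 * k)) = v ^ k * (fact (2 * k) / (2 ^ k * fact k))"
proof -
  have [measurable]: "W \<in> borel_measurable M" and v: "v \<ge> 0"
    and eq: "distr M borel W = distr std_normal_distribution borel (\<lambda>x. sqrt v * x)"
    using assms by (auto simp: centred_normal_def)
  have "integrable std_normal_distribution (\<lambda>x. (sqrt v * x) ^ k)" for k
    using integrable_mult_right[OF integrable_std_normal_moment[of k], of "sqrt v ^ k"]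
    by (subst integrable_density) (auto simp: power_mult_distrib mult_ac)
  hence "integrable (distr M borel W) (\<lambda>x. x ^ k)" for k
    unfolding eq by (subst integrable_distr_eq) auto
  thus int: "integrable M (\<lambda>\<omega>. W \<omega> ^ k)" for k
    by (subst (asm) integrable_distr_eq) auto
  have val: "integral\<^sup>L M (\<lambda>\<omega>. W \<omega> ^ k) = sqrt v ^ k * (LBINT x. std_normal_density x * x ^ k)" for k
  proof -
    have "integral\<^sup>L M (\<lambda>\<omega>. W \<omega> ^ k) = integral\<^sup>L (distr M borel W) (\<lambda>x. x ^ k)"
      by (subst integral_distr) auto
    also have "\<dots> = integral\<^sup>L std_normal_distribution (\<lambda>x. (sqrt v * x) ^ k)"
      unfolding eq by (subst integral_distr) auto
    also have "\<dots> = (LBINT x. std_normal_density x * (sqrt v * x) ^ k)"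
      by (subst integral_density) auto
    also have "\<dots> = (LBINT x. sqrt v ^ k * (std_normal_density x * x ^ k))"
      by (simp add: power_mult_distrib mult_ac)
    finally show ?thesis by simp
  qed
  show "integral\<^sup>L M (\<lambda>\<omega>. W \<omega> ^ (2 * k)) = v ^ k * (fact (2 * k) / (2 ^ k * fact k))"
    using val[of "2 * k"] v unfolding integral_std_normal_moment_even by (simp add: power_mult)
qed

lemma char_scaled_std_normal:
  assumes "0 \<le> v"
  shows "char (distr std_normal_distribution borel (\<lambda>x. sqrt v * x)) t = exp (- v * t\<^sup>2 / 2)"
proof -
  have "char (distr std_normal_distribution borel (\<lambda>x. sqrt v * x)) t
      = char std_normal_distribution (t * sqrt v)"
    unfolding char_def by (subst integral_distr) (auto simp: mult.assoc)
  moreover have "(t * sqrt v)\<^sup>2 = v * t\<^sup>2" using assms by (simp add: power_mult_distrib)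
  ultimately show ?thesis by (simp only: char_std_normal_distribution minus_mult_left)
qed

lemma (in prob_space) centred_normal_iff_char:
  assumes [measurable]: "W \<in> borel_measurable M" and "0 \<le> v"
  shows "centred_normal M W v \<longleftrightarrow> (\<forall>t. char (distr M borel W) t = exp (- v * t\<^sup>2 / 2))"
proof -
  have "prob_space std_normal_distribution"
    by (rule prob_space_normal_density) simp
  then have "real_distribution (distr std_normal_distribution borel (\<lambda>x. sqrt v * x))"
    by (intro prob_space.real_distribution_distr) auto
  moreover have "real_distribution (distr M borel W)"
    by (intro real_distribution_distr) auto
  ultimately have "distr M borel W = distr std_normal_distribution borel (\<lambda>x. sqrt v * x) \<longleftrightarrow>
      char (distr M borel W) = char (distr std_normal_distribution borel (\<lambda>x. sqrt v * x))"
    using Levy_uniqueness by auto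
  thus ?thesis
    using assms by (simp add: centred_normal_def char_scaled_std_normal fun_eq_iff)
qed

lemma (in prob_space) centred_normal_gaussian_rv:
  assumes "gaussian_rv M W" "expectation W = 0"
  shows "centred_normal M W (expectation (\<lambda>\<omega>. (W \<omega>)\<^sup>2))"
  using assms(1) unfolding gaussian_rv_def
proof (elim disjE exE conjE)
  fix \<mu> \<sigma> :: real
  assume \<sigma>: "0 < \<sigma>" and d: "distributed M lborel W (\<lambda>x. ennreal (normal_density \<mu> \<sigma> x))"
  have [measurable]: "W \<in> borel_measurable M" using d by (simp add: distributed_def)
  have \<mu>: "\<mu> = 0" using normal_distributed_expectation[OF \<sigma> d] assms(2) by simp
  have v: "expectation (\<lambda>\<omega>. (W \<omega>)\<^sup>2) = \<sigma>\<^sup>2"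
    using normal_distributed_variance[OF \<sigma> d] assms(2) by simp
  have "distributed M lborel (\<lambda>\<omega>. W \<omega> / \<sigma>) (\<lambda>x. ennreal (std_normal_density x))"
    using normal_standard_normal_convert[OF \<sigma>, of W \<mu>] d \<mu> by simp
  hence s: "distr M lborel (\<lambda>\<omega>. W \<omega> / \<sigma>) = std_normal_distribution"
    by (simp add: distributed_def)
  have "distr M borel W = distr M borel ((\<lambda>x. \<sigma> * x) \<circ> (\<lambda>\<omega>. W \<omega> / \<sigma>))"
    using \<sigma> by (simp add: comp_def)
  also have "\<dots> = distr (distr M lborel (\<lambda>\<omega>. W \<omega> / \<sigma>)) borel (\<lambda>x. \<sigma> * x)"
    by (subst distr_distr) auto
  finally show ?thesis
    using \<sigma> by (simp add: centred_normal_def v s)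
next
  fix \<mu> assume [measurable]: "W \<in> borel_measurable M" and ae: "AE \<omega> in M. W \<omega> = \<mu>"
  have "expectation W = expectation (\<lambda>_. \<mu>)"
    by (rule integral_cong_AE) (use ae in auto)
  hence ae: "AE \<omega> in M. W \<omega> = 0" using ae assms(2) by (simp add: prob_space)
  have v: "expectation (\<lambda>\<omega>. (W \<omega>)\<^sup>2) = 0"
    by (rule integral_eq_zero_AE) (use ae in auto)
  have "char (distr M borel W) t = 1" for t
  proof -
    have "char (distr M borel W) t = (CLINT \<omega>|M. iexp (t * W \<omega>))"
      unfolding char_def by (subst integral_distr) auto
    also have "\<dots> = (CLINT \<omega>|M. 1)"
      by (rule integral_cong_AE) (use ae in auto)
    finally show ?thesis by (simp add: prob_space)
  qed
  thus ?thesis by (simp add: v centred_normal_iff_char)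
qed

text \<open>The integrands of the characteristic functions have modulus 1, so dominated convergence
  carries the pointwise limit over to the law, and exp(-v t^2 / 2) is continuous in v.\<close>

lemma (in prob_space) centred_normal_limit:
  assumes W: "\<And>m. centred_normal M (W m) (v m)"
    and lim: "\<And>\<omega>. \<omega> \<in> space M \<Longrightarrow> (\<lambda>m. W m \<omega>) \<longlonglongrightarrow> Y \<omega>" and v: "v \<longlonglongrightarrow> v'"
  shows "centred_normal M Y v'"
proof -
  have [measurable]: "W m \<in> borel_measurable M" and vm: "v m \<ge> 0" for m
    using W by (auto simp: centred_normal_def)
  have [measurable]: "Y \<in> borel_measurable M"
    by (rule borel_measurable_LIMSEQ_real[OF lim]) auto
  have v': "v' \<ge> 0" using LIMSEQ_le_const[OF v] vm by auto
  have "char (distr M borel Y) t = exp (- v' * t\<^sup>2 / 2)" for t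
  proof -
    have "(\<lambda>m. CLINT \<omega>|M. iexp (t * W m \<omega>)) \<longlonglongrightarrow> (CLINT \<omega>|M. iexp (t * Y \<omega>))"
      by (rule integral_dominated_convergence[where w = "\<lambda>_. 1"])
         (auto intro!: AE_I2 tendsto_intros lim)
    moreover have "(CLINT \<omega>|M. iexp (t * W m \<omega>)) = exp (- v m * t\<^sup>2 / 2)" for m
      using W[of m] vm[of m] unfolding centred_normal_iff_char[OF \<open>W m \<in> _\<close> vm] char_def
      by (subst (asm) integral_distr) auto
    ultimately have "(\<lambda>m. complex_of_real (exp (- v m * t\<^sup>2 / 2))) \<longlonglongrightarrow> (CLINT \<omega>|M. iexp (t * Y \<omega>))"
      by simp
    moreover have "(\<lambda>m. complex_of_real (exp (- v m * t\<^sup>2 / 2))) \<longlonglongrightarrow> complex_of_real (exp (- v' * t\<^sup>2 / 2))"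
      by (intro tendsto_intros v) simp
    ultimately have "(CLINT \<omega>|M. iexp (t * Y \<omega>)) = complex_of_real (exp (- v' * t\<^sup>2 / 2))"
      by (rule LIMSEQ_unique)
    thus ?thesis unfolding char_def by (subst integral_distr) auto
  qed
  thus ?thesis using v' by (simp add: centred_normal_iff_char)
qed

text \<open>Cramer-Wold form with covariance matrix entries \<open>a\<close>, \<open>b\<close>
  (variances) and \<open>c\<close>. It matches \<open>gaussian_process\<close>, which also speaks of
  linear combinations, and it gives the fourth moments of X + Y and X - Y at once.\<close>

definition jointly_normal :: "'a measure \<Rightarrow> ('a \<Rightarrow> real) \<Rightarrow> ('a \<Rightarrow> real) \<Rightarrow> real \<Rightarrow> real \<Rightarrow> real \<Rightarrow> bool" where
  "jointly_normal M X Y a b c \<longleftrightarrow>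
     (\<forall>x y. centred_normal M (\<lambda>\<omega>. x * X \<omega> + y * Y \<omega>) (x\<^sup>2 * a + y\<^sup>2 * b + 2 * x * y * c))"

lemma (in prob_space) jointly_normalD:
  assumes "jointly_normal M X Y a b c"
  shows "integrable M (\<lambda>\<omega>. (X \<omega>)\<^sup>2)" "integrable M (\<lambda>\<omega>. X \<omega> * Y \<omega>)"
    and "expectation (\<lambda>\<omega>. (X \<omega>)\<^sup>2) = a" "expectation (\<lambda>\<omega>. X \<omega> * Y \<omega>) = c"
    and "X \<in> borel_measurable M" "Y \<in> borel_measurable M"
proof -
  have n: "centred_normal M (\<lambda>\<omega>. x * X \<omega> + y * Y \<omega>) (x\<^sup>2 * a + y\<^sup>2 * b + 2 * x * y * c)" for x y
    using assms by (simp add: jointly_normal_def)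
  have X: "centred_normal M X a" and Y: "centred_normal M Y b" and XY: "centred_normal M (\<lambda>\<omega>. X \<omega> + Y \<omega>) (a + b + 2 * c)"
    using n[of 1 0] n[of 0 1] n[of 1 1] by simp_all
  have i: "integrable M (\<lambda>\<omega>. (X \<omega>)\<^sup>2)" "integrable M (\<lambda>\<omega>. (Y \<omega>)\<^sup>2)" "integrable M (\<lambda>\<omega>. (X \<omega> + Y \<omega>)\<^sup>2)"
    using centred_normal_moments(1)[of M _ _ 2] X Y XY by blast+
  have e: "expectation (\<lambda>\<omega>. (X \<omega>)\<^sup>2) = a" "expectation (\<lambda>\<omega>. (Y \<omega>)\<^sup>2) = b"
       "expectation (\<lambda>\<omega>. (X \<omega> + Y \<omega>)\<^sup>2) = a + b + 2 * c"
    using centred_normal_moments(2)[of M _ _ 1] X Y XY by force+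
  have p: "(\<lambda>\<omega>. X \<omega> * Y \<omega>) = (\<lambda>\<omega>. ((X \<omega> + Y \<omega>)\<^sup>2 - (X \<omega>)\<^sup>2 - (Y \<omega>)\<^sup>2) / 2)"
    by (auto simp: power2_eq_square algebra_simps)
  show "integrable M (\<lambda>\<omega>. X \<omega> * Y \<omega>)" "expectation (\<lambda>\<omega>. X \<omega> * Y \<omega>) = c"
    unfolding p using i by (auto simp: e)
  show "integrable M (\<lambda>\<omega>. (X \<omega>)\<^sup>2)" "expectation (\<lambda>\<omega>. (X \<omega>)\<^sup>2) = a"
    using i e by auto
  show "X \<in> borel_measurable M" "Y \<in> borel_measurable M" using X Y by (auto simp: centred_normal_def)
qed

text \<open>Wick's formula for \<open>X\<^sup>2 Y\<^sup>2\<close> follows from the fourth moments of \<open>X \<plusminus> Y\<close> by polarization.\<close>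

lemma (in prob_space) jointly_normal_covariance_squares:
  assumes "jointly_normal M X Y a b c"
  shows "integrable M (\<lambda>\<omega>. ((X \<omega>)\<^sup>2 - a) * ((Y \<omega>)\<^sup>2 - b))"
    and "expectation (\<lambda>\<omega>. ((X \<omega>)\<^sup>2 - a) * ((Y \<omega>)\<^sup>2 - b)) = 2 * c\<^sup>2"
proof -
  have n: "centred_normal M (\<lambda>\<omega>. x * X \<omega> + y * Y \<omega>) (x\<^sup>2 * a + y\<^sup>2 * b + 2 * x * y * c)" for x y
    using assms by (simp add: jointly_normal_def)
  have i2: "integrable M (\<lambda>\<omega>. (x * X \<omega> + y * Y \<omega>)\<^sup>2)" for x y
    by (rule centred_normal_moments(1)[OF n])
  have i4: "integrable M (\<lambda>\<omega>. (x * X \<omega> + y * Y \<omega>) ^ 4)" for x y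
    by (rule centred_normal_moments(1)[OF n])
  have e2: "expectation (\<lambda>\<omega>. (x * X \<omega> + y * Y \<omega>)\<^sup>2) = x\<^sup>2 * a + y\<^sup>2 * b + 2 * x * y * c" for x y
    using centred_normal_moments(2)[OF n[of x y], of 1] by simp
  have e4: "expectation (\<lambda>\<omega>. (x * X \<omega> + y * Y \<omega>) ^ 4) = 3 * (x\<^sup>2 * a + y\<^sup>2 * b + 2 * x * y * c)\<^sup>2" for x y
    using centred_normal_moments(2)[OF n[of x y], of 2] by (simp add: fact_numeral)
  have i: "integrable M (\<lambda>\<omega>. (X \<omega>)\<^sup>2)" "integrable M (\<lambda>\<omega>. (Y \<omega>)\<^sup>2)" "integrable M (\<lambda>\<omega>. X \<omega> ^ 4)"
    "integrable M (\<lambda>\<omega>. Y \<omega> ^ 4)" "integrable M (\<lambda>\<omega>. (X \<omega> + Y \<omega>) ^ 4)" "integrable M (\<lambda>\<omega>. (X \<omega> - Y \<omega>) ^ 4)"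
    using i2[of 1 0] i2[of 0 1] i4[of 1 0] i4[of 0 1] i4[of 1 1] i4[of 1 "-1"] by simp_all
  have e: "expectation (\<lambda>\<omega>. (X \<omega>)\<^sup>2) = a" "expectation (\<lambda>\<omega>. (Y \<omega>)\<^sup>2) = b" "expectation (\<lambda>\<omega>. X \<omega> ^ 4) = 3 * a\<^sup>2"
    "expectation (\<lambda>\<omega>. Y \<omega> ^ 4) = 3 * b\<^sup>2" "expectation (\<lambda>\<omega>. (X \<omega> + Y \<omega>) ^ 4) = 3 * (a + b + 2 * c)\<^sup>2"
    "expectation (\<lambda>\<omega>. (X \<omega> - Y \<omega>) ^ 4) = 3 * (a + b - 2 * c)\<^sup>2"
    using e2[of 1 0] e2[of 0 1] e4[of 1 0] e4[of 0 1] e4[of 1 1] e4[of 1 "-1"] by simp_all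
  have p: "(\<lambda>\<omega>. ((X \<omega>)\<^sup>2 - a) * ((Y \<omega>)\<^sup>2 - b)) =
     (\<lambda>\<omega>. ((X \<omega> + Y \<omega>) ^ 4 + (X \<omega> - Y \<omega>) ^ 4 - 2 * X \<omega> ^ 4 - 2 * Y \<omega> ^ 4) / 12 - b * (X \<omega>)\<^sup>2 - a * (Y \<omega>)\<^sup>2 + a * b)"
    by (auto simp: power2_eq_square power4_eq_xxxx algebra_simps)
  show "integrable M (\<lambda>\<omega>. ((X \<omega>)\<^sup>2 - a) * ((Y \<omega>)\<^sup>2 - b))"
    unfolding p using i by auto
  show "expectation (\<lambda>\<omega>. ((X \<omega>)\<^sup>2 - a) * ((Y \<omega>)\<^sup>2 - b)) = 2 * c\<^sup>2"
    unfolding p using i by (simp add: e prob_space) (simp add: power2_eq_square algebra_simps)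
qed

section \<open>Polynomial growth and one-sided Laplace averages\<close>

text \<open>The exponent \<open>b\<close> stands for size |w|^(2b) at infinity. The weight is smooth
  and positive at 0, so the same scale serves the kernel (\<open>b = H\<close>) and its decaying
  covariance (\<open>b = H - 1\<close>).\<close>

definition growth :: "real \<Rightarrow> (real \<Rightarrow> real) \<Rightarrow> bool" where
  "growth b f \<longleftrightarrow> f \<in> borel_measurable borel \<and> (\<exists>C. \<forall>w. \<bar>f w\<bar> \<le> C * (1 + w\<^sup>2) powr b)"

lemma growth_measurable [measurable_dest]: "growth b f \<Longrightarrow> f \<in> borel_measurable borel"
  by (simp add: growth_def)

lemma growthI:
  "f \<in> borel_measurable borel \<Longrightarrow> (\<And>w. \<bar>f w\<bar> \<le> C * (1 + w\<^sup>2) powr b) \<Longrightarrow> growth b f"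
  by (auto simp: growth_def)

lemma growthE:
  assumes "growth b f"
  obtains C where "C > 0" "\<And>w. \<bar>f w\<bar> \<le> C * (1 + w\<^sup>2) powr b"
proof -
  obtain C where C: "\<And>w. \<bar>f w\<bar> \<le> C * (1 + w\<^sup>2) powr b"
    using assms by (auto simp: growth_def)
  have "\<bar>f w\<bar> \<le> (\<bar>C\<bar> + 1) * (1 + w\<^sup>2) powr b" for w
    by (rule order_trans[OF C]) (intro mult_right_mono, auto)
  thus ?thesis using that[of "\<bar>C\<bar> + 1"] by simp
qed

lemma growth_mono:
  assumes "growth b f" "b \<le> b'"
  shows "growth b' f"
proof -
  obtain C where C: "C > 0" "\<And>w. \<bar>f w\<bar> \<le> C * (1 + w\<^sup>2) powr b"
    using growthE[OF assms(1)] by blast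
  have "\<bar>f w\<bar> \<le> C * (1 + w\<^sup>2) powr b'" for w
    using C(2)[of w] C(1) powr_mono[OF assms(2), of "1 + w\<^sup>2"]
    by (meson mult_left_mono order_trans less_imp_le le_add_same_cancel1 zero_le_power2)
  thus ?thesis using growth_measurable[OF assms(1)] by (rule growthI[rotated])
qed

lemma growth_add:
  assumes "growth b f" "growth b g"
  shows "growth b (\<lambda>w. f w + g w)"
proof -
  obtain C D where "\<And>w. \<bar>f w\<bar> \<le> C * (1 + w\<^sup>2) powr b" "\<And>w. \<bar>g w\<bar> \<le> D * (1 + w\<^sup>2) powr b"
    using assms by (auto simp: growth_def)
  hence "\<bar>f w + g w\<bar> \<le> (C + D) * (1 + w\<^sup>2) powr b" for w
    unfolding distrib_right by (rule order_trans[OF abs_triangle_ineq add_mono])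
  thus ?thesis using assms by (intro growthI) (auto simp: growth_def)
qed

lemma growth_cmult:
  assumes "growth b f"
  shows "growth b (\<lambda>w. c * f w)"
proof -
  obtain C where "\<And>w. \<bar>f w\<bar> \<le> C * (1 + w\<^sup>2) powr b" using assms by (auto simp: growth_def)
  hence "\<bar>c * f w\<bar> \<le> (\<bar>c\<bar> * C) * (1 + w\<^sup>2) powr b" for w
    unfolding abs_mult mult.assoc by (intro mult_left_mono) auto
  thus ?thesis using assms by (intro growthI) (auto simp: growth_def)
qed

lemma growth_diff: "growth b f \<Longrightarrow> growth b g \<Longrightarrow> growth b (\<lambda>w. f w - g w)"
  using growth_add[of b f "\<lambda>w. - 1 * g w"] growth_cmult[of b g "- 1"] by simp

lemma growth_powr: "growth b (\<lambda>w. (1 + w\<^sup>2) powr b)"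
  by (rule growthI[of _ 1]) auto

text \<open>Peetre's inequality: moving the argument changes the weight at most by a polynomial
  factor in the displacement, for either sign of \<open>b\<close>. Negative exponents follow from
  the same estimate with u and v exchanged.\<close>

lemma peetre:
  fixes u v :: real
  shows "(1 + u\<^sup>2) powr b \<le> (2 * (1 + (u - v)\<^sup>2)) powr \<bar>b\<bar> * (1 + v\<^sup>2) powr b"
proof -
  have le: "1 + u\<^sup>2 \<le> 2 * (1 + (u - v)\<^sup>2) * (1 + v\<^sup>2)" for u v :: real
  proof -
    have "u\<^sup>2 \<le> 2 * (u - v)\<^sup>2 + 2 * v\<^sup>2"
      \<comment> \<open>The difference of the two sides is exactly (u - 2 v)^2.\<close>
      using zero_le_power2[of "u - 2 * v"] by (simp add: power2_eq_square algebra_simps)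
    moreover have "0 \<le> (u - v)\<^sup>2 * v\<^sup>2" by simp
    moreover have "2 * (1 + (u - v)\<^sup>2) * (1 + v\<^sup>2) = 2 + 2 * (u - v)\<^sup>2 + 2 * v\<^sup>2 + 2 * ((u - v)\<^sup>2 * v\<^sup>2)"
      by (simp add: algebra_simps)
    ultimately show ?thesis by linarith
  qed
  show ?thesis
  proof (cases "b \<ge> 0")
    case True
    have "(1 + u\<^sup>2) powr b \<le> (2 * (1 + (u - v)\<^sup>2) * (1 + v\<^sup>2)) powr b"
      by (rule powr_mono2) (use True le in auto)
    thus ?thesis using True by (simp add: powr_mult)
  next
    case False
    have "(1 + v\<^sup>2) powr (- b) \<le> (2 * (1 + (v - u)\<^sup>2) * (1 + u\<^sup>2)) powr (- b)"
      by (rule powr_mono2) (use False le in auto)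
    also have "\<dots> = (2 * (1 + (u - v)\<^sup>2)) powr (- b) * (1 + u\<^sup>2) powr (- b)"
      by (simp add: powr_mult power2_commute)
    finally have "inverse ((1 + v\<^sup>2) powr b) \<le> (2 * (1 + (u - v)\<^sup>2)) powr (- b) * inverse ((1 + u\<^sup>2) powr b)"
      by (simp only: powr_minus)
    moreover have "0 < (1 + u\<^sup>2) powr b" "0 < (1 + v\<^sup>2) powr b"
      by (simp_all add: add_pos_nonneg less_imp_neq[THEN not_sym])
    ultimately show ?thesis using False by (simp add: field_simps del: powr_gt_zero)
  qed
qed

lemma exp_poly_bound:
  fixes \<theta> c :: real
  assumes "\<theta> > 0"
  obtains K where "K > 0" "\<And>x. x \<ge> 0 \<Longrightarrow> exp (- \<theta> * x) * (1 + x\<^sup>2) powr c \<le> K * exp (- (x * (\<theta> / 2)))"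
proof -
  define d where "d = max c 1"
  \<comment> \<open>With this rate (exp(\<delta> x))^d = exp(\<theta> x / 2): half of the
    exponential decay pays for the polynomial, the other half is kept.\<close>
  define \<delta> where "\<delta> = \<theta> / (2 * d)"
  have d: "d > 0" "c \<le> d" and \<delta>: "\<delta> > 0" using assms by (auto simp: d_def \<delta>_def)
  define K where "K = (1 + 2 / \<delta>\<^sup>2) powr d"
  have bd: "exp (- \<theta> * x) * (1 + x\<^sup>2) powr c \<le> K * exp (- (x * (\<theta> / 2)))" if x: "x \<ge> 0" for x
  proof -
    have "1 + \<delta> * x + (\<delta> * x)\<^sup>2 / 2 \<le> exp (\<delta> * x)"
      by (rule exp_lower_Taylor_quadratic) (use x \<delta> in auto)
    moreover have "\<delta> * x \<ge> 0" using x \<delta> by simp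
    ultimately have "(\<delta> * x)\<^sup>2 / 2 \<le> exp (\<delta> * x)" by linarith
    hence "x\<^sup>2 \<le> 2 / \<delta>\<^sup>2 * exp (\<delta> * x)" using \<delta> by (simp add: power_mult_distrib field_simps)
    moreover have "1 \<le> exp (\<delta> * x)" using \<open>\<delta> * x \<ge> 0\<close> by simp
    ultimately have "1 + x\<^sup>2 \<le> (1 + 2 / \<delta>\<^sup>2) * exp (\<delta> * x)"
      unfolding distrib_right mult_1 by (rule add_mono[rotated])
    hence "(1 + x\<^sup>2) powr d \<le> ((1 + 2 / \<delta>\<^sup>2) * exp (\<delta> * x)) powr d"
      by (intro powr_mono2) (use d in auto)
    also have "\<dots> = K * exp (\<theta> / 2 * x)"
      using d by (simp add: K_def \<delta>_def powr_mult exp_powr_real)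
    finally have "(1 + x\<^sup>2) powr d \<le> K * exp (\<theta> / 2 * x)" .
    moreover have "(1 + x\<^sup>2) powr c \<le> (1 + x\<^sup>2) powr d" using d by (intro powr_mono) auto
    ultimately have "exp (- \<theta> * x) * (1 + x\<^sup>2) powr c \<le> exp (- \<theta> * x) * (K * exp (\<theta> / 2 * x))"
      by (intro mult_left_mono) auto
    also have "\<dots> = K * exp (- \<theta> * x + \<theta> / 2 * x)" by (simp only: exp_add mult_ac)
    also have "- \<theta> * x + \<theta> / 2 * x = - (x * (\<theta> / 2))" by (simp add: algebra_simps)
    finally show ?thesis .
  qed
  have "1 + 2 / \<delta>\<^sup>2 > 0" by (simp add: add_pos_nonneg)
  hence "K > 0" by (simp add: K_def)
  thus ?thesis using bd by (rule that)
qed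

lemma integrable_exp_poly:
  fixes \<theta> c :: real
  assumes "\<theta> > 0"
  shows "set_integrable lborel {0<..} (\<lambda>x. exp (- \<theta> * x) * (1 + x\<^sup>2) powr c)"
proof -
  obtain K where K: "K > 0" and bd: "\<And>x. x \<ge> 0 \<Longrightarrow> exp (- \<theta> * x) * (1 + x\<^sup>2) powr c \<le> K * exp (- (x * (\<theta> / 2)))"
    using exp_poly_bound[OF assms] by blast
  have "set_integrable lborel {0<..} (\<lambda>x. K * exp (- (x * (\<theta> / 2))))"
    by (rule set_integrable_mult_right) (use integrable_I0i_exp_mscale[of "\<theta> / 2"] assms in auto)
  thus ?thesis
  proof (rule set_integrable_bound)
    show "AE x in lborel. x \<in> {0<..} \<longrightarrow>
        norm (exp (- \<theta> * x) * (1 + x\<^sup>2) powr c) \<le> norm (K * exp (- (x * (\<theta> / 2))))"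
    proof (intro AE_I2 impI)
      fix x :: real assume "x \<in> {0<..}"
      thus "norm (exp (- \<theta> * x) * (1 + x\<^sup>2) powr c) \<le> norm (K * exp (- (x * (\<theta> / 2))))"
        using bd[of x] K by simp
    qed
  qed (simp add: set_borel_measurable_def)
qed

text \<open>\<open>\<sigma> = 1\<close> looks ahead of w and \<open>\<sigma> = -1\<close> behind it.
  The total mass of the weight is 1/\<theta>, so \<theta> times this is an average of
  \<open>f\<close>.\<close>

definition laplace :: "real \<Rightarrow> real \<Rightarrow> (real \<Rightarrow> real) \<Rightarrow> real \<Rightarrow> real" where
  "laplace \<theta> \<sigma> f w = (LBINT x:{0<..}. exp (- \<theta> * x) * f (w + \<sigma> * x))"

lemma growth_laplace_bound:
  fixes f :: "real \<Rightarrow> real"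
  assumes "\<bar>\<sigma>\<bar> = 1" and C: "C \<ge> 0" "\<And>w. \<bar>f w\<bar> \<le> C * (1 + w\<^sup>2) powr b"
  shows "\<bar>exp (- \<theta> * x) * f (w + \<sigma> * x)\<bar>
      \<le> C * 2 powr \<bar>b\<bar> * (1 + w\<^sup>2) powr b * (exp (- \<theta> * x) * (1 + x\<^sup>2) powr \<bar>b\<bar>)"
proof -
  have sq: "(\<sigma> * x)\<^sup>2 = x\<^sup>2" using assms(1) by (auto simp: abs_if split: if_splits)
  have "\<bar>f (w + \<sigma> * x)\<bar> \<le> C * (1 + (w + \<sigma> * x)\<^sup>2) powr b" by (rule C)
  also have "\<dots> \<le> C * ((2 * (1 + x\<^sup>2)) powr \<bar>b\<bar> * (1 + w\<^sup>2) powr b)"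
    using peetre[of "w + \<sigma> * x" b w] C(1) by (intro mult_left_mono) (auto simp: sq)
  finally have "exp (- \<theta> * x) * \<bar>f (w + \<sigma> * x)\<bar> \<le> exp (- \<theta> * x) * (C * ((2 * (1 + x\<^sup>2)) powr \<bar>b\<bar> * (1 + w\<^sup>2) powr b))"
    by (rule mult_left_mono) simp
  also have "(2 * (1 + x\<^sup>2)) powr \<bar>b\<bar> = 2 powr \<bar>b\<bar> * (1 + x\<^sup>2) powr \<bar>b\<bar>" by (rule powr_mult)
  finally show ?thesis by (simp add: abs_mult mult_ac)
qed

lemma laplace_integrable:
  assumes "\<theta> > 0" "\<bar>\<sigma>\<bar> = 1" "growth b f"
  shows "set_integrable lborel {0<..} (\<lambda>x. exp (- \<theta> * x) * f (w + \<sigma> * x))"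
proof -
  obtain C where C: "C > 0" "\<And>w. \<bar>f w\<bar> \<le> C * (1 + w\<^sup>2) powr b"
    using growthE[OF assms(3)] by blast
  note [measurable] = growth_measurable[OF assms(3)]
  have "set_integrable lborel {0<..}
      (\<lambda>x. C * 2 powr \<bar>b\<bar> * (1 + w\<^sup>2) powr b * (exp (- \<theta> * x) * (1 + x\<^sup>2) powr \<bar>b\<bar>))"
    by (rule set_integrable_mult_right) (use integrable_exp_poly[OF assms(1)] in auto)
  thus ?thesis
    by (rule set_integrable_bound)
       (use growth_laplace_bound[OF assms(2) less_imp_le[OF C(1)] C(2)] C(1) in
         \<open>auto simp: set_borel_measurable_def abs_mult intro!: AE_I2\<close>)
qed

lemma growth_laplace:
  assumes "\<theta> > 0" "\<bar>\<sigma>\<bar> = 1" "growth b f"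
  shows "growth b (laplace \<theta> \<sigma> f)"
proof -
  obtain C where C: "C > 0" "\<And>w. \<bar>f w\<bar> \<le> C * (1 + w\<^sup>2) powr b"
    using growthE[OF assms(3)] by blast
  note [measurable] = growth_measurable[OF assms(3)]
  define J where "J = (LBINT x:{0<..}. exp (- \<theta> * x) * (1 + x\<^sup>2) powr \<bar>b\<bar>)"
  show ?thesis
  proof (rule growthI)
    show "laplace \<theta> \<sigma> f \<in> borel_measurable borel"
      unfolding laplace_def set_lebesgue_integral_def by measurable
    fix w
    have "\<bar>laplace \<theta> \<sigma> f w\<bar> \<le> (LBINT x:{0<..}. \<bar>exp (- \<theta> * x) * f (w + \<sigma> * x)\<bar>)"
      unfolding laplace_def using set_integral_norm_bound[OF laplace_integrable[OF assms]] by simp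
    also have "\<dots> \<le> (LBINT x:{0<..}. C * 2 powr \<bar>b\<bar> * (1 + w\<^sup>2) powr b * (exp (- \<theta> * x) * (1 + x\<^sup>2) powr \<bar>b\<bar>))"
      by (rule set_integral_mono[OF set_integrable_abs[OF laplace_integrable[OF assms]]])
         (use integrable_exp_poly[OF assms(1)] growth_laplace_bound[OF assms(2) less_imp_le[OF C(1)] C(2)] in auto)
    also have "\<dots> = C * 2 powr \<bar>b\<bar> * (1 + w\<^sup>2) powr b * J"
      unfolding J_def by (rule set_integral_mult_right)
    finally show "\<bar>laplace \<theta> \<sigma> f w\<bar> \<le> C * 2 powr \<bar>b\<bar> * J * (1 + w\<^sup>2) powr b"
      by (simp only: mult_ac)
  qed
qed

lemma laplace_add:
  assumes "\<theta> > 0" "\<bar>\<sigma>\<bar> = 1" "growth b f" "growth b g"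
  shows "laplace \<theta> \<sigma> (\<lambda>w. f w + g w) w = laplace \<theta> \<sigma> f w + laplace \<theta> \<sigma> g w"
  unfolding laplace_def distrib_left
  by (intro set_integral_add laplace_integrable[OF assms(1,2,3)] laplace_integrable[OF assms(1,2,4)])

lemma laplace_cmult: "laplace \<theta> \<sigma> (\<lambda>w. c * f w) w = c * laplace \<theta> \<sigma> f w"
  by (simp add: laplace_def mult.left_commute)

lemma laplace_diff:
  assumes "\<theta> > 0" "\<bar>\<sigma>\<bar> = 1" "growth b f" "growth b g"
  shows "laplace \<theta> \<sigma> (\<lambda>w. f w - g w) w = laplace \<theta> \<sigma> f w - laplace \<theta> \<sigma> g w"
  unfolding laplace_def right_diff_distrib
  by (intro set_integral_diff laplace_integrable[OF assms(1,2,3)] laplace_integrable[OF assms(1,2,4)])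

lemma growth_exp_tendsto_0:
  assumes "\<theta> > 0" "\<bar>\<sigma>\<bar> = 1" "growth b f"
  shows "((\<lambda>x. exp (- \<theta> * x) * f (w + \<sigma> * x)) \<longlongrightarrow> 0) at_top"
proof -
  obtain C where C: "C > 0" "\<And>w. \<bar>f w\<bar> \<le> C * (1 + w\<^sup>2) powr b"
    using growthE[OF assms(3)] by blast
  have lim: "((\<lambda>x. exp (- \<theta> * x) * (1 + x\<^sup>2) powr \<bar>b\<bar>) \<longlongrightarrow> 0) at_top"
    using assms(1) by real_asymp
  show ?thesis
    by (rule Lim_null_comparison[OF _ tendsto_mult_right_zero[OF lim, of "C * 2 powr \<bar>b\<bar> * (1 + w\<^sup>2) powr b"]])
       (use growth_laplace_bound[OF assms(2) less_imp_le[OF C(1)] C(2)] in auto)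
qed

text \<open>Integration by parts: exp(-\<theta> x) f(w + \<sigma> x) vanishes at infinity, so only
  the boundary term at x = 0 survives. Subtracting the average thus amounts to a smoothed
  derivative, and every application gains the decay of f' over f.\<close>

lemma laplace_deriv:
  assumes "\<theta> > 0" "\<bar>\<sigma>\<bar> = 1" "growth b f" "growth b' f'"
    and f: "\<And>x. (f has_real_derivative f' x) (at x)" and f': "continuous_on UNIV f'"
  shows "f w - \<theta> * laplace \<theta> \<sigma> f w = - \<sigma> * laplace \<theta> \<sigma> f' w"
proof -
  define F where "F x = exp (- \<theta> * x) * f (w + \<sigma> * x)" for x
  define G where "G x = - \<theta> * (exp (- \<theta> * x) * f (w + \<sigma> * x)) + \<sigma> * (exp (- \<theta> * x) * f' (w + \<sigma> * x))" for x
  have contf: "continuous_on UNIV f" using f by (meson DERIV_isCont continuous_at_imp_continuous_on)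
  have D: "(F has_real_derivative G x) (at x)" for x
    unfolding F_def G_def by (auto intro!: derivative_eq_intros DERIV_chain'[OF _ f] simp: algebra_simps)
  have contG: "continuous_on UNIV G" unfolding G_def
    by (intro continuous_intros continuous_on_compose2[OF contf] continuous_on_compose2[OF f']) auto
  have contF: "continuous_on UNIV F" unfolding F_def
    by (intro continuous_intros continuous_on_compose2[OF contf]) auto
  note i = laplace_integrable[OF assms(1,2,3)] laplace_integrable[OF assms(1,2,4)]
  have intG: "set_integrable lborel {0<..} G"
    unfolding G_def by (intro set_integral_add set_integrable_mult_right i)
  have "(LBINT x=ereal 0..\<infinity>. G x) = 0 - F 0"
  proof (rule interval_integral_FTC_integrable[where F = F])
    show "(F has_vector_derivative G x) (at x)" for x
      using D by (simp add: has_real_derivative_iff_has_vector_derivative)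
    show "isCont G x" for x using contG by (simp add: continuous_on_eq_continuous_at)
    show "set_integrable lborel (einterval (ereal 0) \<infinity>) G" using intG by (simp add: einterval_eq_Ici)
    show "((F \<circ> real_of_ereal) \<longlongrightarrow> F 0) (at_right (ereal 0))"
      unfolding comp_def ereal_tendsto_simps[unfolded comp_def]
      using contF by (simp add: continuous_on_eq_continuous_at isCont_def filterlim_at_split)
    show "((F \<circ> real_of_ereal) \<longlongrightarrow> 0) (at_left \<infinity>)"
      unfolding ereal_tendsto_simps F_def by (rule growth_exp_tendsto_0[OF assms(1,2,3)])
  qed auto
  hence "(LBINT x:{0<..}. G x) = - f w"
    unfolding interval_integral_to_infinity_eq by (simp add: F_def)
  moreover have "(LBINT x:{0<..}. G x) = - \<theta> * laplace \<theta> \<sigma> f w + \<sigma> * laplace \<theta> \<sigma> f' w"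
    unfolding G_def laplace_def set_integral_mult_right[symmetric]
    by (intro set_integral_add set_integrable_mult_right i)
  ultimately show ?thesis by simp
qed

section \<open>The Ornstein--Uhlenbeck functional\<close>

text \<open>The integral of exp(-\<theta>(t - s)) against df(s) over [a, t], after integration by
  parts. The starting time \<open>a\<close> is 0 for X and tends to minus infinity for Z; the term
  in \<open>f a\<close> is kept because the paths vanish at 0 only almost surely.\<close>

definition ou_functional :: "real \<Rightarrow> real \<Rightarrow> real \<Rightarrow> (real \<Rightarrow> real) \<Rightarrow> real" where
  "ou_functional \<theta> a t f =
     f t - exp (- \<theta> * (t - a)) * f a - (LBINT u:{a..t}. \<theta> * exp (- \<theta> * (t - u)) * f u)"

lemma young_integral_eq_ou_functional:
  assumes "a \<le> t" "continuous_on {a..t} g"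
  shows "exp (- \<theta> * t) * young_integral (\<lambda>s. exp (\<theta> * s)) g a t = ou_functional \<theta> a t g"
proof -
  have "set_integrable lborel {a..t} (\<lambda>u. \<theta> * exp (- \<theta> * (t - u)) * g u)"
    using assms(2) by (intro borel_integrable_atLeastAtMost' continuous_intros)
  hence "(LBINT u:{a..t}. \<theta> * exp (- \<theta> * (t - u)) * g u)
      = integral {a..t} (\<lambda>u. \<theta> * exp (- \<theta> * (t - u)) * g u)"
    by (rule set_borel_integral_eq_integral)
  also have "\<dots> = integral {a..t} (\<lambda>u. \<theta> * exp (- \<theta> * t) * (exp (\<theta> * u) * g u))"
    by (rule arg_cong[where f = "integral {a..t}"]) (auto simp: algebra_simps simp flip: exp_add)
  also have "\<dots> = \<theta> * exp (- \<theta> * t) * integral {a..t} (\<lambda>u. exp (\<theta> * u) * g u)"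
    by (rule integral_mult_right)
  finally have "(LBINT u:{a..t}. \<theta> * exp (- \<theta> * (t - u)) * g u)
      = \<theta> * exp (- \<theta> * t) * integral {a..t} (\<lambda>u. exp (\<theta> * u) * g u)" .
  moreover have "exp (- \<theta> * t) * exp (\<theta> * t) = 1" "exp (- \<theta> * t) * exp (\<theta> * a) = exp (- \<theta> * (t - a))"
    by (auto simp: algebra_simps simp flip: exp_add)
  ultimately show ?thesis
    unfolding ou_functional_def young_integral_exp[OF assms] right_diff_distrib
    by (simp add: mult_ac flip: mult.assoc)
qed

section \<open>Approximation of the functional by finite linear combinations\<close>

definition grid :: "nat \<Rightarrow> real \<Rightarrow> real \<Rightarrow> real" where
  "grid m a u = max a (of_int \<lfloor>real (Suc m) * u\<rfloor> / real (Suc m))"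

text \<open>Only the argument of \<open>f\<close> is rounded; the exponential weight stays exact.
  Since \<open>grid\<close> takes finitely many values, all inside [a, t], this is a finite sum of
  values of \<open>f\<close>.\<close>

definition ou_discrete :: "real \<Rightarrow> real \<Rightarrow> real \<Rightarrow> nat \<Rightarrow> (real \<Rightarrow> real) \<Rightarrow> real" where
  "ou_discrete \<theta> a t m f =
     f t - exp (- \<theta> * (t - a)) * f a - (LBINT u:{a..t}. \<theta> * exp (- \<theta> * (t - u)) * f (grid m a u))"

lemma grid_bounds: "a \<le> u \<Longrightarrow> a \<le> grid m a u \<and> grid m a u \<le> u"
  by (auto simp: grid_def divide_le_eq mult.commute)

lemma grid_tendsto:
  assumes "a \<le> u"
  shows "(\<lambda>m. grid m a u) \<longlonglongrightarrow> u"
proof -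
  have bd: "\<bar>grid m a u - u\<bar> \<le> 1 / real (Suc m)" for m
  proof -
    have "u - 1 / real (Suc m) = (real (Suc m) * u - 1) / real (Suc m)"
      by (simp add: diff_divide_distrib)
    also have "\<dots> \<le> of_int \<lfloor>real (Suc m) * u\<rfloor> / real (Suc m)"
      by (rule divide_right_mono) (linarith, simp)
    finally have "u - 1 / real (Suc m) \<le> of_int \<lfloor>real (Suc m) * u\<rfloor> / real (Suc m)" .
    hence "u - 1 / real (Suc m) \<le> grid m a u" by (simp add: grid_def)
    thus ?thesis using grid_bounds[OF assms, of m] by simp
  qed
  have lim: "(\<lambda>m. 1 / real (Suc m)) \<longlonglongrightarrow> 0"
    using LIMSEQ_inverse_real_of_nat by (simp add: inverse_eq_divide)
  have "(\<lambda>m. grid m a u - u) \<longlonglongrightarrow> 0"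
    by (rule Lim_null_comparison[OF always_eventually lim]) (simp only: real_norm_def bd simp_thms)
  thus ?thesis by (simp add: LIM_zero_iff)
qed

lemma measurable_grid [measurable]: "(\<lambda>u. f (grid m a u) :: real) \<in> borel_measurable borel"
proof -
  have "(\<lambda>u. (\<lambda>k::int. f (max a (of_int k / real (Suc m)))) \<lfloor>real (Suc m) * u\<rfloor>) \<in> borel_measurable borel"
    by (rule measurable_compose[of _ _ "count_space UNIV"]) auto
  thus ?thesis by (simp add: grid_def)
qed

lemma ou_weight_le:
  fixes t u :: real
  assumes "\<theta> > 0" "u \<le> t" "\<bar>y\<bar> \<le> C"
  shows "\<bar>\<theta> * exp (- \<theta> * (t - u)) * y\<bar> \<le> \<theta> * C"
proof -
  have "0 \<le> \<theta> * (t - u)" using assms by simp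
  hence "exp (- \<theta> * (t - u)) \<le> 1" by simp
  hence "exp (- \<theta> * (t - u)) * \<bar>y\<bar> \<le> 1 * C" using assms by (intro mult_mono) auto
  thus ?thesis using assms(1) by (simp add: abs_mult mult.assoc)
qed

lemma ou_discrete_integrable:
  assumes "\<theta> > 0" "\<And>x. x \<in> {a..t} \<Longrightarrow> \<bar>f x\<bar> \<le> C"
  shows "set_integrable lborel {a..t} (\<lambda>u. \<theta> * exp (- \<theta> * (t - u)) * f (grid m a u))"
proof (rule set_integrable_bound[of lborel "{a..t}" "\<lambda>_. \<theta> * C"])
  show "AE u in lborel. u \<in> {a..t} \<longrightarrow>
      norm (\<theta> * exp (- \<theta> * (t - u)) * f (grid m a u)) \<le> norm (\<theta> * C)"
  proof (intro AE_I2 impI)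
    fix u assume u: "u \<in> {a..t}"
    have "\<bar>f (grid m a u)\<bar> \<le> C" using grid_bounds[of a u m] u by (intro assms(2)) auto
    from ou_weight_le[OF assms(1) _ this, of u t] u
    show "norm (\<theta> * exp (- \<theta> * (t - u)) * f (grid m a u)) \<le> norm (\<theta> * C)" by auto
  qed
qed (auto simp: set_borel_measurable_def intro!: borel_integrable_atLeastAtMost')

lemma ou_discrete_bound:
  assumes "\<theta> > 0" "a \<le> t" and C: "\<And>x. x \<in> {a..t} \<Longrightarrow> \<bar>f x\<bar> \<le> C"
  shows "\<bar>ou_discrete \<theta> a t m f\<bar> \<le> (2 + \<theta> * (t - a)) * C"
proof -
  have i: "set_integrable lborel {a..t} (\<lambda>u. \<theta> * exp (- \<theta> * (t - u)) * f (grid m a u))"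
    by (rule ou_discrete_integrable[OF assms(1)]) (rule C)
  have "\<bar>LBINT u:{a..t}. \<theta> * exp (- \<theta> * (t - u)) * f (grid m a u)\<bar>
      \<le> (LBINT u:{a..t}. \<bar>\<theta> * exp (- \<theta> * (t - u)) * f (grid m a u)\<bar>)"
    using set_integral_norm_bound[OF i] by simp
  also have "\<dots> \<le> (LBINT u:{a..t}. \<theta> * C)"
  proof (rule set_integral_mono[OF set_integrable_abs[OF i]])
    fix u assume u: "u \<in> {a..t}"
    have "\<bar>f (grid m a u)\<bar> \<le> C" using grid_bounds[of a u m] u by (intro C) auto
    from ou_weight_le[OF assms(1) _ this, of u t] u
    show "\<bar>\<theta> * exp (- \<theta> * (t - u)) * f (grid m a u)\<bar> \<le> \<theta> * C" by auto
  qed (auto intro!: borel_integrable_atLeastAtMost')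
  also have "\<dots> = \<theta> * (t - a) * C" using assms(2) by (simp add: set_lebesgue_integral_def)
  finally have 1: "\<bar>LBINT u:{a..t}. \<theta> * exp (- \<theta> * (t - u)) * f (grid m a u)\<bar> \<le> \<theta> * (t - a) * C" .
  have 2: "\<bar>f t\<bar> \<le> C" using C assms by auto
  have "exp (- \<theta> * (t - a)) * \<bar>f a\<bar> \<le> 1 * C"
    using C[of a] assms by (intro mult_mono) auto
  hence 3: "\<bar>exp (- \<theta> * (t - a)) * f a\<bar> \<le> C" by (simp add: abs_mult)
  have "(2 + \<theta> * (t - a)) * C = C + C + \<theta> * (t - a) * C" by (simp add: algebra_simps)
  thus ?thesis using 1 2 3 unfolding ou_discrete_def by linarith
qed

text \<open>The hypothesis of continuous convergence is stable under applying the functional in one of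
  two variables, so that the lemma can be iterated.\<close>

lemma ou_discrete_tendsto:
  assumes "\<theta> > 0" "a \<le> t"
    and lim: "\<And>x X. x \<in> {a..t} \<Longrightarrow> (\<And>m. X m \<in> {a..t}) \<Longrightarrow> X \<longlonglongrightarrow> x \<Longrightarrow> (\<lambda>m. \<phi> m (X m)) \<longlonglongrightarrow> \<psi> x"
    and C: "\<And>m x. x \<in> {a..t} \<Longrightarrow> \<bar>\<phi> m x\<bar> \<le> C"
  shows "(\<lambda>m. ou_discrete \<theta> a t m (\<phi> m)) \<longlonglongrightarrow> ou_functional \<theta> a t \<psi>"
proof -
  define s where "s m u = indicator {a..t} u * (\<theta> * exp (- \<theta> * (t - u)) * \<phi> m (grid m a u))" for m u
  define l where "l u = indicator {a..t} u * (\<theta> * exp (- \<theta> * (t - u)) * \<psi> u)" for u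
  have s_lim: "(\<lambda>m. s m u) \<longlonglongrightarrow> l u" for u
  proof (cases "u \<in> {a..t}")
    case True
    have "(\<lambda>m. \<phi> m (grid m a u)) \<longlonglongrightarrow> \<psi> u"
      using True by (intro lim grid_tendsto) (auto dest: grid_bounds intro: order_trans)
    thus ?thesis unfolding s_def l_def by (intro tendsto_intros)
  qed (simp add: s_def l_def)
  have [measurable]: "s m \<in> borel_measurable borel" for m unfolding s_def by measurable
  have [measurable]: "l \<in> borel_measurable borel"
    by (rule borel_measurable_LIMSEQ_real[OF s_lim]) auto
  have "(\<lambda>m. integral\<^sup>L lborel (s m)) \<longlonglongrightarrow> integral\<^sup>L lborel l"
  proof (rule integral_dominated_convergence[where w = "\<lambda>u. indicator {a..t} u * (\<theta> * C)"])
    have "set_integrable lborel {a..t} (\<lambda>_. \<theta> * C)"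
      by (intro borel_integrable_atLeastAtMost' continuous_intros)
    thus "integrable lborel (\<lambda>u. indicator {a..t} u * (\<theta> * C))" by (simp add: set_integrable_def)
    fix m
    show "AE u in lborel. norm (s m u) \<le> indicator {a..t} u * (\<theta> * C)"
    proof (rule AE_I2)
      fix u
      show "norm (s m u) \<le> indicator {a..t} u * (\<theta> * C)"
      proof (cases "u \<in> {a..t}")
        case True
        have "\<bar>\<phi> m (grid m a u)\<bar> \<le> C" using grid_bounds[of a u m] True by (intro C) auto
        from ou_weight_le[OF assms(1) _ this, of u t] True show ?thesis by (simp add: s_def)
      qed (simp add: s_def)
    qed
  qed (use s_lim in auto)
  moreover have "(\<lambda>m. \<phi> m t) \<longlonglongrightarrow> \<psi> t" "(\<lambda>m. \<phi> m a) \<longlonglongrightarrow> \<psi> a"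
    using assms(2) lim[of _ "\<lambda>_. t"] lim[of _ "\<lambda>_. a"] by auto
  ultimately show ?thesis
    unfolding ou_discrete_def ou_functional_def set_lebesgue_integral_def s_def l_def
    by (auto intro!: tendsto_intros)
qed

lemma finite_grid_image: "finite (grid m a ` {a..t})"
proof (rule finite_subset)
  define N where "N = real (Suc m)"
  have N: "N \<ge> 0" by (simp add: N_def)
  have "\<lfloor>N * u\<rfloor> \<in> {\<lfloor>N * a\<rfloor>..\<lfloor>N * t\<rfloor>}" if u: "u \<in> {a..t}" for u
    unfolding atLeastAtMost_iff using N u by (intro conjI floor_mono mult_left_mono) auto
  thus "grid m a ` {a..t} \<subseteq> (\<lambda>k::int. max a (of_int k / N)) ` {\<lfloor>N * a\<rfloor>..\<lfloor>N * t\<rfloor>}"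
    unfolding grid_def N_def[symmetric] by blast
qed simp

lemma ou_discrete_finite_sum:
  assumes "\<theta> > 0" "a \<le> t"
  shows "\<exists>J c. finite J \<and> J \<subseteq> {a..t} \<and> ou_discrete \<theta> a t m = (\<lambda>f. \<Sum>p\<in>J. c p * f p)"
proof -
  define G where "G = grid m a ` {a..t}"
  define J where "J = insert t (insert a G)"
  \<comment> \<open>\<open>w p\<close> is the weight of the part of [a, t] that is rounded to
    \<open>p\<close>. In \<open>c\<close> the contributions are added point by point, because the
    two endpoints may coincide with each other or with grid values.\<close>
  define w where "w p = (LBINT u:{a..t}. \<theta> * exp (- \<theta> * (t - u)) * (if grid m a u = p then 1 else 0))" for p
  define c where "c p = (if p = t then 1 else 0) - (if p = a then exp (- \<theta> * (t - a)) else 0) - (if p \<in> G then w p else 0)" for p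
  have fG: "finite G" unfolding G_def by (rule finite_grid_image)
  hence fJ: "finite J" by (simp add: J_def)
  have "G \<subseteq> {a..t}"
  proof
    fix p assume "p \<in> G"
    then obtain u where "u \<in> {a..t}" "p = grid m a u" by (auto simp: G_def)
    thus "p \<in> {a..t}" using grid_bounds[of a u m] by auto
  qed
  hence sub: "J \<subseteq> {a..t}" using assms by (auto simp: J_def)
  have "ou_discrete \<theta> a t m f = (\<Sum>p\<in>J. c p * f p)" for f
  proof -
    have "(LBINT u:{a..t}. \<theta> * exp (- \<theta> * (t - u)) * f (grid m a u))
        = (LBINT u. (\<Sum>p\<in>G. indicator {a..t} u *\<^sub>R (\<theta> * exp (- \<theta> * (t - u)) * (if grid m a u = p then 1 else 0)) * f p))"
      unfolding set_lebesgue_integral_def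
    proof (rule Bochner_Integration.integral_cong[OF refl])
      fix u
      show "indicator {a..t} u *\<^sub>R (\<theta> * exp (- \<theta> * (t - u)) * f (grid m a u))
        = (\<Sum>p\<in>G. indicator {a..t} u *\<^sub>R (\<theta> * exp (- \<theta> * (t - u)) * (if grid m a u = p then 1 else 0)) * f p)"
      proof (cases "u \<in> {a..t}")
        case True
        hence "grid m a u \<in> G" by (auto simp: G_def)
        thus ?thesis using True fG by (simp add: if_distrib if_distribR sum.delta' cong: if_cong)
      qed simp
    qed
    also have "\<dots> = (\<Sum>p\<in>G. w p * f p)"
    proof -
      have i: "integrable lborel (\<lambda>u. indicator {a..t} u *\<^sub>R (\<theta> * exp (- \<theta> * (t - u)) * (if grid m a u = p then 1 else 0)))" for p
        using ou_discrete_integrable[of \<theta> a t "\<lambda>q. if q = p then 1 else 0" 1 m] assms(1)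
        by (simp add: set_integrable_def)
      show ?thesis
        unfolding w_def set_lebesgue_integral_def
        by (subst Bochner_Integration.integral_sum) (use i in auto)
    qed
    also have "\<dots> = (\<Sum>p\<in>J. (if p \<in> G then w p else 0) * f p)"
      using fJ by (intro sum.mono_neutral_cong_left) (auto simp: J_def)
    finally have int: "(LBINT u:{a..t}. \<theta> * exp (- \<theta> * (t - u)) * f (grid m a u))
        = (\<Sum>p\<in>J. (if p \<in> G then w p else 0) * f p)" .
    have delta: "(\<Sum>p\<in>J. (if p = q then k else 0) * f p) = k * f q" if "q \<in> J" for q k
    proof -
      have "(\<Sum>p\<in>J. (if p = q then k else 0) * f p) = (\<Sum>p\<in>J. if p = q then k * f p else 0)"
        by (intro sum.cong) auto
      thus ?thesis using fJ that by simp
    qed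
    have "t \<in> J" "a \<in> J" by (auto simp: J_def)
    thus ?thesis
      unfolding ou_discrete_def c_def left_diff_distrib sum_subtractf int by (simp add: delta)
  qed
  thus ?thesis using fJ sub by blast
qed

section \<open>Joint normality of the functionals\<close>

lemma gaussian_processD:
  assumes "gaussian_process M T Y" "finite J" "J \<subseteq> T"
  shows "gaussian_rv M (\<lambda>\<omega>. \<Sum>t\<in>J. c t * Y t \<omega>)"
  using assms by (simp add: gaussian_process_def)

text \<open>The work is done for \<open>ou_discrete\<close>: there linear combinations are Gaussian
  by hypothesis, and variances are finite double sums over K. \<open>centred_normal_limit\<close>
  then passes to the functional, where continuity of the paths supplies the pointwise limit and
  continuity of K the limit of the variances.\<close>

lemma (in prob_space) gaussian_process_ou_functional:
  assumes gauss: "gaussian_process M {a..} Y"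
    and path: "\<And>\<omega>. \<omega> \<in> space M \<Longrightarrow> continuous_on {a..} (\<lambda>t. Y t \<omega>)"
    and mean: "\<And>t. t \<ge> a \<Longrightarrow> expectation (Y t) = 0"
    and cov: "\<And>s t. s \<ge> a \<Longrightarrow> t \<ge> a \<Longrightarrow> expectation (\<lambda>\<omega>. Y s \<omega> * Y t \<omega>) = K s t"
    and K: "continuous_on ({a..} \<times> {a..}) (\<lambda>(u, v). K u v)"
    and \<theta>: "\<theta> > 0" and s: "a \<le> s" and t: "a \<le> t"
  defines "R \<equiv> \<lambda>s t. ou_functional \<theta> a s (\<lambda>u. ou_functional \<theta> a t (K u))"
  shows "jointly_normal M (\<lambda>\<omega>. ou_functional \<theta> a s (\<lambda>r. Y r \<omega>)) (\<lambda>\<omega>. ou_functional \<theta> a t (\<lambda>r. Y r \<omega>))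
           (R s s) (R t t) (R s t)"
proof -
  define D where "D m s t = ou_discrete \<theta> a s m (\<lambda>u. ou_discrete \<theta> a t m (K u))" for m s t
  have Y: "centred_normal M (Y r) (K r r)" if "r \<ge> a" for r
  proof -
    have "gaussian_rv M (Y r)"
      using gaussian_processD[OF gauss, of "{r}" "\<lambda>_. 1"] that by simp
    from centred_normal_gaussian_rv[OF this mean[OF that]] cov[OF that that]
    show ?thesis by (simp add: power2_eq_square)
  qed
  have iY: "integrable M (Y r)" if "r \<ge> a" for r
    using centred_normal_moments(1)[OF Y[OF that], of 1] by simp
  have iYY: "integrable M (\<lambda>\<omega>. Y p \<omega> * Y q \<omega>)" if "p \<ge> a" "q \<ge> a" for p q
  proof (rule integral_mult_le_of_squares(1)[OF _ _ _ _ zero_less_one])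
    show "Y p \<in> borel_measurable M" "Y q \<in> borel_measurable M" using iY that by auto
    show "integrable M (\<lambda>\<omega>. (Y p \<omega>)\<^sup>2)" "integrable M (\<lambda>\<omega>. (Y q \<omega>)\<^sup>2)"
      using centred_normal_moments(1)[OF Y] that by auto
  qed
  have Ksym: "K p q = K q p" if "p \<ge> a" "q \<ge> a" for p q
    using cov[OF that] cov[OF that(2,1)] by (simp add: mult.commute)
  have K_lim: "(\<lambda>m. K (U m) (V m)) \<longlonglongrightarrow> K u v"
    if "U \<longlonglongrightarrow> u" "V \<longlonglongrightarrow> v" "\<And>m. U m \<ge> a" "\<And>m. V m \<ge> a" "u \<ge> a" "v \<ge> a" for U V u v
    using continuous_on_tendsto_compose[OF K, of "\<lambda>m. (U m, V m)" "(u, v)" sequentially] that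
    by (auto intro!: tendsto_Pair)
  have D_lim: "(\<lambda>m. D m s t) \<longlonglongrightarrow> R s t" if s: "a \<le> s" and t: "a \<le> t" for s t
  proof -
    have "compact ((\<lambda>(u, v). K u v) ` ({a..s} \<times> {a..t}))"
      by (intro compact_continuous_image continuous_on_subset[OF K] compact_Times) auto
    then obtain C where C: "\<And>u v. u \<in> {a..s} \<Longrightarrow> v \<in> {a..t} \<Longrightarrow> \<bar>K u v\<bar> \<le> C"
      by (fastforce dest!: compact_imp_bounded simp: bounded_iff)
    \<comment> \<open>The same index m discretises both variables. The outer use of
      \<open>ou_discrete_tendsto\<close> therefore asks for convergence along moving points U m,
      which the inner use provides through joint continuity of K.\<close>
    show ?thesis
      unfolding D_def R_def
    proof (rule ou_discrete_tendsto[OF \<theta> s])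
      show "\<bar>ou_discrete \<theta> a t m (K x)\<bar> \<le> (2 + \<theta> * (t - a)) * C" if "x \<in> {a..s}" for m x
        using that by (intro ou_discrete_bound \<theta> t C)
      fix u U assume u: "u \<in> {a..s}" and U: "\<And>m. U m \<in> {a..s}" "U \<longlonglongrightarrow> u"
      show "(\<lambda>m. ou_discrete \<theta> a t m (K (U m))) \<longlonglongrightarrow> ou_functional \<theta> a t (K u)"
        by (rule ou_discrete_tendsto[OF \<theta> t, where C = C]) (use u U in \<open>auto intro!: K_lim C\<close>)
    qed
  qed
  \<comment> \<open>For finite sums over a symmetric kernel it suffices to exchange the order of
    summation. This merges the two mixed terms of the variance into one.\<close>
  have D_sym: "D m s t = D m t s" for m
  proof -
    obtain J c where J: "finite J" "J \<subseteq> {a..s}" "ou_discrete \<theta> a s m = (\<lambda>f. (\<Sum>p\<in>J. c p * f p))"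
        using ou_discrete_finite_sum[OF \<theta> s, of m] by (elim exE conjE)
    obtain J' d where J': "finite J'" "J' \<subseteq> {a..t}" "ou_discrete \<theta> a t m = (\<lambda>f. (\<Sum>p\<in>J'. d p * f p))"
        using ou_discrete_finite_sum[OF \<theta> t, of m] by (elim exE conjE)
    have "(\<Sum>p\<in>J. c p * (\<Sum>q\<in>J'. d q * K p q)) = (\<Sum>p\<in>J. \<Sum>q\<in>J'. d q * (c p * K q p))"
      unfolding sum_distrib_left
    proof (intro sum.cong refl)
      fix p q assume "p \<in> J" "q \<in> J'"
      hence "K p q = K q p" using J(2) J'(2) by (intro Ksym) auto
      thus "c p * (d q * K p q) = d q * (c p * K q p)" by simp
    qed
    also have "\<dots> = (\<Sum>q\<in>J'. d q * (\<Sum>p\<in>J. c p * K q p))"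
      by (subst sum.swap) (simp add: sum_distrib_left)
    finally show ?thesis by (simp add: D_def J(3) J'(3))
  qed
  have R_sym: "R t s = R s t"
    using D_lim[OF s t] D_lim[OF t s] unfolding D_sym by (rule LIMSEQ_unique[rotated])
  have "centred_normal M (\<lambda>\<omega>. x * ou_functional \<theta> a s (\<lambda>r. Y r \<omega>) + y * ou_functional \<theta> a t (\<lambda>r. Y r \<omega>))
     (x\<^sup>2 * R s s + y\<^sup>2 * R t t + 2 * x * y * R s t)" for x y
  proof (rule centred_normal_limit)
    show "centred_normal M (\<lambda>\<omega>. x * ou_discrete \<theta> a s m (\<lambda>r. Y r \<omega>) + y * ou_discrete \<theta> a t m (\<lambda>r. Y r \<omega>))
      (x\<^sup>2 * D m s s + y\<^sup>2 * D m t t + 2 * x * y * D m s t)" for m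
    proof -
      obtain J1 c1 where J1: "finite J1" "J1 \<subseteq> {a..s}" "ou_discrete \<theta> a s m = (\<lambda>f. (\<Sum>p\<in>J1. c1 p * f p))"
        using ou_discrete_finite_sum[OF \<theta> s, of m] by (elim exE conjE)
      obtain J2 c2 where J2: "finite J2" "J2 \<subseteq> {a..t}" "ou_discrete \<theta> a t m = (\<lambda>f. (\<Sum>p\<in>J2. c2 p * f p))"
        using ou_discrete_finite_sum[OF \<theta> t, of m] by (elim exE conjE)
      define J where "J = J1 \<union> J2"
      define c where "c p = x * (if p \<in> J1 then c1 p else 0) + y * (if p \<in> J2 then c2 p else 0)" for p
      have J: "finite J" "J \<subseteq> {a..}" using J1 J2 by (auto simp: J_def)
      have r1: "(\<Sum>p\<in>J1. c1 p * f p) = (\<Sum>p\<in>J. (if p \<in> J1 then c1 p else 0) * f p)" for f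
        using J by (intro sum.mono_neutral_cong_left) (auto simp: J_def)
      have r2: "(\<Sum>p\<in>J2. c2 p * f p) = (\<Sum>p\<in>J. (if p \<in> J2 then c2 p else 0) * f p)" for f
        using J by (intro sum.mono_neutral_cong_left) (auto simp: J_def)
      have lin: "x * ou_discrete \<theta> a s m f + y * ou_discrete \<theta> a t m f = (\<Sum>p\<in>J. c p * f p)" for f
        unfolding J1(3) J2(3) r1 r2 c_def
        by (simp only: distrib_right sum.distrib sum_distrib_left mult.assoc)
      let ?W = "\<lambda>\<omega>. \<Sum>p\<in>J. c p * Y p \<omega>"
      have "gaussian_rv M ?W" by (rule gaussian_processD[OF gauss J])
      moreover have "expectation ?W = 0"
        using J iY mean by (subst Bochner_Integration.integral_sum) (auto intro!: sum.neutral)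
      ultimately have "centred_normal M ?W (expectation (\<lambda>\<omega>. (?W \<omega>)\<^sup>2))"
        by (rule centred_normal_gaussian_rv)
      moreover have "expectation (\<lambda>\<omega>. (?W \<omega>)\<^sup>2) = x\<^sup>2 * D m s s + y\<^sup>2 * D m t t + 2 * x * y * D m s t"
      proof -
        have "(\<lambda>\<omega>. (?W \<omega>)\<^sup>2) = (\<lambda>\<omega>. \<Sum>p\<in>J. \<Sum>q\<in>J. c p * c q * (Y p \<omega> * Y q \<omega>))"
          by (simp add: power2_eq_square sum_product mult_ac)
        hence "expectation (\<lambda>\<omega>. (?W \<omega>)\<^sup>2) = (\<Sum>p\<in>J. \<Sum>q\<in>J. c p * c q * expectation (\<lambda>\<omega>. Y p \<omega> * Y q \<omega>))"
          using J iYY by (auto simp: subset_iff Bochner_Integration.integral_sum)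
        also have "\<dots> = (\<Sum>p\<in>J. \<Sum>q\<in>J. c p * c q * K p q)"
          using J cov by (auto simp: subset_iff intro!: sum.cong)
        also have "\<dots> = (\<Sum>p\<in>J. c p * (\<Sum>q\<in>J. c q * K p q))"
          by (simp add: sum_distrib_left mult_ac)
        also have "\<dots> = (\<Sum>p\<in>J. c p * (x * ou_discrete \<theta> a s m (K p) + y * ou_discrete \<theta> a t m (K p)))"
          by (simp add: lin)
        also have "\<dots> = x * ou_discrete \<theta> a s m (\<lambda>p. x * ou_discrete \<theta> a s m (K p) + y * ou_discrete \<theta> a t m (K p))
            + y * ou_discrete \<theta> a t m (\<lambda>p. x * ou_discrete \<theta> a s m (K p) + y * ou_discrete \<theta> a t m (K p))"
          by (simp add: lin)
        also have "\<dots> = x * (x * D m s s + y * D m s t) + y * (x * D m t s + y * D m t t)"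
        proof -
          have "ou_discrete \<theta> a s m (\<lambda>p. x * f p + y * g p) = x * ou_discrete \<theta> a s m f + y * ou_discrete \<theta> a s m g"
            "ou_discrete \<theta> a t m (\<lambda>p. x * f p + y * g p) = x * ou_discrete \<theta> a t m f + y * ou_discrete \<theta> a t m g" for f g
            unfolding J1(3) J2(3) by (simp_all add: algebra_simps sum.distrib sum_distrib_left)
          thus ?thesis by (simp add: D_def)
        qed
        finally show ?thesis using D_sym[of m] by (simp add: algebra_simps power2_eq_square)
      qed
      ultimately show ?thesis by (simp add: lin)
    qed
    show "(\<lambda>m. x\<^sup>2 * D m s s + y\<^sup>2 * D m t t + 2 * x * y * D m s t)
        \<longlonglongrightarrow> x\<^sup>2 * R s s + y\<^sup>2 * R t t + 2 * x * y * R s t"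
      by (intro tendsto_intros D_lim s t)
    fix \<omega> assume \<omega>: "\<omega> \<in> space M"
    have lim: "(\<lambda>m. ou_discrete \<theta> a r m (\<lambda>r. Y r \<omega>)) \<longlonglongrightarrow> ou_functional \<theta> a r (\<lambda>r. Y r \<omega>)" if r: "a \<le> r" for r
    proof -
      have "compact ((\<lambda>r. Y r \<omega>) ` {a..r})"
        by (intro compact_continuous_image continuous_on_subset[OF path[OF \<omega>]]) auto
      then obtain C where C: "\<And>u. u \<in> {a..r} \<Longrightarrow> \<bar>Y u \<omega>\<bar> \<le> C"
        by (fastforce dest!: compact_imp_bounded simp: bounded_iff)
      show ?thesis
      proof (rule ou_discrete_tendsto[OF \<theta> r _ C])
        fix x X assume "x \<in> {a..r}" "\<And>m. X m \<in> {a..r}" "X \<longlonglongrightarrow> x"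
        thus "(\<lambda>m. Y (X m) \<omega>) \<longlonglongrightarrow> Y x \<omega>"
          by (intro continuous_on_tendsto_compose[OF path[OF \<omega>]]) auto
      qed
    qed
    show "(\<lambda>m. x * ou_discrete \<theta> a s m (\<lambda>r. Y r \<omega>) + y * ou_discrete \<theta> a t m (\<lambda>r. Y r \<omega>))
        \<longlonglongrightarrow> x * ou_functional \<theta> a s (\<lambda>r. Y r \<omega>) + y * ou_functional \<theta> a t (\<lambda>r. Y r \<omega>)"
      by (intro tendsto_intros lim s t)
  qed
  thus ?thesis by (simp add: jointly_normal_def)
qed

section \<open>Half-line filters and the iterated functional\<close>

definition ou_filter :: "real \<Rightarrow> real \<Rightarrow> (real \<Rightarrow> real) \<Rightarrow> real \<Rightarrow> real" where
  "ou_filter \<theta> \<sigma> g w = g w - \<theta> * laplace \<theta> \<sigma> g w"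

lemma growth_ou_filter:
  "\<theta> > 0 \<Longrightarrow> \<bar>\<sigma>\<bar> = 1 \<Longrightarrow> growth b g \<Longrightarrow> growth b (ou_filter \<theta> \<sigma> g)"
  unfolding ou_filter_def by (intro growth_diff growth_cmult growth_laplace)

lemma ou_filter_add:
  "\<theta> > 0 \<Longrightarrow> \<bar>\<sigma>\<bar> = 1 \<Longrightarrow> growth b f \<Longrightarrow> growth b g \<Longrightarrow>
    ou_filter \<theta> \<sigma> (\<lambda>w. f w + g w) w = ou_filter \<theta> \<sigma> f w + ou_filter \<theta> \<sigma> g w"
  unfolding ou_filter_def by (subst laplace_add[where b = b]) (simp_all add: algebra_simps)

lemma ou_filter_cmult: "ou_filter \<theta> \<sigma> (\<lambda>w. c * f w) w = c * ou_filter \<theta> \<sigma> f w"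
  unfolding ou_filter_def laplace_cmult by (simp add: algebra_simps)

lemma growth_const: "b \<ge> 0 \<Longrightarrow> growth b (\<lambda>_. k)"
  by (rule growth_mono[of 0], rule growthI[of _ "\<bar>k\<bar>"]) (auto simp: add_nonneg_eq_0_iff)

lemma growth_shift:
  assumes "growth b f" "\<bar>\<epsilon>\<bar> = 1"
  shows "growth b (\<lambda>v. f (u + \<epsilon> * v))"
proof -
  note [measurable] = growth_measurable[OF assms(1)]
  obtain C where C: "C > 0" "\<And>w. \<bar>f w\<bar> \<le> C * (1 + w\<^sup>2) powr b"
    using growthE[OF assms(1)] by blast
  have sq: "(\<epsilon> * v)\<^sup>2 = v\<^sup>2" for v using assms(2) by (auto simp: abs_if split: if_splits)
  have "\<bar>f (u + \<epsilon> * v)\<bar> \<le> (C * (2 * (1 + u\<^sup>2)) powr \<bar>b\<bar>) * (1 + v\<^sup>2) powr b" for v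
  proof -
    have "\<bar>f (u + \<epsilon> * v)\<bar> \<le> C * (1 + (u + \<epsilon> * v)\<^sup>2) powr b" by (rule C)
    also have "\<dots> \<le> C * ((2 * (1 + u\<^sup>2)) powr \<bar>b\<bar> * (1 + v\<^sup>2) powr b)"
      using peetre[of "u + \<epsilon> * v" b "\<epsilon> * v"] C(1) by (intro mult_left_mono) (auto simp: sq)
    finally show ?thesis by (simp add: mult.assoc)
  qed
  thus ?thesis by (rule growthI[rotated]) measurable
qed

lemma growth_bounded_on_interval:
  assumes "growth b f"
  obtains C where "\<And>v. v \<in> {a..t} \<Longrightarrow> \<bar>f v\<bar> \<le> C"
proof -
  obtain C where C: "C > 0" "\<And>w. \<bar>f w\<bar> \<le> C * (1 + w\<^sup>2) powr b"
    using growthE[OF assms] by blast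
  define r where "r = \<bar>a\<bar> + \<bar>t\<bar>"
  have "\<bar>f v\<bar> \<le> C * (1 + r\<^sup>2) powr \<bar>b\<bar>" if "v \<in> {a..t}" for v
  proof -
    have "\<bar>v\<bar> \<le> r" using that by (auto simp: r_def)
    hence "v\<^sup>2 \<le> r\<^sup>2" by (simp add: abs_le_square_iff[symmetric] r_def)
    hence "(1 + v\<^sup>2) powr \<bar>b\<bar> \<le> (1 + r\<^sup>2) powr \<bar>b\<bar>" by (intro powr_mono2) auto
    moreover have "(1 + v\<^sup>2) powr b \<le> (1 + v\<^sup>2) powr \<bar>b\<bar>" by (intro powr_mono) auto
    ultimately have "C * (1 + v\<^sup>2) powr b \<le> C * (1 + r\<^sup>2) powr \<bar>b\<bar>" using C(1) by (intro mult_left_mono) auto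
    thus ?thesis using C(2)[of v] by linarith
  qed
  thus ?thesis using that by blast
qed

lemma ou_functional_integrable:
  assumes "\<theta> > 0" "growth b f"
  shows "set_integrable lborel {a..t} (\<lambda>u. \<theta> * exp (- \<theta> * (t - u)) * f u)"
proof -
  note [measurable] = growth_measurable[OF assms(2)]
  obtain C where C: "\<And>v. v \<in> {a..t} \<Longrightarrow> \<bar>f v\<bar> \<le> C"
    using growth_bounded_on_interval[OF assms(2)] by blast
  show ?thesis
  proof (rule set_integrable_bound[of lborel "{a..t}" "\<lambda>_. \<theta> * C"])
    show "AE u in lborel. u \<in> {a..t} \<longrightarrow>
        norm (\<theta> * exp (- \<theta> * (t - u)) * f u) \<le> norm (\<theta> * C)"
    proof (intro AE_I2 impI)
      fix u assume u: "u \<in> {a..t}"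
      have "u \<le> t" using u by simp
      from ou_weight_le[OF assms(1) this C[OF u]]
      show "norm (\<theta> * exp (- \<theta> * (t - u)) * f u) \<le> norm (\<theta> * C)" by auto
    qed
  qed (auto simp: set_borel_measurable_def intro!: borel_integrable_atLeastAtMost')
qed

lemma ou_functional_add:
  assumes "\<theta> > 0" "growth b f" "growth b g"
  shows "ou_functional \<theta> a t (\<lambda>u. f u + g u) = ou_functional \<theta> a t f + ou_functional \<theta> a t g"
proof -
  have "(LBINT u:{a..t}. \<theta> * exp (- \<theta> * (t - u)) * (f u + g u))
      = (LBINT u:{a..t}. \<theta> * exp (- \<theta> * (t - u)) * f u) + (LBINT u:{a..t}. \<theta> * exp (- \<theta> * (t - u)) * g u)"
    unfolding distrib_left
    by (intro set_integral_add ou_functional_integrable[OF assms(1,2)] ou_functional_integrable[OF assms(1,3)])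
  thus ?thesis by (simp add: ou_functional_def algebra_simps)
qed

lemma ou_functional_cmult: "ou_functional \<theta> a t (\<lambda>u. c * f u) = c * ou_functional \<theta> a t f"
proof -
  have "(LBINT u:{a..t}. \<theta> * exp (- \<theta> * (t - u)) * (c * f u)) = c * (LBINT u:{a..t}. \<theta> * exp (- \<theta> * (t - u)) * f u)"
    by (simp only: mult.left_commute[of _ c] set_integral_mult_right)
  thus ?thesis by (simp add: ou_functional_def algebra_simps)
qed

lemma set_integral_endpoint:
  fixes f :: "real \<Rightarrow> real"
  assumes [measurable]: "f \<in> borel_measurable borel"
  shows "set_integrable lborel {..r} f \<longleftrightarrow> set_integrable lborel {..<r} f"
    and "(LBINT u:{..r}. f u) = (LBINT u:{..<r}. f u)"
proof -
  have ae: "AE u in lborel. indicator {..r} u *\<^sub>R f u = indicator {..<r} u *\<^sub>R f u"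
    using AE_lborel_singleton[of r] by eventually_elim (auto simp: indicator_def)
  show "set_integrable lborel {..r} f \<longleftrightarrow> set_integrable lborel {..<r} f"
    unfolding set_integrable_def by (rule integrable_cong_AE[OF _ _ ae]) auto
  show "(LBINT u:{..r}. f u) = (LBINT u:{..<r}. f u)"
    unfolding set_lebesgue_integral_def by (rule integral_cong_AE[OF _ _ ae]) auto
qed

text \<open>Substitute v = r - x. Along the line u + \<epsilon> v the past v < r lies on the side
  -\<epsilon> of the point u + \<epsilon> r, hence the reversed direction.\<close>

lemma laplace_half_line:
  assumes "\<theta> > 0" "\<bar>\<epsilon>\<bar> = 1" "growth b g"
  shows "set_integrable lborel {..<r} (\<lambda>v. exp (- \<theta> * (r - v)) * g (u + \<epsilon> * v))"
    and "laplace \<theta> (- \<epsilon>) g (u + \<epsilon> * r) = (LBINT v:{..<r}. exp (- \<theta> * (r - v)) * g (u + \<epsilon> * v))"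
proof -
  define F where "F x = indicator {0<..} x *\<^sub>R (exp (- \<theta> * x) * g (u + \<epsilon> * r + - \<epsilon> * x))" for x
  have F: "integrable lborel F"
    unfolding F_def using laplace_integrable[of \<theta> "- \<epsilon>" b g "u + \<epsilon> * r"] assms by (simp add: set_integrable_def)
  have e: "F (r + (- 1) * v) = indicator {..<r} v *\<^sub>R (exp (- \<theta> * (r - v)) * g (u + \<epsilon> * v))" for v
    by (auto simp: F_def indicator_def algebra_simps)
  show "set_integrable lborel {..<r} (\<lambda>v. exp (- \<theta> * (r - v)) * g (u + \<epsilon> * v))"
    using lborel_integrable_real_affine[OF F, of "- 1" r] unfolding e set_integrable_def by simp
  show "laplace \<theta> (- \<epsilon>) g (u + \<epsilon> * r) = (LBINT v:{..<r}. exp (- \<theta> * (r - v)) * g (u + \<epsilon> * v))"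
    using lborel_integral_real_affine[of "- 1" F r] unfolding e
    by (simp add: F_def[abs_def] laplace_def set_lebesgue_integral_def)
qed

text \<open>The integral over [a, t] is a difference of half-line integrals up to t and up to a. The
  latter enters with the factor exp(-\<theta>(t - a)), the same one that \<open>f a\<close> carries,
  so the two combine into the filter at a.\<close>

lemma ou_functional_affine:
  assumes "\<theta> > 0" "\<bar>\<epsilon>\<bar> = 1" "growth b g" "a \<le> t"
  shows "ou_functional \<theta> a t (\<lambda>v. g (u + \<epsilon> * v)) =
    ou_filter \<theta> (- \<epsilon>) g (u + \<epsilon> * t) - exp (- \<theta> * (t - a)) * ou_filter \<theta> (- \<epsilon>) g (u + \<epsilon> * a)"
proof -
  note [measurable] = growth_measurable[OF assms(3)]
  let ?G = "\<lambda>v. exp (- \<theta> * (t - v)) * g (u + \<epsilon> * v)"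
  note t = laplace_half_line[OF assms(1,2,3), where r = t and u = u]
  note a = laplace_half_line[OF assms(1,2,3), where r = a and u = u]
  have int: "set_integrable lborel {..t} ?G" using t(1) by (subst set_integral_endpoint) auto
  have "laplace \<theta> (- \<epsilon>) g (u + \<epsilon> * t) = (LBINT v:{..t}. ?G v)"
    unfolding t(2) by (rule set_integral_endpoint(2)[symmetric]) measurable
  also have "{..t} = {..<a} \<union> {a..t}" using assms(4) by auto
  also have "(LBINT v:\<dots>. ?G v) = (LBINT v:{..<a}. ?G v) + (LBINT v:{a..t}. ?G v)"
    using assms(4) by (intro set_integral_Un set_integrable_subset[OF int]) auto
  also have "(LBINT v:{..<a}. ?G v) = (LBINT v:{..<a}. exp (- \<theta> * (t - a)) * (exp (- \<theta> * (a - v)) * g (u + \<epsilon> * v)))"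
    by (rule arg_cong[where f = "set_lebesgue_integral lborel {..<a}"]) (auto simp: algebra_simps simp flip: exp_add)
  also have "\<dots> = exp (- \<theta> * (t - a)) * laplace \<theta> (- \<epsilon>) g (u + \<epsilon> * a)"
    unfolding a(2) by (rule set_integral_mult_right)
  finally have 1: "laplace \<theta> (- \<epsilon>) g (u + \<epsilon> * t)
      = exp (- \<theta> * (t - a)) * laplace \<theta> (- \<epsilon>) g (u + \<epsilon> * a) + (LBINT v:{a..t}. ?G v)" .
  have 2: "(LBINT v:{a..t}. \<theta> * exp (- \<theta> * (t - v)) * g (u + \<epsilon> * v)) = \<theta> * (LBINT v:{a..t}. ?G v)"
    unfolding mult.assoc by (rule set_integral_mult_right)
  show ?thesis
    unfolding ou_functional_def ou_filter_def 1 2 by (simp add: algebra_simps)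
qed

lemma ou_functional_const:
  assumes "\<theta> > 0" "a \<le> t"
  shows "ou_functional \<theta> a t (\<lambda>_. k) = 0"
proof -
  have "ou_filter \<theta> (- 1) (\<lambda>_. k) w = 0" for w
    unfolding ou_filter_def
    by (subst laplace_deriv[where b = 0 and b' = 0 and f' = "\<lambda>_. 0"])
       (use assms in \<open>auto intro: growth_const simp: laplace_def\<close>)
  thus ?thesis
    using ou_functional_affine[OF assms(1) _ growth_const[of 0 k] assms(2), of 1 0] by simp
qed

text \<open>The inner functional kills \<alpha> u, the outer one kills the constant left by \<beta>.
  The variable v has sign +1 in u + v and -1 in u - v, which gives inner filters -1 and 1; u always
  has sign +1, hence the outer filter -1 in both \<open>P\<close> and \<open>Q\<close>. The four
  brackets are the product of two pairs, a value at the time itself minus a damped value at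
  a.\<close>

lemma ou_functional_twice:
  assumes \<theta>: "\<theta> > 0" and b: "b \<ge> 0" and g: "growth b \<alpha>" "growth b \<beta>" "growth b g" "growth b h"
    and s: "a \<le> s" and t: "a \<le> t"
    and K: "\<And>u v. a \<le> u \<Longrightarrow> a \<le> v \<Longrightarrow> K u v = \<alpha> u + \<beta> v + g (u + v) + h (u - v)"
  defines "P \<equiv> ou_filter \<theta> (- 1) (ou_filter \<theta> (- 1) g)" and "Q \<equiv> ou_filter \<theta> (- 1) (ou_filter \<theta> 1 h)"
  shows "ou_functional \<theta> a s (\<lambda>u. ou_functional \<theta> a t (K u)) =
      (P (s + t) + Q (s - t)) - exp (- \<theta> * (s - a)) * (P (a + t) + Q (a - t))
      - exp (- \<theta> * (t - a)) * (P (s + a) + Q (s - a))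
      + exp (- \<theta> * (s - a)) * exp (- \<theta> * (t - a)) * (P (a + a) + Q (a - a))"
proof -
  define P1 where "P1 = ou_filter \<theta> (- 1) g"
  define Q1 where "Q1 = ou_filter \<theta> 1 h"
  have gP1: "growth b P1" and gQ1: "growth b Q1"
    unfolding P1_def Q1_def using \<theta> g by (auto intro!: growth_ou_filter)
  have cong: "ou_functional \<theta> a r f = ou_functional \<theta> a r f'"
    if "a \<le> r" "\<And>x. a \<le> x \<Longrightarrow> f x = f' x" for r f f'
  proof -
    have "(LBINT u:{a..r}. \<theta> * exp (- \<theta> * (r - u)) * f u) = (LBINT u:{a..r}. \<theta> * exp (- \<theta> * (r - u)) * f' u)"
      by (rule set_lebesgue_integral_cong) (use that in auto)
    thus ?thesis using that by (simp add: ou_functional_def)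
  qed
  define k where "k = ou_functional \<theta> a t \<beta>"
  define E where "E r = exp (- \<theta> * (r - a))" for r
  have inner: "ou_functional \<theta> a t (K u) = k + (P1 (t + 1 * u) + (- E t) * P1 (a + 1 * u)
      + (Q1 (- t + 1 * u) + (- E t) * Q1 (- a + 1 * u)))" if u: "a \<le> u" for u
  proof -
    have "ou_functional \<theta> a t (K u) = ou_functional \<theta> a t (\<lambda>v. \<alpha> u + (\<beta> v + (g (u + 1 * v) + h (u + (- 1) * v))))"
      by (rule cong[OF t]) (use K[OF u] in simp)
    also have "\<dots> = ou_functional \<theta> a t (\<lambda>v. \<alpha> u) + (ou_functional \<theta> a t \<beta>
        + (ou_functional \<theta> a t (\<lambda>v. g (u + 1 * v)) + ou_functional \<theta> a t (\<lambda>v. h (u + (- 1) * v))))"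
    proof -
      have gv: "growth b (\<lambda>v. g (u + 1 * v))" "growth b (\<lambda>v. h (u + (- 1) * v))"
        using growth_shift[OF g(3), of 1] growth_shift[OF g(4), of "- 1"] by auto
      show ?thesis
        by (simp only: ou_functional_add[OF \<theta> growth_const[OF b, of "\<alpha> u"] growth_add[OF g(2) growth_add[OF gv]]]
            ou_functional_add[OF \<theta> g(2) growth_add[OF gv]] ou_functional_add[OF \<theta> gv])
    qed
    also have "\<dots> = k + ((P1 (u + 1 * t) - E t * P1 (u + 1 * a)) + (Q1 (u + (- 1) * t) - E t * Q1 (u + (- 1) * a)))"
      using ou_functional_affine[OF \<theta> _ g(3) t, of 1 u] ou_functional_affine[OF \<theta> _ g(4) t, of "- 1" u]
        ou_functional_const[OF \<theta> t]
      by (simp add: k_def P1_def Q1_def E_def)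
    finally show ?thesis by (simp add: algebra_simps)
  qed
  have "ou_functional \<theta> a s (\<lambda>u. ou_functional \<theta> a t (K u)) =
      ou_functional \<theta> a s (\<lambda>u. k + (P1 (t + 1 * u) + (- E t) * P1 (a + 1 * u)
      + (Q1 (- t + 1 * u) + (- E t) * Q1 (- a + 1 * u))))"
    by (rule cong[OF s inner])
  also have "\<dots> = ou_functional \<theta> a s (\<lambda>u. k) + (ou_functional \<theta> a s (\<lambda>u. P1 (t + 1 * u))
      + (- E t) * ou_functional \<theta> a s (\<lambda>u. P1 (a + 1 * u))
      + (ou_functional \<theta> a s (\<lambda>u. Q1 (- t + 1 * u)) + (- E t) * ou_functional \<theta> a s (\<lambda>u. Q1 (- a + 1 * u))))"
  proof -
    have gr: "growth b (\<lambda>u. P1 (c + 1 * u))" "growth b (\<lambda>u. Q1 (c + 1 * u))" for c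
      using growth_shift[OF gP1, of 1] growth_shift[OF gQ1, of 1] by auto
    note P = gr(1)[of t] growth_cmult[OF gr(1)[of a], of "- E t"]
    note Q = gr(2)[of "- t"] growth_cmult[OF gr(2)[of "- a"], of "- E t"]
    show ?thesis
      by (simp only: ou_functional_add[OF \<theta> growth_const[OF b] growth_add[OF growth_add[OF P] growth_add[OF Q]]]
          ou_functional_add[OF \<theta> growth_add[OF P] growth_add[OF Q]]
          ou_functional_add[OF \<theta> P] ou_functional_add[OF \<theta> Q] ou_functional_cmult)
  qed
  also have "\<dots> = (P (t + s) - E s * P (t + a)) + (- E t) * (P (a + s) - E s * P (a + a))
      + ((Q (- t + s) - E s * Q (- t + a)) + (- E t) * (Q (- a + s) - E s * Q (- a + a)))"
  proof -
    have "ou_functional \<theta> a s (\<lambda>u. P1 (c + 1 * u)) = P (c + s) - E s * P (c + a)"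
      "ou_functional \<theta> a s (\<lambda>u. Q1 (c + 1 * u)) = Q (c + s) - E s * Q (c + a)" for c
      using ou_functional_affine[OF \<theta> _ gP1 s, of 1 c] ou_functional_affine[OF \<theta> _ gQ1 s, of 1 c]
      by (simp_all add: P_def Q_def P1_def Q1_def E_def)
    thus ?thesis by (simp only: ou_functional_const[OF \<theta> s] add_0)
  qed
  finally show ?thesis
    unfolding E_def by (simp add: algebra_simps)
qed

section \<open>Asymptotics of the filtered power function\<close>

lemma growth_monomial: "growth (a + real k / 2) (\<lambda>w. w ^ k * (1 + w\<^sup>2) powr a)"
proof (rule growthI[of _ 1])
  fix w :: real
  have "\<bar>w\<bar> \<le> (1 + w\<^sup>2) powr (1 / 2)"
    using real_le_rsqrt[of "\<bar>w\<bar>" "1 + w\<^sup>2"] by (simp add: powr_half_sqrt)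
  hence "\<bar>w\<bar> ^ k \<le> ((1 + w\<^sup>2) powr (1 / 2)) ^ k" by (intro power_mono) auto
  also have "\<dots> = (1 + w\<^sup>2) powr (real k / 2)"
    by (subst powr_power) (auto simp: add_nonneg_eq_0_iff)
  finally have "\<bar>w\<bar> ^ k * (1 + w\<^sup>2) powr a \<le> (1 + w\<^sup>2) powr (real k / 2) * (1 + w\<^sup>2) powr a"
    by (rule mult_right_mono) simp
  thus "\<bar>w ^ k * (1 + w\<^sup>2) powr a\<bar> \<le> 1 * (1 + w\<^sup>2) powr (a + real k / 2)"
    by (simp add: abs_mult power_abs powr_add mult.commute)
qed measurable

lemma has_real_derivative_monomial:
  "((\<lambda>w. w ^ k * (1 + w\<^sup>2) powr a) has_real_derivative
     real k * w ^ (k - 1) * (1 + w\<^sup>2) powr a + 2 * a * (w ^ (k + 1) * (1 + w\<^sup>2) powr (a - 1))) (at w)"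
proof -
  have pos: "1 + w\<^sup>2 > 0" by (simp add: add_pos_nonneg)
  have "((\<lambda>w. (1 + w\<^sup>2) powr a) has_real_derivative a * (1 + w\<^sup>2) powr (a - 1) * (2 * w)) (at w)"
    by (rule DERIV_chain2[where f = "\<lambda>z. z powr a" and g = "\<lambda>w. 1 + w\<^sup>2", OF has_real_derivative_powr[OF pos]])
       (auto intro!: derivative_eq_intros)
  from DERIV_mult[OF DERIV_power[OF DERIV_ident, of k] this] show ?thesis
    by (rule DERIV_cong) (simp add: mult_ac)
qed

lemma continuous_monomial: "continuous_on UNIV (\<lambda>w::real. w ^ k * (1 + w\<^sup>2) powr a)"
  by (intro continuous_intros) (auto simp: add_nonneg_eq_0_iff)

text \<open>Each factor is expanded by integration by parts; as \<open>\<sigma>\<^sup>2 = 1\<close>, the first derivative contributes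
  \<open>- \<sigma> f'' / \<theta>\<^sup>2\<close> and everything else is an image of \<open>f'''\<close>.\<close>

lemma growth_ou_filter_twice:
  assumes \<theta>: "\<theta> > 0" and \<sigma>: "\<bar>\<sigma>\<bar> = 1"
    and g: "growth b0 f" "growth b1 f1" "growth b2 f2" "growth b f3"
    and d: "\<And>x. (f has_real_derivative f1 x) (at x)" "\<And>x. (f1 has_real_derivative f2 x) (at x)"
      "\<And>x. (f2 has_real_derivative f3 x) (at x)" and c3: "continuous_on UNIV f3"
  shows "growth b (\<lambda>w. ou_filter \<theta> (- 1) (ou_filter \<theta> \<sigma> f) w + \<sigma> / \<theta>\<^sup>2 * f2 w)"
proof -
  have c: "continuous_on UNIV f1" "continuous_on UNIV f2"
    using d(2,3) by (meson DERIV_isCont continuous_at_imp_continuous_on)+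
  have \<sigma>2: "\<sigma> * \<sigma> = 1" using \<sigma> by (auto simp: abs_if split: if_splits)
  have m: "\<bar>- 1 :: real\<bar> = 1" by simp
  note I = laplace_deriv[OF \<theta> \<sigma> g(1,2) d(1) c(1)] laplace_deriv[OF \<theta> \<sigma> g(2,3) d(2) c(2)]
    laplace_deriv[OF \<theta> \<sigma> g(3,4) d(3) c3]
  note J = laplace_deriv[OF \<theta> m g(2,3) d(2) c(2)] laplace_deriv[OF \<theta> m g(3,4) d(3) c3]
  \<comment> \<open>Additivity of the filter is stated for one exponent, so f1, f2 and the image of
    f3 are put into a common class before splitting.\<close>
  define B where "B = max (max b1 b2) b"
  let ?L = "laplace \<theta> \<sigma> f3"
  have gL: "growth b ?L" by (rule growth_laplace[OF \<theta> \<sigma> g(4)])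
  have gB: "growth B f1" "growth B f2" "growth B ?L"
    by (rule growth_mono[OF g(2)] growth_mono[OF g(3)] growth_mono[OF gL], simp add: B_def)+
  have 1: "ou_filter \<theta> \<sigma> f = (\<lambda>w. (- \<sigma> / \<theta>) * f1 w + ((- 1 / \<theta>\<^sup>2) * f2 w + (- \<sigma> / \<theta>\<^sup>2) * ?L w))"
  proof
    fix w
    have "laplace \<theta> \<sigma> f1 w = (f1 w + \<sigma> * laplace \<theta> \<sigma> f2 w) / \<theta>" "laplace \<theta> \<sigma> f2 w = (f2 w + \<sigma> * ?L w) / \<theta>"
      using I(2)[of w] I(3)[of w] \<theta> by (simp_all add: field_simps)
    hence "ou_filter \<theta> \<sigma> f w = - \<sigma> * ((f1 w + \<sigma> * ((f2 w + \<sigma> * ?L w) / \<theta>)) / \<theta>)"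
      using I(1)[of w] by (simp add: ou_filter_def)
    also have "\<dots> = (- \<sigma> / \<theta>) * f1 w + ((- (\<sigma> * \<sigma>) / \<theta>\<^sup>2) * f2 w + (- (\<sigma> * \<sigma>) * \<sigma> / \<theta>\<^sup>2) * ?L w)"
      using \<theta> by (simp add: field_simps power2_eq_square)
    finally show "ou_filter \<theta> \<sigma> f w = (- \<sigma> / \<theta>) * f1 w + ((- 1 / \<theta>\<^sup>2) * f2 w + (- \<sigma> / \<theta>\<^sup>2) * ?L w)"
      unfolding \<sigma>2 by simp
  qed
  have 2: "ou_filter \<theta> (- 1) (ou_filter \<theta> \<sigma> f) w + \<sigma> / \<theta>\<^sup>2 * f2 w =
      (\<sigma> / \<theta>\<^sup>2 - 1 / \<theta>\<^sup>2) * laplace \<theta> (- 1) f3 w + (- \<sigma> / \<theta>\<^sup>2) * ou_filter \<theta> (- 1) ?L w" for w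
  proof -
    have "ou_filter \<theta> (- 1) (ou_filter \<theta> \<sigma> f) w = (- \<sigma> / \<theta>) * ou_filter \<theta> (- 1) f1 w
        + ((- 1 / \<theta>\<^sup>2) * ou_filter \<theta> (- 1) f2 w + (- \<sigma> / \<theta>\<^sup>2) * ou_filter \<theta> (- 1) ?L w)"
      unfolding 1
      by (simp only: ou_filter_add[OF \<theta> m growth_cmult[OF gB(1)] growth_add[OF growth_cmult[OF gB(2)] growth_cmult[OF gB(3)]]]
          ou_filter_add[OF \<theta> m growth_cmult[OF gB(2)] growth_cmult[OF gB(3)]] ou_filter_cmult)
    moreover have "ou_filter \<theta> (- 1) f2 w = laplace \<theta> (- 1) f3 w"
      using J(2)[of w] by (simp add: ou_filter_def)
    moreover have "ou_filter \<theta> (- 1) f1 w = (f2 w - laplace \<theta> (- 1) f3 w) / \<theta>"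
      using J(1)[of w] J(2)[of w] \<theta> by (simp add: ou_filter_def field_simps)
    ultimately have e: "ou_filter \<theta> (- 1) (ou_filter \<theta> \<sigma> f) w = (- \<sigma> / \<theta>) * ((f2 w - laplace \<theta> (- 1) f3 w) / \<theta>)
        + ((- 1 / \<theta>\<^sup>2) * laplace \<theta> (- 1) f3 w + (- \<sigma> / \<theta>\<^sup>2) * ou_filter \<theta> (- 1) ?L w)"
      by simp
    show ?thesis unfolding e using \<theta> by (simp add: field_simps power2_eq_square)
  qed
  show ?thesis
    unfolding 2 by (intro growth_add growth_cmult growth_laplace[OF \<theta> m g(4)] growth_ou_filter[OF \<theta> m gL])
qed

section \<open>Smooth approximation of |w|^(2H)\<close>

lemma powr_le_affine:
  fixes x a :: real
  assumes "0 \<le> x" "0 < a" "a < 1"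
  shows "x powr a \<le> 1 - a * (1 - x)"
proof (cases "x = 0")
  case False
  thus ?thesis
    \<comment> \<open>The tangent at 1 of the concave power: weighted AM-GM of x and 1.\<close>
    using Youngs_inequality_0[of a "1 - a" x 1] assms by (simp add: algebra_simps)
qed (use assms in simp)

text \<open>The tangent bound for the complementary exponent gives (1 - z)^(1-a) \<le> D, hence (1 -
  z)^a \<ge> (1 - z) / D. The quadratic equals (1 - z)(1 + (1 - a) z), and multiplied by D = 1 - (1
  - a) z it stays below 1 - z.\<close>

lemma powr_ge_quadratic:
  fixes z a :: real
  assumes "0 \<le> z" "z < 1" "0 < a" "a < 1"
  shows "1 - a * z - (1 - a) * z\<^sup>2 \<le> (1 - z) powr a"
proof -
  define D where "D = 1 - (1 - a) * z"
  have "(1 - a) * z < 1" using assms mult_strict_mono'[of "1 - a" 1 z 1] by auto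
  hence D: "D > 0" by (simp add: D_def)
  have "(1 - z) powr (1 - a) \<le> D"
    using powr_le_affine[of "1 - z" "1 - a"] assms by (simp add: D_def)
  hence "(1 - z) powr a * (1 - z) powr (1 - a) \<le> (1 - z) powr a * D" by (intro mult_left_mono) auto
  hence x: "1 - z \<le> (1 - z) powr a * D" using assms by (simp flip: powr_add)
  have "(1 - a * z - (1 - a) * z\<^sup>2) * D = (1 - z) * (1 - ((1 - a) * z)\<^sup>2)"
    by (simp add: D_def power2_eq_square algebra_simps)
  also have "\<dots> \<le> (1 - z) * 1" using assms by (intro mult_left_mono) auto
  also have "\<dots> \<le> (1 - z) powr a * D" using x by simp
  finally have "(1 - a * z - (1 - a) * z\<^sup>2) * D \<le> (1 - z) powr a * D" .
  thus ?thesis using D by simp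
qed

text \<open>With y = 1 + w^2 and z = 1/y the power is y^H (1 - z)^H. Its first two terms in z are
  the subtracted function, and the upper and lower bounds above leave a remainder of at most y^H z^2
  = y^(H-2), uniformly down to w = 0.\<close>

lemma growth_abs_powr_remainder:
  assumes "0 < H" "H < 1"
  shows "growth (H - 2) (\<lambda>w. \<bar>w\<bar> powr (2 * H) - ((1 + w\<^sup>2) powr H - H * (1 + w\<^sup>2) powr (H - 1)))"
proof (rule growthI[of _ 1])
  fix w :: real
  define y where "y = 1 + w\<^sup>2"
  define z where "z = 1 / y"
  have y: "y \<ge> 1" by (simp add: y_def)
  hence z: "0 < z" "z \<le> 1" "y * z = 1" by (auto simp: z_def)
  have "\<bar>w\<bar> powr (2 * H) = (w\<^sup>2) powr H" by (simp add: powr_powr[symmetric] powr_numeral)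
  also have "w\<^sup>2 = y * (1 - z)" using z(3) by (simp add: y_def algebra_simps)
  also have "\<dots> powr H = y powr H * (1 - z) powr H" by (rule powr_mult)
  finally have w: "\<bar>w\<bar> powr (2 * H) = y powr H * (1 - z) powr H" .
  have "y powr (H - 1) = y powr H * z" "y powr (H - 2) = y powr H * z\<^sup>2"
    using y by (simp_all add: powr_diff z_def power_divide)
  hence e: "\<bar>w\<bar> powr (2 * H) - (y powr H - H * y powr (H - 1)) = y powr H * ((1 - z) powr H - (1 - H * z))"
    and e2: "y powr (H - 2) = y powr H * z\<^sup>2"
    unfolding w by (simp_all add: algebra_simps)
  have "(1 - z) powr H \<le> 1 - H * z" using powr_le_affine[of "1 - z" H] assms z by simp
  moreover have "(1 - z) powr H \<ge> 1 - H * z - (1 - H) * z\<^sup>2"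
  \<comment> \<open>z = 1 means w = 0, outside the range of \<open>powr_ge_quadratic\<close>; both
    sides are then 0.\<close>
  proof (cases "z = 1")
    case False
    thus ?thesis using powr_ge_quadratic[of z H] z assms by simp
  qed simp
  moreover have "(1 - H) * z\<^sup>2 \<le> z\<^sup>2" using assms by (simp add: mult_left_le_one_le)
  ultimately have "\<bar>(1 - z) powr H - (1 - H * z)\<bar> \<le> z\<^sup>2" by linarith
  hence "y powr H * \<bar>(1 - z) powr H - (1 - H * z)\<bar> \<le> y powr H * z\<^sup>2" by (rule mult_left_mono) simp
  thus "\<bar>\<bar>w\<bar> powr (2 * H) - ((1 + w\<^sup>2) powr H - H * (1 + w\<^sup>2) powr (H - 1))\<bar> \<le> 1 * (1 + w\<^sup>2) powr (H - 2)"
    unfolding y_def[symmetric] e e2 by (simp add: abs_mult)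
qed measurable

lemma growth_abs_powr:
  assumes "0 \<le> H"
  shows "growth H (\<lambda>w. \<bar>w\<bar> powr (2 * H))"
proof (rule growthI[of _ 1])
  fix w :: real
  have "\<bar>w\<bar> powr (2 * H) = (w\<^sup>2) powr H" by (simp add: powr_powr[symmetric] powr_numeral)
  also have "\<dots> \<le> (1 + w\<^sup>2) powr H" using assms by (intro powr_mono2) auto
  finally show "\<bar>\<bar>w\<bar> powr (2 * H)\<bar> \<le> 1 * (1 + w\<^sup>2) powr H" by simp
qed measurable

text \<open>Replacing \<open>|w|\<^bsup>2H\<^esup>\<close> by the smooth function \<open>(1 + w\<^sup>2)\<^bsup>H\<^esup> - H (1 + w\<^sup>2)\<^bsup>H-1\<^esup>\<close> costs only
  \<open>O((1 + w\<^sup>2)\<^bsup>H-2\<^esup>)\<close>, which the filters preserve.\<close>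

lemma growth_ou_filter_abs_powr:
  assumes H: "0 < H" "H < 1" and \<theta>: "\<theta> > 0" and \<sigma>: "\<bar>\<sigma>\<bar> = 1"
  shows "growth (H - 3 / 2) (\<lambda>w. ou_filter \<theta> (- 1) (ou_filter \<theta> \<sigma> (\<lambda>w. \<bar>w\<bar> powr (2 * H))) w
           + \<sigma> / \<theta>\<^sup>2 * (2 * H * (2 * H - 1) * (1 + w\<^sup>2) powr (H - 1)))"
proof -
  define p where "p k a w = w ^ k * (1 + w\<^sup>2) powr a" for k :: nat and a w :: real
  define f where "f w = p 0 H w - H * p 0 (H - 1) w" for w
  define f1 where "f1 w = 2 * H * p 1 (H - 1) w - 2 * H * (H - 1) * p 1 (H - 2) w" for w
  define f2 where "f2 w = 2 * H * p 0 (H - 1) w + 4 * H * (H - 1) * p 2 (H - 2) w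
      - 2 * H * (H - 1) * p 0 (H - 2) w - 4 * H * (H - 1) * (H - 2) * p 2 (H - 3) w" for w
  \<comment> \<open>Each term \<open>p k a\<close> of f3 has a + k/2 \<le> H - 3/2, so three
    derivatives just reach the target class.\<close>
  define f3 where "f3 w = 12 * H * (H - 1) * p 1 (H - 2) w + 8 * H * (H - 1) * (H - 2) * p 3 (H - 3) w
      - 12 * H * (H - 1) * (H - 2) * p 1 (H - 3) w - 8 * H * (H - 1) * (H - 2) * (H - 3) * p 3 (H - 4) w" for w
  define c where "c w = \<bar>w\<bar> powr (2 * H) - f w" for w
  have gp: "growth b (p k a)" if "a + real k / 2 \<le> b" for k a b
    using growth_mono[OF growth_monomial that] by (simp add: p_def[abs_def])
  have dp: "(p k a has_real_derivative real k * p (k - 1) a w + 2 * a * p (k + 1) (a - 1) w) (at w)" for k a w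
    using has_real_derivative_monomial[of k a w] by (simp add: p_def[abs_def] mult.assoc)
  have cp: "continuous_on UNIV (p k a)" for k a
    using continuous_monomial[of k a] by (simp add: p_def[abs_def])
  have g: "growth H f" "growth H f1" "growth H f2" "growth (H - 3 / 2) f3"
    unfolding f_def f1_def f2_def f3_def by (intro growth_add growth_diff growth_cmult gp; simp)+
  have d: "(f has_real_derivative f1 x) (at x)" "(f1 has_real_derivative f2 x) (at x)"
    "(f2 has_real_derivative f3 x) (at x)" for x
    unfolding f_def f1_def f2_def f3_def
    by (rule DERIV_cong, (rule DERIV_add DERIV_diff DERIV_cmult dp)+, simp add: numeral_3_eq_3 numeral_2_eq_2 algebra_simps)+
  have c3: "continuous_on UNIV f3" unfolding f3_def by (intro continuous_intros cp)
  have gc: "growth (H - 3 / 2) c"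
    using growth_mono[OF growth_abs_powr_remainder[OF H], of "H - 3 / 2"] by (simp add: c_def[abs_def] f_def p_def)
  have m: "\<bar>- 1 :: real\<bar> = 1" by simp
  have gcH: "growth H c" by (rule growth_mono[OF gc]) simp
  have eq: "ou_filter \<theta> (- 1) (ou_filter \<theta> \<sigma> (\<lambda>w. \<bar>w\<bar> powr (2 * H))) w
      = ou_filter \<theta> (- 1) (ou_filter \<theta> \<sigma> f) w + ou_filter \<theta> (- 1) (ou_filter \<theta> \<sigma> c) w" for w
  proof -
    have "(\<lambda>w. \<bar>w\<bar> powr (2 * H)) = (\<lambda>w. f w + c w)" by (simp add: c_def)
    hence "ou_filter \<theta> \<sigma> (\<lambda>w. \<bar>w\<bar> powr (2 * H)) = (\<lambda>w. ou_filter \<theta> \<sigma> f w + ou_filter \<theta> \<sigma> c w)"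
      by (simp only: fun_eq_iff ou_filter_add[OF \<theta> \<sigma> g(1) gcH] simp_thms)
    thus ?thesis
      by (simp only: ou_filter_add[OF \<theta> m growth_ou_filter[OF \<theta> \<sigma> g(1)] growth_ou_filter[OF \<theta> \<sigma> gcH]])
  qed
  \<comment> \<open>Writing w^2 as (1 + w^2) - 1 turns f2 into pure powers of the weight. Its
    leading coefficient becomes 2H + 4H(H - 1) = 2H(2H - 1).\<close>
  have p2: "p 2 a w = p 0 (a + 1) w - p 0 a w" for a w
    unfolding p_def by (simp add: powr_add add_nonneg_eq_0_iff algebra_simps)
  have "2 * H * (2 * H - 1) * (1 + w\<^sup>2) powr (H - 1) - f2 w =
      (4 * H * (H - 1) + 2 * H * (H - 1)) * p 0 (H - 2) w + 4 * H * (H - 1) * (H - 2) * p 2 (H - 3) w" for w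
  proof -
    have e: "p 2 (H - 2) w = p 0 (H - 1) w - p 0 (H - 2) w" using p2[of "H - 2" w] by simp
    show ?thesis unfolding f2_def e by (simp add: p_def[of 0] algebra_simps)
  qed
  moreover have "growth (H - 3 / 2) (\<lambda>w. (4 * H * (H - 1) + 2 * H * (H - 1)) * p 0 (H - 2) w + 4 * H * (H - 1) * (H - 2) * p 2 (H - 3) w)"
    by (intro growth_add growth_cmult gp; simp)
  ultimately have r: "growth (H - 3 / 2) (\<lambda>w. 2 * H * (2 * H - 1) * (1 + w\<^sup>2) powr (H - 1) - f2 w)"
    by simp
  have "growth (H - 3 / 2) (\<lambda>w. (ou_filter \<theta> (- 1) (ou_filter \<theta> \<sigma> f) w + \<sigma> / \<theta>\<^sup>2 * f2 w)
      + (ou_filter \<theta> (- 1) (ou_filter \<theta> \<sigma> c) w + \<sigma> / \<theta>\<^sup>2 * (2 * H * (2 * H - 1) * (1 + w\<^sup>2) powr (H - 1) - f2 w)))"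
    by (intro growth_add growth_cmult r growth_ou_filter[OF \<theta> m growth_ou_filter[OF \<theta> \<sigma> gc]]
        growth_ou_filter_twice[OF \<theta> \<sigma> g d c3])
  thus ?thesis unfolding eq by (simp add: algebra_simps)
qed

section \<open>Sums of powers\<close>

definition zeta_sum :: "real \<Rightarrow> nat \<Rightarrow> real" where
  "zeta_sum r n = (\<Sum>k=1..n. real k powr (- r))"

text \<open>Telescoping: the tangent at n + 1 of the concave function x^(1-r) shows that (1 - r)(n +
  1)^(-r) is at most the increment from n to n + 1.\<close>

lemma zeta_sum_le_powr:
  assumes "0 < r" "r < 1"
  shows "zeta_sum r n \<le> real n powr (1 - r) / (1 - r)"
proof (induction n)
  case (Suc n)
  define y where "y = real (Suc n)"
  have y: "y > 0" "real n = y * (real n / y)" "1 - real n / y = 1 / y" by (auto simp: y_def field_simps)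
  have "(real n / y) powr (1 - r) \<le> 1 - (1 - r) * (1 - real n / y)"
    by (rule powr_le_affine) (use assms y in auto)
  hence "y powr (1 - r) * (real n / y) powr (1 - r) \<le> y powr (1 - r) * (1 - (1 - r) * (1 / y))"
    unfolding y(3) by (intro mult_left_mono) auto
  also have "\<dots> = y powr (1 - r) - (1 - r) * (y powr (1 - r) / y)" by (simp add: algebra_simps)
  also have "y powr (1 - r) / y = y powr (- r)" using y(1) by (simp add: powr_diff powr_minus field_simps)
  also have "y powr (1 - r) * (real n / y) powr (1 - r) = real n powr (1 - r)"
    using y(2) by (simp flip: powr_mult)
  finally have "(1 - r) * y powr (- r) \<le> y powr (1 - r) - real n powr (1 - r)" by linarith
  hence "y powr (- r) \<le> y powr (1 - r) / (1 - r) - real n powr (1 - r) / (1 - r)"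
    using assms by (simp only: diff_divide_distrib[symmetric] pos_le_divide_eq diff_gt_0_iff_gt mult.commute)
  thus ?case using Suc by (simp add: zeta_sum_def y_def)
qed (simp add: zeta_sum_def)

text \<open>Tangent inequality at y = x + 1 for the convex function x^(1-s), obtained from ln z
  \<le> z - 1 and 1 + u \<le> exp u.\<close>

lemma powr_telescope_gt_1:
  fixes s x :: real
  assumes "s > 1" "x > 0"
  shows "(s - 1) * (x + 1) powr (- s) \<le> x powr (1 - s) - (x + 1) powr (1 - s)"
proof -
  define y where "y = x + 1"
  have y: "y > 0" "x = y * (x / y)" "x / y = 1 - 1 / y" using assms by (auto simp: y_def field_simps)
  have "x / y > 0" using assms(2) by (simp add: y_def)
  hence "ln (x / y) \<le> x / y - 1" by (rule ln_le_minus_one)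
  hence "ln (x / y) \<le> - (1 / y)" using y by linarith
  hence "(1 - s) * (- (1 / y)) \<le> (1 - s) * ln (x / y)" using assms by (intro mult_left_mono_neg) auto
  moreover have "(1 - s) * (- (1 / y)) = (s - 1) / y" by (simp add: diff_divide_distrib)
  ultimately have "1 + (s - 1) / y \<le> 1 + (1 - s) * ln (x / y)" by linarith
  also have "\<dots> \<le> exp ((1 - s) * ln (x / y))" by (rule exp_ge_add_one_self)
  also have "\<dots> = (x / y) powr (1 - s)" using \<open>x / y > 0\<close> by (auto simp: powr_def)
  finally have "y powr (1 - s) * (1 + (s - 1) / y) \<le> y powr (1 - s) * (x / y) powr (1 - s)"
    by (rule mult_left_mono) simp
  also have "\<dots> = x powr (1 - s)" using y(2) by (simp flip: powr_mult)
  also have "y powr (1 - s) * (1 + (s - 1) / y) = y powr (1 - s) + (s - 1) * (y powr (1 - s) / y)"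
    by (simp add: algebra_simps)
  also have "y powr (1 - s) / y = y powr (- s)" using y(1) by (simp add: powr_diff powr_minus field_simps)
  finally show ?thesis by (simp add: y_def)
qed

text \<open>The first term is estimated on its own and accounts for the 1 in the constant; the
  others telescope from m + 1, a positive base point even for m = 0. The induction carries the
  negative endpoint of the telescope, which is dropped at the end.\<close>

lemma powr_tail_partial_sum_le:
  assumes "s > 1"
  shows "(\<Sum>k<N. real (m + 1 + k) powr (- s)) \<le> (1 + 1 / (s - 1)) * real (m + 1) powr (1 - s)"
proof -
  have "(\<Sum>k<Suc N. real (m + 1 + k) powr (- s))
      \<le> (1 + 1 / (s - 1)) * real (m + 1) powr (1 - s) - real (m + Suc N) powr (1 - s) / (s - 1)" for N
  proof (induction N)
    case 0
    have "real (m + 1) powr (- s) \<le> real (m + 1) powr (1 - s)" by (intro powr_mono) auto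
    thus ?case by (simp add: algebra_simps)
  next
    case (Suc N)
    have "(s - 1) * (real (m + Suc N) + 1) powr (- s)
        \<le> real (m + Suc N) powr (1 - s) - (real (m + Suc N) + 1) powr (1 - s)"
      by (rule powr_telescope_gt_1) (use assms in auto)
    hence "(real (m + Suc N) + 1) powr (- s)
        \<le> real (m + Suc N) powr (1 - s) / (s - 1) - (real (m + Suc N) + 1) powr (1 - s) / (s - 1)"
      using assms by (simp only: diff_divide_distrib[symmetric] pos_le_divide_eq diff_gt_0_iff_gt mult.commute)
    moreover have e: "real (m + 1 + Suc N) = real (m + Suc N) + 1" "real (m + Suc (Suc N)) = real (m + Suc N) + 1" by auto
    ultimately show ?case using Suc unfolding sum.lessThan_Suc[of _ "Suc N"] e by linarith
  qed
  moreover have "real (m + Suc N) powr (1 - s) / (s - 1) \<ge> 0" for N using assms by simp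
  ultimately have "(\<Sum>k<Suc N. real (m + 1 + k) powr (- s)) \<le> (1 + 1 / (s - 1)) * real (m + 1) powr (1 - s)" for N
    by (meson diff_le_eq le_add_same_cancel1 order_trans)
  moreover have "(\<Sum>k<N. real (m + 1 + k) powr (- s)) \<le> (\<Sum>k<Suc N. real (m + 1 + k) powr (- s))"
    by (rule sum_mono2) auto
  ultimately show ?thesis by (rule order_trans[rotated])
qed

lemma zeta_sum_bounded:
  assumes "s > 1"
  shows "zeta_sum s n \<le> 1 + 1 / (s - 1)"
proof -
  have "zeta_sum s n = (\<Sum>k<n. real (0 + 1 + k) powr (- s))"
    unfolding zeta_sum_def by (rule sum.reindex_bij_witness[of _ "\<lambda>k. k + 1" "\<lambda>k. k - 1"]) auto
  thus ?thesis using powr_tail_partial_sum_le[OF assms, where N = n and m = 0] by simp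
qed

lemma zeta_sum_ge_1: "n \<ge> 1 \<Longrightarrow> zeta_sum r n \<ge> 1"
  using sum_mono2[of "{1..n}" "{1}" "\<lambda>k. real k powr (- r)"] by (simp add: zeta_sum_def)

text \<open>The error is the average of the tails of the series. The tail after m is O((m +
  1)^(1-s)), and these bounds add up to \<open>zeta_sum (s - 1) n\<close>, which may grow with n if
  s \<le> 2.\<close>

lemma cesaro_tail_bound:
  assumes s: "s > 1" and g: "\<And>k. k \<ge> 1 \<Longrightarrow> 0 \<le> g k \<and> g k \<le> C * real k powr (- s)"
  shows "summable (\<lambda>k. g (Suc k))"
    and "n \<ge> 1 \<Longrightarrow> \<bar>(\<Sum>m<n. \<Sum>k=1..m. g k) / real n - (\<Sum>k. g (Suc k))\<bar>
           \<le> C * (1 + 1 / (s - 1)) * zeta_sum (s - 1) n / real n"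
proof -
  have C: "C \<ge> 0" using g[of 1] by simp
  have part: "(\<Sum>k<N. g (Suc (k + m))) \<le> C * ((1 + 1 / (s - 1)) * real (m + 1) powr (1 - s))" for N m
  proof -
    have "(\<Sum>k<N. g (Suc (k + m))) \<le> (\<Sum>k<N. C * real (m + 1 + k) powr (- s))"
    proof (rule sum_mono)
      fix k
      have "real (Suc (k + m)) = real (m + 1 + k)" by simp
      thus "g (Suc (k + m)) \<le> C * real (m + 1 + k) powr (- s)" using g[of "Suc (k + m)"] by (simp add: add_ac)
    qed
    also have "\<dots> = C * (\<Sum>k<N. real (m + 1 + k) powr (- s))" by (simp add: sum_distrib_left)
    also have "\<dots> \<le> C * ((1 + 1 / (s - 1)) * real (m + 1) powr (1 - s))"
      by (intro mult_left_mono powr_tail_partial_sum_le s C)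
    finally show ?thesis .
  qed
  show sm: "summable (\<lambda>k. g (Suc k))"
  proof (rule summableI_nonneg_bounded)
    show "(\<Sum>k<N. g (Suc k)) \<le> C * (1 + 1 / (s - 1))" for N using part[of 0 N] by simp
  qed (use g in auto)
  define S where "S = (\<Sum>k. g (Suc k))"
  have tail: "0 \<le> S - (\<Sum>k=1..m. g k) \<and> S - (\<Sum>k=1..m. g k) \<le> C * (1 + 1 / (s - 1)) * real (m + 1) powr (1 - s)" for m
  proof -
    have "(\<Sum>k=1..m. g k) = (\<Sum>k<m. g (Suc k))"
      by (rule sum.reindex_bij_witness[of _ "\<lambda>k. k + 1" "\<lambda>k. k - 1"]) auto
    hence e: "S - (\<Sum>k=1..m. g k) = (\<Sum>k. g (Suc (k + m)))"
      using suminf_minus_initial_segment[OF sm, of m] by (simp add: S_def)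
    have sm': "summable (\<lambda>k. g (Suc (k + m)))" using sm summable_iff_shift[of "\<lambda>k. g (Suc k)" m] by simp
    have "0 \<le> (\<Sum>k. g (Suc (k + m)))" by (rule suminf_nonneg[OF sm']) (use g in auto)
    moreover have "(\<Sum>k. g (Suc (k + m))) \<le> C * ((1 + 1 / (s - 1)) * real (m + 1) powr (1 - s))"
      by (rule suminf_le_const[OF sm' part])
    ultimately show ?thesis unfolding e by (simp only: mult.assoc simp_thms)
  qed
  assume n: "n \<ge> 1"
  have "(\<Sum>m<n. real (m + 1) powr (1 - s)) = zeta_sum (s - 1) n"
    unfolding zeta_sum_def by (rule sum.reindex_bij_witness[of _ "\<lambda>k. k - 1" "\<lambda>k. k + 1"]) auto
  moreover have "(\<Sum>m<n. S - (\<Sum>k=1..m. g k)) \<le> (\<Sum>m<n. C * (1 + 1 / (s - 1)) * real (m + 1) powr (1 - s))"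
    by (rule sum_mono) (use tail in auto)
  ultimately have "(\<Sum>m<n. S - (\<Sum>k=1..m. g k)) \<le> C * (1 + 1 / (s - 1)) * zeta_sum (s - 1) n"
    by (simp flip: sum_distrib_left)
  moreover have "0 \<le> (\<Sum>m<n. S - (\<Sum>k=1..m. g k))" by (rule sum_nonneg) (use tail in auto)
  moreover have "(\<Sum>m<n. S - (\<Sum>k=1..m. g k)) = real n * S - (\<Sum>m<n. \<Sum>k=1..m. g k)"
    by (simp add: sum_subtractf)
  ultimately have "\<bar>(\<Sum>m<n. \<Sum>k=1..m. g k) - real n * S\<bar> \<le> C * (1 + 1 / (s - 1)) * zeta_sum (s - 1) n" by linarith
  hence "\<bar>((\<Sum>m<n. \<Sum>k=1..m. g k) - real n * S) / real n\<bar> \<le> C * (1 + 1 / (s - 1)) * zeta_sum (s - 1) n / real n"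
    unfolding abs_divide using n by (simp add: divide_right_mono)
  moreover have "((\<Sum>m<n. \<Sum>k=1..m. g k) - real n * S) / real n = (\<Sum>m<n. \<Sum>k=1..m. g k) / real n - S"
    using n by (simp add: diff_divide_distrib)
  ultimately show "\<bar>(\<Sum>m<n. \<Sum>k=1..m. g k) / real n - (\<Sum>k. g (Suc k))\<bar>
           \<le> C * (1 + 1 / (s - 1)) * zeta_sum (s - 1) n / real n"
    unfolding S_def[symmetric] by (simp only:)
qed

text \<open>Passing from n to n + 1 adds a row, a column and one diagonal entry, so each lag 1, ...,
  n enters once with either sign. The iterated form, rather than weights n - k, exposes a Cesaro
  mean of partial sums.\<close>

lemma sum_differences:
  fixes f :: "real \<Rightarrow> real"
  shows "(\<Sum>i=1..n. \<Sum>j=1..n. f (real i - real j)) = real n * f 0 + (\<Sum>m<n. \<Sum>k=1..m. f (real k) + f (- real k))"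
proof (induction n)
  case (Suc n)
  have "(\<Sum>i=1..n. f (real i - real (Suc n))) = (\<Sum>k=1..n. f (- real k))"
    by (rule sum.reindex_bij_witness[of _ "\<lambda>k. Suc n - k" "\<lambda>k. Suc n - k"]) (auto simp: of_nat_diff algebra_simps)
  moreover have "(\<Sum>j=1..n. f (real (Suc n) - real j)) = (\<Sum>k=1..n. f (real k))"
    by (rule sum.reindex_bij_witness[of _ "\<lambda>k. Suc n - k" "\<lambda>k. Suc n - k"]) (auto simp: of_nat_diff algebra_simps)
  moreover have "(\<Sum>i=1..Suc n. \<Sum>j=1..Suc n. f (real i - real j)) =
      (\<Sum>i=1..n. \<Sum>j=1..n. f (real i - real j)) + (\<Sum>i=1..n. f (real i - real (Suc n)))
      + ((\<Sum>j=1..n. f (real (Suc n) - real j)) + f 0)"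
    by (simp add: sum.distrib)
  ultimately show ?case using Suc by (simp add: sum.distrib algebra_simps)
qed simp

section \<open>Double sums and the nonstationary perturbation\<close>

lemma powr_bracket_le:
  assumes "\<gamma> \<ge> 0" "k \<ge> 1"
  shows "(1 + (real k)\<^sup>2) powr (- \<gamma>) \<le> real k powr (- (2 * \<gamma>))"
proof -
  have "(1 + (real k)\<^sup>2) powr (- \<gamma>) \<le> ((real k)\<^sup>2) powr (- \<gamma>)" by (rule powr_mono2') (use assms in auto)
  also have "\<dots> = real k powr (- (2 * \<gamma>))" using assms by (simp add: powr_powr flip: powr_numeral)
  finally show ?thesis .
qed

lemma bracket_sum_le:
  assumes "\<gamma> > 0" "i \<in> {1..n}"
  shows "(\<Sum>j=1..n. (1 + (real i - real j)\<^sup>2) powr (- \<gamma>)) \<le> 1 + 2 * zeta_sum (2 * \<gamma>) n"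
proof -
  let ?p = "\<lambda>w::real. (1 + w\<^sup>2) powr (- \<gamma>)"
  have Z: "(\<Sum>k=1..m. ?p (real k)) \<le> zeta_sum (2 * \<gamma>) n" if "m \<le> n" for m
  proof -
    have "(\<Sum>k=1..m. ?p (real k)) \<le> (\<Sum>k=1..m. real k powr (- (2 * \<gamma>)))" by (intro sum_mono powr_bracket_le) (use assms in auto)
    also have "\<dots> \<le> zeta_sum (2 * \<gamma>) n" unfolding zeta_sum_def by (rule sum_mono2) (use that in auto)
    finally show ?thesis .
  qed
  have disj: "{Suc 0..<i} \<inter> {i<..n} = {}" by auto
  have "{1..n} = {1..<i} \<union> ({i} \<union> {i<..n})" using assms by auto
  hence "(\<Sum>j=1..n. ?p (real i - real j)) = (\<Sum>j\<in>{1..<i}. ?p (real i - real j)) + (1 + (\<Sum>j\<in>{i<..n}. ?p (real i - real j)))"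
    by (simp add: sum.union_disjoint disj)
  also have "(\<Sum>j\<in>{1..<i}. ?p (real i - real j)) = (\<Sum>k=1..i-1. ?p (real k))"
    by (rule sum.reindex_bij_witness[of _ "\<lambda>k. i - k" "\<lambda>k. i - k"]) (use assms in \<open>auto simp: of_nat_diff\<close>)
  also have "(\<Sum>j\<in>{i<..n}. ?p (real i - real j)) = (\<Sum>k=1..n-i. ?p (real k))"
    by (rule sum.reindex_bij_witness[of _ "\<lambda>k. i + k" "\<lambda>k. k - i"]) (use assms in \<open>auto simp: of_nat_diff power2_commute\<close>)
  finally have "(\<Sum>j=1..n. ?p (real i - real j)) = (\<Sum>k=1..i-1. ?p (real k)) + (1 + (\<Sum>k=1..n-i. ?p (real k)))" .
  moreover have "i - 1 \<le> n" "n - i \<le> n" using assms by auto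
  ultimately show ?thesis using Z[of "i - 1"] Z[of "n - i"] by linarith
qed

text \<open>With e = R - \<rho> and r = \<rho>, the difference of squares is e (2r + e). As i + j
  dominates both i and |i - j|, the bound on e is spent in two ways: i^(-2\<gamma>) for the first
  factor, the bracket in i - j for the second. The double sum then splits into a sum over i and a
  sum over j.\<close>

lemma sum_squares_perturbation:
  fixes R \<rho> and \<gamma> C :: real
  assumes \<gamma>: "\<gamma> > 0" and C: "C > 0"
    and \<rho>: "\<And>w. \<bar>\<rho> w\<bar> \<le> C * (1 + w\<^sup>2) powr (- \<gamma>)"
    and R: "\<And>s t. 0 \<le> s \<Longrightarrow> 0 \<le> t \<Longrightarrow> \<bar>R s t - \<rho> (s - t)\<bar> \<le> C * (1 + (s + t)\<^sup>2) powr (- \<gamma>)"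
    and n: "n \<ge> 1"
  shows "\<bar>(\<Sum>i=1..n. \<Sum>j=1..n. (R (real i) (real j))\<^sup>2) - (\<Sum>i=1..n. \<Sum>j=1..n. (\<rho> (real i - real j))\<^sup>2)\<bar>
           \<le> 9 * C\<^sup>2 * (zeta_sum (2 * \<gamma>) n)\<^sup>2"
proof -
  let ?p = "\<lambda>w::real. (1 + w\<^sup>2) powr (- \<gamma>)"
  define Z where "Z = zeta_sum (2 * \<gamma>) n"
  \<comment> \<open>Absorbs the diagonal entry of each row: 1 + 2 Z \<le> 3 Z.\<close>
  have Z: "Z \<ge> 1" unfolding Z_def by (rule zeta_sum_ge_1[OF n])
  have term_le: "\<bar>(R (real i) (real j))\<^sup>2 - (\<rho> (real i - real j))\<^sup>2\<bar> \<le> 3 * C\<^sup>2 * (real i powr (- (2 * \<gamma>)) * ?p (real i - real j))"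
    if i: "i \<ge> 1" for i j
  proof -
    define e where "e = R (real i) (real j) - \<rho> (real i - real j)"
    define r where "r = \<rho> (real i - real j)"
    have "?p (real i + real j) \<le> ((real i)\<^sup>2) powr (- \<gamma>)"
      by (rule powr_mono2') (use \<gamma> i in \<open>auto intro: add_increasing power_mono\<close>)
    also have "\<dots> = real i powr (- (2 * \<gamma>))" using i by (simp add: powr_powr flip: powr_numeral)
    finally have p1: "?p (real i + real j) \<le> real i powr (- (2 * \<gamma>))" .
    have "(real i - real j)\<^sup>2 \<le> (real i + real j)\<^sup>2" by (simp add: power2_eq_square algebra_simps)
    hence p2: "?p (real i + real j) \<le> ?p (real i - real j)"
      using \<gamma> by (intro powr_mono2') (auto simp: add_pos_nonneg)
    have e0: "\<bar>e\<bar> \<le> C * ?p (real i + real j)" unfolding e_def by (rule R) auto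
    have e1: "\<bar>e\<bar> \<le> C * real i powr (- (2 * \<gamma>))" by (rule order_trans[OF e0]) (use C p1 in auto)
    have e2: "\<bar>e\<bar> \<le> C * ?p (real i - real j)" by (rule order_trans[OF e0]) (use C p2 in auto)
    have r: "\<bar>r\<bar> \<le> C * ?p (real i - real j)" unfolding r_def by (rule \<rho>)
    have "(R (real i) (real j))\<^sup>2 - (\<rho> (real i - real j))\<^sup>2 = e * (2 * r + e)"
      by (simp add: e_def r_def power2_eq_square algebra_simps)
    hence "\<bar>(R (real i) (real j))\<^sup>2 - (\<rho> (real i - real j))\<^sup>2\<bar> = \<bar>e\<bar> * \<bar>2 * r + e\<bar>" by (simp add: abs_mult)
    \<comment> \<open>The 3 is 2 + 1: |r| and |e| obey the same bound by the bracket.\<close>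
    also have "\<dots> \<le> (C * real i powr (- (2 * \<gamma>))) * (3 * (C * ?p (real i - real j)))"
      by (intro mult_mono e1) (use e2 r C in auto)
    finally show ?thesis by (simp add: power2_eq_square mult_ac)
  qed
  have "\<bar>(\<Sum>i=1..n. \<Sum>j=1..n. (R (real i) (real j))\<^sup>2) - (\<Sum>i=1..n. \<Sum>j=1..n. (\<rho> (real i - real j))\<^sup>2)\<bar>
      = \<bar>\<Sum>i=1..n. \<Sum>j=1..n. (R (real i) (real j))\<^sup>2 - (\<rho> (real i - real j))\<^sup>2\<bar>"
    by (simp add: sum_subtractf)
  also have "\<dots> \<le> (\<Sum>i=1..n. \<Sum>j=1..n. 3 * C\<^sup>2 * (real i powr (- (2 * \<gamma>)) * ?p (real i - real j)))"
    by (intro order_trans[OF sum_abs] sum_mono order_trans[OF sum_abs]) (use term_le in auto)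
  also have "\<dots> = 3 * C\<^sup>2 * (\<Sum>i=1..n. real i powr (- (2 * \<gamma>)) * (\<Sum>j=1..n. ?p (real i - real j)))"
    by (simp add: sum_distrib_left mult_ac)
  also have "\<dots> \<le> 3 * C\<^sup>2 * (\<Sum>i=1..n. real i powr (- (2 * \<gamma>)) * (3 * Z))"
  proof (intro mult_left_mono sum_mono)
    fix i assume "i \<in> {1..n}"
    from bracket_sum_le[OF \<gamma> this] Z show "(\<Sum>j=1..n. ?p (real i - real j)) \<le> 3 * Z" by (simp add: Z_def)
  qed auto
  also have "\<dots> = 9 * C\<^sup>2 * Z\<^sup>2"
    by (simp add: Z_def zeta_sum_def power2_eq_square flip: sum_distrib_right)
  finally show ?thesis by (simp add: Z_def)
qed

section \<open>The stationary covariance\<close>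

definition fou_cov :: "real \<Rightarrow> real \<Rightarrow> real \<Rightarrow> real" where
  "fou_cov \<theta> H w = - 1 / 2 * ou_filter \<theta> (- 1) (ou_filter \<theta> 1 (\<lambda>w. \<bar>w\<bar> powr (2 * H))) w"

definition fou_cov_reflected :: "real \<Rightarrow> real \<Rightarrow> real \<Rightarrow> real" where
  "fou_cov_reflected \<theta> H w = - 1 / 2 * ou_filter \<theta> (- 1) (ou_filter \<theta> (- 1) (\<lambda>w. \<bar>w\<bar> powr (2 * H))) w"

lemma laplace_const:
  assumes "\<theta> > 0"
  shows "laplace \<theta> 1 (\<lambda>_. k) w = k / \<theta>"
proof -
  have "k - \<theta> * laplace \<theta> 1 (\<lambda>_. k) w = - 1 * laplace \<theta> 1 (\<lambda>_. 0) w"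
    by (rule laplace_deriv[where b = 0 and b' = 0]) (use assms in \<open>auto intro: growth_const\<close>)
  thus ?thesis using assms by (simp add: laplace_def field_simps)
qed

lemma laplace_abs_powr_pos:
  assumes "\<theta> > 0" "H > 0"
  shows "laplace \<theta> 1 (\<lambda>w. \<bar>w\<bar> powr (2 * H)) 0 > 0"
proof -
  have int: "set_integrable lborel {0<..} (\<lambda>x. exp (- \<theta> * x) * \<bar>0 + 1 * x\<bar> powr (2 * H))"
    by (rule laplace_integrable[OF _ _ growth_abs_powr]) (use assms in auto)
  \<comment> \<open>On the unit-length interval [1, 2] the integrand is at least exp(-2 \<theta>),
    since x^(2H) \<ge> 1 there.\<close>
  have "exp (- \<theta> * 2) = (LBINT x::real. indicator {1..2} x * exp (- \<theta> * 2))" by simp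
  also have "\<dots> \<le> (LBINT x:{0<..}. exp (- \<theta> * x) * \<bar>0 + 1 * x\<bar> powr (2 * H))"
    unfolding set_lebesgue_integral_def
  proof (rule integral_mono)
    show "integrable lborel (\<lambda>x. indicator {0<..} x *\<^sub>R (exp (- \<theta> * x) * \<bar>0 + 1 * x\<bar> powr (2 * H)))"
      using int by (simp add: set_integrable_def)
    show "integrable lborel (\<lambda>x. indicator {1..2::real} x * exp (- \<theta> * 2))" by simp
    fix x :: real
    show "indicator {1..2} x * exp (- \<theta> * 2) \<le> indicator {0<..} x *\<^sub>R (exp (- \<theta> * x) * \<bar>0 + 1 * x\<bar> powr (2 * H))"
    proof (cases "x \<in> {1..2}")
      case True
      have "exp (- \<theta> * 2) * 1 \<le> exp (- \<theta> * x) * x powr (2 * H)"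
        using True assms by (intro mult_mono ge_one_powr_ge_zero) auto
      thus ?thesis using True by simp
    qed simp
  qed
  finally show ?thesis unfolding laplace_def using exp_gt_zero[of "- \<theta> * 2"] by linarith
qed

text \<open>Splitting at \<open>y = x\<close> gives \<open>|y - x|\<^bsup>2H\<^esup> \<le> x\<^bsup>2H\<^esup> + (y - x)\<^sub>+\<^bsup>2H\<^esup>\<close>; a bound by
  \<open>x\<^bsup>2H\<^esup> + y\<^bsup>2H\<^esup>\<close> would not be strict enough for the positivity of the variance.\<close>

lemma laplace_abs_powr_minus:
  assumes "\<theta> > 0" "H > 0" "x > 0"
  defines "h \<equiv> \<lambda>w. \<bar>w\<bar> powr (2 * H)"
  shows "laplace \<theta> 1 h (- x) \<le> h x / \<theta> + exp (- \<theta> * x) * laplace \<theta> 1 h 0"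
proof -
  have gh: "growth H h" unfolding h_def by (rule growth_abs_powr) (use assms in simp)
  note [measurable] = growth_measurable[OF gh]
  define F where "F y = indicator {x<..} y *\<^sub>R (exp (- \<theta> * y) * h (y - x))" for y
  have e: "F (x + 1 * z) = indicator {0<..} z *\<^sub>R (exp (- \<theta> * x) * (exp (- \<theta> * z) * h (0 + 1 * z)))" for z
    by (auto simp: F_def indicator_def algebra_simps simp flip: exp_add)
  have i0: "set_integrable lborel {0<..} (\<lambda>z. exp (- \<theta> * z) * h (0 + 1 * z))"
    by (rule laplace_integrable[OF assms(1) _ gh]) simp
  have "integrable lborel (\<lambda>z. F (x + 1 * z))"
    unfolding e using set_integrable_mult_right[of "exp (- \<theta> * x)", OF i0] by (simp add: set_integrable_def)
  hence iF: "integrable lborel F" by (subst (asm) lborel_integrable_real_affine_iff) auto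
  have "integral\<^sup>L lborel F = (LBINT z. F (x + 1 * z))"
    using lborel_integral_real_affine[of 1 F x] by simp
  also have "\<dots> = (LBINT z:{0<..}. exp (- \<theta> * x) * (exp (- \<theta> * z) * h (0 + 1 * z)))"
    unfolding e set_lebesgue_integral_def ..
  also have "\<dots> = exp (- \<theta> * x) * laplace \<theta> 1 h 0"
    unfolding laplace_def by (rule set_integral_mult_right)
  finally have F: "integral\<^sup>L lborel F = exp (- \<theta> * x) * laplace \<theta> 1 h 0" .
  have ik: "set_integrable lborel {0<..} (\<lambda>y. exp (- \<theta> * y) * h x)"
    using laplace_integrable[OF assms(1) _ growth_const[of 0 "h x"], where \<sigma> = 1] by simp
  have k: "(LBINT y:{0<..}. exp (- \<theta> * y) * h x) = h x / \<theta>"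
    using laplace_const[OF assms(1), of "h x" 0] by (simp add: laplace_def)
  have "laplace \<theta> 1 h (- x) \<le> integral\<^sup>L lborel (\<lambda>y. indicator {0<..} y *\<^sub>R (exp (- \<theta> * y) * h x) + F y)"
    unfolding laplace_def set_lebesgue_integral_def
  proof (rule integral_mono)
    show "integrable lborel (\<lambda>y. indicator {0<..} y *\<^sub>R (exp (- \<theta> * y) * h (- x + 1 * y)))"
      using laplace_integrable[OF assms(1) _ gh, of 1 "- x"] by (simp add: set_integrable_def)
    show "integrable lborel (\<lambda>y. indicator {0<..} y *\<^sub>R (exp (- \<theta> * y) * h x) + F y)"
      using ik iF by (simp add: set_integrable_def)
    fix y
    show "indicator {0<..} y *\<^sub>R (exp (- \<theta> * y) * h (- x + 1 * y))
        \<le> indicator {0<..} y *\<^sub>R (exp (- \<theta> * y) * h x) + F y"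
    proof (cases "y \<le> x")
      case True
      have "h (y - x) \<le> h x" if "y > 0" unfolding h_def
        using that True assms by (intro powr_mono2) auto
      thus ?thesis using True by (auto simp: F_def indicator_def)
    next
      case False
      have "0 \<le> h x" by (simp add: h_def)
      thus ?thesis using False assms(3) by (simp add: F_def indicator_def)
    qed
  qed
  also have "\<dots> = h x / \<theta> + exp (- \<theta> * x) * laplace \<theta> 1 h 0"
    unfolding k[symmetric] F[symmetric] set_lebesgue_integral_def
    by (rule Bochner_Integration.integral_add) (use ik iF in \<open>auto simp: set_integrable_def\<close>)
  finally show ?thesis .
qed

text \<open>With m = \<open>laplace \<theta> 1 h 0\<close> and the iterated average D, the value is
  \<theta> m - \<theta>^2 D / 2. Integrating \<open>laplace_abs_powr_minus\<close> yields D \<le>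
  m/\<theta> + m/(2\<theta>), so at least \<theta> m / 4 remains. The second summand has 2\<theta>
  because the exponential in that bound meets the one of the outer average.\<close>

lemma fou_cov_0_pos:
  assumes "\<theta> > 0" "H > 0"
  shows "fou_cov \<theta> H 0 > 0"
proof -
  define h :: "real \<Rightarrow> real" where "h = (\<lambda>w. \<bar>w\<bar> powr (2 * H))"
  define m where "m = laplace \<theta> 1 h 0"
  have gh: "growth H h" unfolding h_def by (rule growth_abs_powr) (use assms in simp)
  have m: "m > 0" unfolding m_def h_def by (rule laplace_abs_powr_pos[OF assms])
  have m': "laplace \<theta> (- 1) h 0 = m" by (simp add: m_def laplace_def h_def)
  have one: "\<bar>1::real\<bar> = 1" "\<bar>- 1::real\<bar> = 1" by auto
  have g1: "growth H (laplace \<theta> 1 h)" by (rule growth_laplace[OF assms(1) one(1) gh])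
  define D where "D = laplace \<theta> (- 1) (laplace \<theta> 1 h) 0"
  have i1: "set_integrable lborel {0<..} (\<lambda>x. exp (- \<theta> * x) * laplace \<theta> 1 h (0 + (- 1) * x))"
    by (rule laplace_integrable[OF assms(1) one(2) g1])
  have i2: "set_integrable lborel {0<..} (\<lambda>x. exp (- \<theta> * x) * h (0 + 1 * x))"
    by (rule laplace_integrable[OF assms(1) one(1) gh])
  have i3: "set_integrable lborel {0<..} (\<lambda>x. exp (- (2 * \<theta>) * x) * m)"
    using laplace_integrable[OF _ one(1) growth_const[of 0 m], where \<theta> = "2 * \<theta>"] assms by simp
  have "D \<le> (LBINT x:{0<..}. 1 / \<theta> * (exp (- \<theta> * x) * h (0 + 1 * x)) + exp (- (2 * \<theta>) * x) * m)"
    unfolding D_def laplace_def[of \<theta> "- 1"]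
  proof (rule set_integral_mono[OF i1])
    show "set_integrable lborel {0<..} (\<lambda>x. 1 / \<theta> * (exp (- \<theta> * x) * h (0 + 1 * x)) + exp (- (2 * \<theta>) * x) * m)"
      by (intro set_integral_add set_integrable_mult_right i2 i3)
    fix x :: real assume x: "x \<in> {0<..}"
    have "exp (- \<theta> * x) * laplace \<theta> 1 h (- x) \<le> exp (- \<theta> * x) * (h x / \<theta> + exp (- \<theta> * x) * m)"
      using laplace_abs_powr_minus[OF assms, of x] x by (intro mult_left_mono) (auto simp: h_def m_def)
    also have "\<dots> = 1 / \<theta> * (exp (- \<theta> * x) * h x) + exp (- \<theta> * x + - \<theta> * x) * m"
      unfolding exp_add by (simp add: algebra_simps)
    also have "- \<theta> * x + - \<theta> * x = - (2 * \<theta>) * x" by simp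
    finally show "exp (- \<theta> * x) * laplace \<theta> 1 h (0 + (- 1) * x)
        \<le> 1 / \<theta> * (exp (- \<theta> * x) * h (0 + 1 * x)) + exp (- (2 * \<theta>) * x) * m" by simp
  qed
  also have "\<dots> = 1 / \<theta> * m + m / (2 * \<theta>)"
  proof -
    have "(LBINT x:{0<..}. 1 / \<theta> * (exp (- \<theta> * x) * h (0 + 1 * x)) + exp (- (2 * \<theta>) * x) * m)
       = (LBINT x:{0<..}. 1 / \<theta> * (exp (- \<theta> * x) * h (0 + 1 * x))) + (LBINT x:{0<..}. exp (- (2 * \<theta>) * x) * m)"
      by (intro set_integral_add set_integrable_mult_right i2 i3)
    also have "(LBINT x:{0<..}. 1 / \<theta> * (exp (- \<theta> * x) * h (0 + 1 * x))) = 1 / \<theta> * m"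
      unfolding m_def laplace_def by (rule set_integral_mult_right)
    also have "(LBINT x:{0<..}. exp (- (2 * \<theta>) * x) * m) = m / (2 * \<theta>)"
      using laplace_const[of "2 * \<theta>" m 0] assms by (simp add: laplace_def)
    finally show ?thesis .
  qed
  finally have "\<theta>\<^sup>2 * D \<le> \<theta>\<^sup>2 * (1 / \<theta> * m + m / (2 * \<theta>))" by (rule mult_left_mono) simp
  also have "\<dots> = 3 / 2 * (\<theta> * m)" using assms by (simp add: power2_eq_square field_simps)
  finally have D: "\<theta>\<^sup>2 * D \<le> 3 / 2 * (\<theta> * m)" .
  have F: "ou_filter \<theta> 1 h = (\<lambda>w. h w - \<theta> * laplace \<theta> 1 h w)" by (simp add: ou_filter_def fun_eq_iff)
  have "laplace \<theta> (- 1) (ou_filter \<theta> 1 h) 0 = m - \<theta> * D"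
    unfolding F laplace_diff[OF assms(1) one(2) gh growth_cmult[OF g1]] laplace_cmult m' D_def ..
  hence "ou_filter \<theta> (- 1) (ou_filter \<theta> 1 h) 0 = (h 0 - \<theta> * m) - \<theta> * (m - \<theta> * D)"
    by (simp add: ou_filter_def m_def)
  hence "fou_cov \<theta> H 0 = - 1 / 2 * (- 2 * (\<theta> * m) + \<theta>\<^sup>2 * D)"
    by (simp add: fou_cov_def h_def power2_eq_square algebra_simps)
  hence "fou_cov \<theta> H 0 = \<theta> * m - \<theta>\<^sup>2 * D / 2" by (simp add: field_simps)
  moreover have "\<theta> * m > 0" using assms m by simp
  ultimately show ?thesis using D by linarith
qed

lemma growth_fou_cov:
  assumes "0 < H" "H < 1" "\<theta> > 0"
  shows "growth (H - 3 / 2) (\<lambda>w. fou_cov \<theta> H w - H * (2 * H - 1) / \<theta>\<^sup>2 * (1 + w\<^sup>2) powr (H - 1))"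
    and "growth (H - 3 / 2) (\<lambda>w. fou_cov_reflected \<theta> H w + H * (2 * H - 1) / \<theta>\<^sup>2 * (1 + w\<^sup>2) powr (H - 1))"
proof -
  have "growth (H - 3 / 2) (\<lambda>w. - 1 / 2 * (ou_filter \<theta> (- 1) (ou_filter \<theta> 1 (\<lambda>w. \<bar>w\<bar> powr (2 * H))) w
      + 1 / \<theta>\<^sup>2 * (2 * H * (2 * H - 1) * (1 + w\<^sup>2) powr (H - 1))))"
    by (intro growth_cmult growth_ou_filter_abs_powr assms) simp
  also have "(\<lambda>w. - 1 / 2 * (ou_filter \<theta> (- 1) (ou_filter \<theta> 1 (\<lambda>w. \<bar>w\<bar> powr (2 * H))) w
      + 1 / \<theta>\<^sup>2 * (2 * H * (2 * H - 1) * (1 + w\<^sup>2) powr (H - 1))))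
      = (\<lambda>w. fou_cov \<theta> H w - H * (2 * H - 1) / \<theta>\<^sup>2 * (1 + w\<^sup>2) powr (H - 1))"
    by (rule ext) (simp add: fou_cov_def distrib_left)
  finally show "growth (H - 3 / 2) (\<lambda>w. fou_cov \<theta> H w - H * (2 * H - 1) / \<theta>\<^sup>2 * (1 + w\<^sup>2) powr (H - 1))" .
  have "growth (H - 3 / 2) (\<lambda>w. - 1 / 2 * (ou_filter \<theta> (- 1) (ou_filter \<theta> (- 1) (\<lambda>w. \<bar>w\<bar> powr (2 * H))) w
      + - 1 / \<theta>\<^sup>2 * (2 * H * (2 * H - 1) * (1 + w\<^sup>2) powr (H - 1))))"
    by (intro growth_cmult growth_ou_filter_abs_powr assms) simp
  also have "(\<lambda>w. - 1 / 2 * (ou_filter \<theta> (- 1) (ou_filter \<theta> (- 1) (\<lambda>w. \<bar>w\<bar> powr (2 * H))) w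
      + - 1 / \<theta>\<^sup>2 * (2 * H * (2 * H - 1) * (1 + w\<^sup>2) powr (H - 1))))
      = (\<lambda>w. fou_cov_reflected \<theta> H w + H * (2 * H - 1) / \<theta>\<^sup>2 * (1 + w\<^sup>2) powr (H - 1))"
  proof
    have alg: "- 1 / 2 * (x + - 1 / c * (2 * H * a * q)) = - 1 / 2 * x + H * a / c * q" for x a c q :: real
      by (cases "c = 0") (simp_all add: field_simps)
    show "- 1 / 2 * (ou_filter \<theta> (- 1) (ou_filter \<theta> (- 1) (\<lambda>w. \<bar>w\<bar> powr (2 * H))) w
      + - 1 / \<theta>\<^sup>2 * (2 * H * (2 * H - 1) * (1 + w\<^sup>2) powr (H - 1)))
      = fou_cov_reflected \<theta> H w + H * (2 * H - 1) / \<theta>\<^sup>2 * (1 + w\<^sup>2) powr (H - 1)" for w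
      unfolding alg fou_cov_reflected_def ..
  qed
  finally show "growth (H - 3 / 2) (\<lambda>w. fou_cov_reflected \<theta> H w + H * (2 * H - 1) / \<theta>\<^sup>2 * (1 + w\<^sup>2) powr (H - 1))" .
qed

text \<open>At \<open>H = 1/2\<close> the leading coefficient \<open>H (2H - 1)\<close> vanishes, and the exponent \<open>1 - H\<close> would lose a
  logarithm against \<open>psi\<close>.\<close>

definition decay_exponent :: "real \<Rightarrow> real" where
  "decay_exponent H = (if H = 1 / 2 then 1 else 1 - H)"

lemma growth_fou_cov_decay:
  assumes "0 < H" "H < 1" "\<theta> > 0"
  shows "growth (- decay_exponent H) (fou_cov \<theta> H)" "growth (- decay_exponent H) (fou_cov_reflected \<theta> H)"
proof -
  let ?f = "\<lambda>w::real. H * (2 * H - 1) / \<theta>\<^sup>2 * (1 + w\<^sup>2) powr (H - 1)"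
  have f: "growth (- decay_exponent H) ?f"
  proof (cases "H = 1 / 2")
    case True
    hence e: "2 * H - 1 = 0" by simp
    show ?thesis unfolding e by (rule growthI[of _ 0]) auto
  next
    case False
    thus ?thesis using growth_powr[of "H - 1"] by (intro growth_cmult) (simp add: decay_exponent_def)
  qed
  \<comment> \<open>Equality at H = 1/2: there the leading term is absent and the remainder dictates
    the exponent 1.\<close>
  have le: "H - 3 / 2 \<le> - decay_exponent H" by (auto simp: decay_exponent_def)
  show "growth (- decay_exponent H) (fou_cov \<theta> H)"
    using growth_add[OF growth_mono[OF growth_fou_cov(1)[OF assms] le] f] by simp
  show "growth (- decay_exponent H) (fou_cov_reflected \<theta> H)"
    using growth_diff[OF growth_mono[OF growth_fou_cov(2)[OF assms] le] f] by simp
qed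

section \<open>Second moments of the quadratic variation\<close>

lemma centred_normal_cong:
  assumes "\<And>\<omega>. \<omega> \<in> space M \<Longrightarrow> W \<omega> = W' \<omega>" "centred_normal M W v"
  shows "centred_normal M W' v"
proof -
  have "W \<in> borel_measurable M \<longleftrightarrow> W' \<in> borel_measurable M"
    by (rule measurable_cong) (rule assms(1))
  moreover have "distr M borel W = distr M borel W'"
    by (rule distr_cong) (use assms(1) in auto)
  ultimately show ?thesis using assms(2) by (simp add: centred_normal_def)
qed

lemma jointly_normal_cong:
  assumes "\<And>\<omega>. \<omega> \<in> space M \<Longrightarrow> X \<omega> = X' \<omega>" "\<And>\<omega>. \<omega> \<in> space M \<Longrightarrow> Y \<omega> = Y' \<omega>"
    and "jointly_normal M X Y a b c"
  shows "jointly_normal M X' Y' a b c"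
  unfolding jointly_normal_def
proof (intro allI)
  fix x y
  have "centred_normal M (\<lambda>\<omega>. x * X \<omega> + y * Y \<omega>) (x\<^sup>2 * a + y\<^sup>2 * b + 2 * x * y * c)"
    using assms(3) by (simp add: jointly_normal_def)
  thus "centred_normal M (\<lambda>\<omega>. x * X' \<omega> + y * Y' \<omega>) (x\<^sup>2 * a + y\<^sup>2 * b + 2 * x * y * c)"
    by (rule centred_normal_cong[rotated]) (simp add: assms(1,2))
qed

lemma gaussian_process_mono: "gaussian_process M T Y \<Longrightarrow> T' \<subseteq> T \<Longrightarrow> gaussian_process M T' Y"
  unfolding gaussian_process_def by (meson order_trans)

lemma ou_filter_cmult_fun: "ou_filter \<theta> \<sigma> (\<lambda>w. c * f w) = (\<lambda>w. c * ou_filter \<theta> \<sigma> f w)"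
  by (rule ext) (rule ou_filter_cmult)

lemma continuous_abs_powr:
  assumes "H > 0"
  shows "continuous_on UNIV (\<lambda>w::real. \<bar>w\<bar> powr (2 * H))"
  using assms by (intro continuous_on_powr' continuous_on_rabs continuous_on_id continuous_on_const) auto

text \<open>The right-hand side of \<open>ou_functional_twice\<close> at a = 0. Only the first
  bracket is free of exponential damping.\<close>

definition sub_fou_cov :: "real \<Rightarrow> real \<Rightarrow> real \<Rightarrow> real \<Rightarrow> real" where
  "sub_fou_cov \<theta> H s t = (fou_cov_reflected \<theta> H (s + t) + fou_cov \<theta> H (s - t))
     - exp (- \<theta> * s) * (fou_cov_reflected \<theta> H t + fou_cov \<theta> H (- t))
     - exp (- \<theta> * t) * (fou_cov_reflected \<theta> H s + fou_cov \<theta> H s)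
     + exp (- \<theta> * s) * exp (- \<theta> * t) * (fou_cov_reflected \<theta> H 0 + fou_cov \<theta> H 0)"

lemma jointly_normal_sub_fou:
  assumes S: "sub_fBm M H S" and \<theta>: "\<theta> > 0" and s: "0 \<le> s" and t: "0 \<le> t"
  shows "jointly_normal M (OU \<theta> S s) (OU \<theta> S t) (sub_fou_cov \<theta> H s s) (sub_fou_cov \<theta> H t t) (sub_fou_cov \<theta> H s t)"
proof -
  interpret prob_space M using S by (simp add: sub_fBm_def)
  have H: "0 < H" "H < 1" using S by (auto simp: sub_fBm_def)
  define h where "h w = \<bar>w\<bar> powr (2 * H)" for w :: real
  define g where "g w = - 1 / 2 * h w" for w
  have gh: "growth H h" using growth_abs_powr[of H] H by (simp add: h_def[abs_def])
  have gg: "growth H g" unfolding g_def[abs_def] by (rule growth_cmult[OF gh])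
  \<comment> \<open>For u, v \<ge> 0 the term (u + v)^(2H) is h(u + v), so the same g serves both
    the sum and the difference.\<close>
  define K where "K u v = h u + h v + g (u + v) + g (u - v)" for u v
  have path: "continuous_on {0..} (\<lambda>t. S t \<omega>)" if "\<omega> \<in> space M" for \<omega>
    using S that by (simp add: sub_fBm_def)
  have cont: "continuous_on ({0..} \<times> {0..}) (\<lambda>(u, v). K u v)"
    unfolding K_def g_def split_def
    by (intro continuous_intros continuous_on_compose2[OF continuous_abs_powr[OF H(1), folded h_def]]) auto
  have twice: "ou_functional \<theta> 0 s (\<lambda>u. ou_functional \<theta> 0 t (K u)) = sub_fou_cov \<theta> H s t"
    if s: "0 \<le> s" and t: "0 \<le> t" for s t
  proof -
    have "ou_filter \<theta> (- 1) (ou_filter \<theta> (- 1) g) = fou_cov_reflected \<theta> H"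
      "ou_filter \<theta> (- 1) (ou_filter \<theta> 1 g) = fou_cov \<theta> H"
      unfolding g_def[abs_def] ou_filter_cmult_fun fou_cov_reflected_def[abs_def] fou_cov_def[abs_def] h_def[abs_def] by simp_all
    thus ?thesis
      unfolding ou_functional_twice[OF \<theta> less_imp_le[OF H(1)] gh gh gg gg s t K_def] sub_fou_cov_def by simp
  qed
  have J: "jointly_normal M (\<lambda>\<omega>. ou_functional \<theta> 0 s (\<lambda>r. S r \<omega>)) (\<lambda>\<omega>. ou_functional \<theta> 0 t (\<lambda>r. S r \<omega>))
      (ou_functional \<theta> 0 s (\<lambda>u. ou_functional \<theta> 0 s (K u))) (ou_functional \<theta> 0 t (\<lambda>u. ou_functional \<theta> 0 t (K u)))
      (ou_functional \<theta> 0 s (\<lambda>u. ou_functional \<theta> 0 t (K u)))"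
  proof (rule gaussian_process_ou_functional[OF _ path _ _ cont \<theta> s t])
    show "gaussian_process M {0..} S" "\<And>t. 0 \<le> t \<Longrightarrow> expectation (S t) = 0" using S by (auto simp: sub_fBm_def)
    fix s t :: real assume "0 \<le> s" "0 \<le> t"
    thus "expectation (\<lambda>\<omega>. S s \<omega> * S t \<omega>) = K s t"
      using S by (simp add: sub_fBm_def K_def g_def h_def algebra_simps)
  qed
  show ?thesis
  proof (rule jointly_normal_cong[OF _ _ J[unfolded twice[OF s s] twice[OF t t] twice[OF s t]]])
    fix \<omega> assume \<omega>: "\<omega> \<in> space M"
    have "ou_functional \<theta> 0 r (\<lambda>r. S r \<omega>) = OU \<theta> S r \<omega>" if "0 \<le> r" for r
      unfolding OU_def
      by (rule young_integral_eq_ou_functional[symmetric, OF that]) (rule continuous_on_subset[OF path[OF \<omega>]], auto)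
    thus "ou_functional \<theta> 0 s (\<lambda>r. S r \<omega>) = OU \<theta> S s \<omega>" "ou_functional \<theta> 0 t (\<lambda>r. S r \<omega>) = OU \<theta> S t \<omega>"
      using s t by auto
  qed
qed

lemma second_moment_V:
  assumes S: "sub_fBm M H S" and \<theta>: "\<theta> > 0" and n: "n \<ge> 1"
  shows "integral\<^sup>L M (\<lambda>\<omega>. (V M (OU \<theta> S) n \<omega>)\<^sup>2) =
    2 / real n * (\<Sum>i=1..n. \<Sum>j=1..n. (sub_fou_cov \<theta> H (real i) (real j))\<^sup>2)"
proof -
  interpret prob_space M using S by (simp add: sub_fBm_def)
  define X where "X i = OU \<theta> S (real i)" for i :: nat
  define R where "R i j = sub_fou_cov \<theta> H (real i) (real j)" for i j :: nat
  have J: "jointly_normal M (X i) (X j) (R i i) (R j j) (R i j)" for i j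
    unfolding X_def R_def by (rule jointly_normal_sub_fou[OF S \<theta>]) auto
  have E: "expectation (\<lambda>\<omega>. (X i \<omega>)\<^sup>2) = R i i" for i by (rule jointly_normalD(3)[OF J])
  have "(V M (OU \<theta> S) n \<omega>)\<^sup>2 = 1 / real n * (\<Sum>i=1..n. \<Sum>j=1..n. ((X i \<omega>)\<^sup>2 - R i i) * ((X j \<omega>)\<^sup>2 - R j j))" for \<omega>
  proof -
    have "V M (OU \<theta> S) n \<omega> = 1 / sqrt (real n) * (\<Sum>i=1..n. (X i \<omega>)\<^sup>2 - R i i)"
      unfolding V_def E[symmetric] X_def ..
    thus ?thesis using n by (simp add: power_mult_distrib power_divide) (simp add: power2_eq_square sum_product)
  qed
  hence "expectation (\<lambda>\<omega>. (V M (OU \<theta> S) n \<omega>)\<^sup>2) =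
      1 / real n * (\<Sum>i=1..n. \<Sum>j=1..n. expectation (\<lambda>\<omega>. ((X i \<omega>)\<^sup>2 - R i i) * ((X j \<omega>)\<^sup>2 - R j j)))"
    using jointly_normal_covariance_squares(1)[OF J] by (simp add: Bochner_Integration.integral_sum)
  also have "\<dots> = 1 / real n * (\<Sum>i=1..n. \<Sum>j=1..n. 2 * (R i j)\<^sup>2)"
    by (simp only: jointly_normal_covariance_squares(2)[OF J])
  finally show ?thesis by (simp add: R_def sum_distrib_left mult.assoc)
qed

text \<open>Every correction must decay in s + t to suit \<open>sum_squares_perturbation\<close>.
  For \<kappa>(s + t) this is its own decay. A damped term is exp(-\<theta> s) times something
  decaying in t; weakening the exponential to (1 + s^2)^(-\<gamma>) lets Peetre's inequality merge s
  and t.\<close>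

lemma sub_fou_cov_decay:
  assumes H: "0 < H" "H < 1" and \<theta>: "\<theta> > 0"
  defines "\<gamma> \<equiv> decay_exponent H"
  obtains C where "C > 0" "\<And>w. \<bar>fou_cov \<theta> H w\<bar> \<le> C * (1 + w\<^sup>2) powr (- \<gamma>)"
    "\<And>s t. 0 \<le> s \<Longrightarrow> 0 \<le> t \<Longrightarrow> \<bar>sub_fou_cov \<theta> H s t - fou_cov \<theta> H (s - t)\<bar> \<le> C * (1 + (s + t)\<^sup>2) powr (- \<gamma>)"
proof -
  let ?p = "\<lambda>w::real. (1 + w\<^sup>2) powr (- \<gamma>)"
  have \<gamma>: "\<gamma> > 0" using H by (auto simp: \<gamma>_def decay_exponent_def)
  obtain C1 where C1: "C1 > 0" "\<And>w. \<bar>fou_cov \<theta> H w\<bar> \<le> C1 * ?p w"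
    using growthE[OF growth_fou_cov_decay(1)[OF H \<theta>]] unfolding \<gamma>_def by blast
  obtain C2 where C2: "C2 > 0" "\<And>w. \<bar>fou_cov_reflected \<theta> H w\<bar> \<le> C2 * ?p w"
    using growthE[OF growth_fou_cov_decay(2)[OF H \<theta>]] unfolding \<gamma>_def by blast
  obtain K where K: "K > 0" "\<And>x. x \<ge> 0 \<Longrightarrow> exp (- \<theta> * x) * (1 + x\<^sup>2) powr \<gamma> \<le> K * exp (- (x * (\<theta> / 2)))"
    using exp_poly_bound[OF \<theta>] by blast
  have pos: "1 + x\<^sup>2 > 0" for x :: real by (simp add: add_pos_nonneg)
  have ex: "exp (- \<theta> * x) \<le> K * ?p x" if "x \<ge> 0" for x
  proof -
    have "K * exp (- (x * (\<theta> / 2))) \<le> K * 1" using K that \<theta> by (intro mult_left_mono) auto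
    hence "exp (- \<theta> * x) * (1 + x\<^sup>2) powr \<gamma> \<le> K" using K(2)[OF that] by linarith
    thus ?thesis using pos[of x] by (simp add: powr_minus field_simps)
  qed
  \<comment> \<open>Peetre at exponent -\<gamma> moves the base point from t to s + t at the price
    (2 (1 + s^2))^\<gamma>; the first factor cancels all but 2^\<gamma>.\<close>
  have pp: "?p s * ?p t \<le> 2 powr \<gamma> * ?p (s + t)" for s t :: real
  proof -
    have "?p t \<le> (2 * (1 + s\<^sup>2)) powr \<gamma> * ?p (s + t)"
      using peetre[of t "- \<gamma>" "s + t"] \<gamma> by simp
    hence "?p s * ?p t \<le> ?p s * ((2 * (1 + s\<^sup>2)) powr \<gamma> * ?p (s + t))" by (rule mult_left_mono) simp
    also have "\<dots> = (?p s * (1 + s\<^sup>2) powr \<gamma>) * (2 powr \<gamma> * ?p (s + t))" by (simp only: powr_mult mult_ac)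
    also have "?p s * (1 + s\<^sup>2) powr \<gamma> = 1" using pos[of s] by (simp add: powr_minus)
    finally show ?thesis by simp
  qed
  define C0 where "C0 = C1 + C2"
  have C0: "C0 > 0" using C1 C2 by (simp add: C0_def)
  \<comment> \<open>The weight sees only w^2, so one bound covers the arguments t and -t without
    appeal to evenness of \<open>fou_cov\<close>.\<close>
  have q: "\<bar>fou_cov_reflected \<theta> H w + fou_cov \<theta> H w'\<bar> \<le> C0 * ?p w" if "w' = w \<or> w' = - w" for w w'
  proof -
    have "?p w' = ?p w" using that by auto
    hence "\<bar>fou_cov \<theta> H w'\<bar> \<le> C1 * ?p w" using C1(2)[of w'] by (simp only:)
    thus ?thesis using C2(2)[of w] unfolding C0_def distrib_right by linarith
  qed
  have m: "\<bar>exp (- \<theta> * s) * x\<bar> \<le> K * C0 * 2 powr \<gamma> * ?p (s + t)" if "s \<ge> 0" "\<bar>x\<bar> \<le> C0 * ?p t" for s t x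
  proof -
    have "\<bar>exp (- \<theta> * s) * x\<bar> = exp (- \<theta> * s) * \<bar>x\<bar>" by (simp add: abs_mult)
    also have "\<dots> \<le> (K * ?p s) * (C0 * ?p t)" using ex[OF that(1)] that(2) K by (intro mult_mono) auto
    also have "\<dots> = K * C0 * (?p s * ?p t)" by simp
    also have "\<dots> \<le> K * C0 * (2 powr \<gamma> * ?p (s + t))" using K C0 by (intro mult_left_mono pp) auto
    finally show ?thesis by (simp add: mult.assoc)
  qed
  define D where "D = K * C0 * 2 powr \<gamma>"
  define C where "C = C1 + C2 + 2 * D + K * D"
  have D: "D > 0" using K C0 by (simp add: D_def)
  show thesis
  proof (rule that[of C])
    show "C > 0" using C1 C2 D K by (simp add: C_def add_pos_pos)
    fix w
    have "C1 \<le> C" using C2 D K by (simp add: C_def)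
    hence "C1 * ?p w \<le> C * ?p w" by (rule mult_right_mono) simp
    thus "\<bar>fou_cov \<theta> H w\<bar> \<le> C * ?p w" using C1(2)[of w] by linarith
  next
    fix s t :: real assume s: "0 \<le> s" and t: "0 \<le> t"
    let ?a = "fou_cov_reflected \<theta> H (s + t)"
    let ?b = "exp (- \<theta> * s) * (fou_cov_reflected \<theta> H t + fou_cov \<theta> H (- t))"
    let ?c = "exp (- \<theta> * t) * (fou_cov_reflected \<theta> H s + fou_cov \<theta> H s)"
    let ?d = "exp (- \<theta> * s) * (exp (- \<theta> * t) * (fou_cov_reflected \<theta> H 0 + fou_cov \<theta> H 0))"
    have b: "\<bar>?b\<bar> \<le> D * ?p (s + t)" unfolding D_def by (rule m[OF s q]) simp
    have "\<bar>?c\<bar> \<le> D * ?p (t + s)" unfolding D_def by (rule m[OF t q]) simp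
    hence c: "\<bar>?c\<bar> \<le> D * ?p (s + t)" by (simp add: add.commute)
    have "\<bar>exp (- \<theta> * t) * (fou_cov_reflected \<theta> H 0 + fou_cov \<theta> H 0)\<bar> \<le> K * C0 * ?p t"
    proof -
      have "\<bar>fou_cov_reflected \<theta> H 0 + fou_cov \<theta> H 0\<bar> \<le> C0" using q[of 0 0] by simp
      hence "exp (- \<theta> * t) * \<bar>fou_cov_reflected \<theta> H 0 + fou_cov \<theta> H 0\<bar> \<le> (K * ?p t) * C0"
        using ex[OF t] K by (intro mult_mono) auto
      thus ?thesis by (simp add: abs_mult mult_ac)
    qed
    \<comment> \<open>Dividing by K fits the doubly damped constant to the hypothesis of
      \<open>m\<close>; restoring the factor gives \<open>K * D\<close>.\<close>
    hence "\<bar>1 / K * (exp (- \<theta> * t) * (fou_cov_reflected \<theta> H 0 + fou_cov \<theta> H 0))\<bar> \<le> C0 * ?p t"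
      using K by (simp add: abs_mult field_simps)
    from m[OF s this] have "\<bar>1 / K * ?d\<bar> \<le> D * ?p (s + t)" by (simp add: D_def mult_ac)
    hence d: "\<bar>?d\<bar> \<le> K * D * ?p (s + t)" using K by (simp add: abs_mult field_simps)
    have a: "\<bar>?a\<bar> \<le> C2 * ?p (s + t)" by (rule C2)
    have "sub_fou_cov \<theta> H s t - fou_cov \<theta> H (s - t) = ?a - ?b - ?c + ?d"
      by (simp add: sub_fou_cov_def mult.assoc)
    hence "\<bar>sub_fou_cov \<theta> H s t - fou_cov \<theta> H (s - t)\<bar> \<le> \<bar>?a\<bar> + \<bar>?b\<bar> + \<bar>?c\<bar> + \<bar>?d\<bar>" by linarith
    also have "\<dots> \<le> (C2 + 2 * D + K * D) * ?p (s + t)"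
      using a b c d by (simp add: distrib_right)
    also have "\<dots> \<le> C * ?p (s + t)" using C1 by (intro mult_right_mono) (auto simp: C_def)
    finally show "\<bar>sub_fou_cov \<theta> H s t - fou_cov \<theta> H (s - t)\<bar> \<le> C * ?p (s + t)" .
  qed
qed

section \<open>Identification of the autocovariance of Z\<close>

lemma (in prob_space) expectation_mult_L2_limit:
  fixes Z1 Z2 :: "'a \<Rightarrow> real" and Y1 Y2 :: "'b \<Rightarrow> 'a \<Rightarrow> real"
  assumes F: "F \<noteq> bot" and [measurable]: "Z1 \<in> borel_measurable M" "Z2 \<in> borel_measurable M"
    and D1: "((\<lambda>a. \<integral>\<^sup>+\<omega>. ennreal ((Z1 \<omega> - Y1 a \<omega>)\<^sup>2) \<partial>M) \<longlongrightarrow> 0) F"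
    and D2: "((\<lambda>a. \<integral>\<^sup>+\<omega>. ennreal ((Z2 \<omega> - Y2 a \<omega>)\<^sup>2) \<partial>M) \<longlongrightarrow> 0) F"
    and J: "\<forall>\<^sub>F a in F. jointly_normal M (Y1 a) (Y2 a) (v1 a) (v2 a) (c a)"
    and v: "(v1 \<longlongrightarrow> l1) F" "(v2 \<longlongrightarrow> l2) F" and c: "(c \<longlongrightarrow> l) F"
  shows "expectation (\<lambda>\<omega>. Z1 \<omega> * Z2 \<omega>) = l"
proof -
  define d1 where "d1 a = enn2real (\<integral>\<^sup>+\<omega>. ennreal ((Z1 \<omega> - Y1 a \<omega>)\<^sup>2) \<partial>M)" for a
  define d2 where "d2 a = enn2real (\<integral>\<^sup>+\<omega>. ennreal ((Z2 \<omega> - Y2 a \<omega>)\<^sup>2) \<partial>M)" for a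
  have d: "(d1 \<longlongrightarrow> 0) F" "(d2 \<longlongrightarrow> 0) F"
    unfolding d1_def[abs_def] d2_def[abs_def] by (rule tendsto_enn2real; simp add: D1 D2)+
  \<comment> \<open>\<open>enn2real\<close> sends infinity to 0, so small d1 and d2 alone would say
    nothing. Being eventually below 1, the integrals are finite and the squares integrable.\<close>
  have ev: "\<forall>\<^sub>F a in F. (\<integral>\<^sup>+\<omega>. ennreal ((Z1 \<omega> - Y1 a \<omega>)\<^sup>2) \<partial>M) < 1"
    "\<forall>\<^sub>F a in F. (\<integral>\<^sup>+\<omega>. ennreal ((Z2 \<omega> - Y2 a \<omega>)\<^sup>2) \<partial>M) < 1"
    using order_tendstoD(2)[OF D1, of 1] order_tendstoD(2)[OF D2, of 1] by auto
  let ?E = "expectation (\<lambda>\<omega>. Z1 \<omega> * Z2 \<omega>)"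
  \<comment> \<open>Writing Z1 = U + Y1 and Z2 = W + Y2 leaves Y1 Y2, of mean c, and three error
    products. For fixed r the second moments of U and W vanish along F and only r (l1 + l2) / 2
    survives; r is arbitrary.\<close>
  have main: "\<bar>?E - l\<bar> \<le> r * (l1 + l2) / 2" if r: "r > 0" for r
  proof (rule tendsto_le[OF F])
    show "((\<lambda>a. \<bar>?E - c a\<bar>) \<longlongrightarrow> \<bar>?E - l\<bar>) F" by (intro tendsto_intros c)
    have "((\<lambda>a. (d1 a + d2 a) / 2 + (d1 a / r + r * v2 a) / 2 + (d2 a / r + r * v1 a) / 2)
        \<longlongrightarrow> (0 + 0) / 2 + (0 / r + r * l2) / 2 + (0 / r + r * l1) / 2) F"
      using r by (intro tendsto_intros d v) auto
    thus "((\<lambda>a. (d1 a + d2 a) / 2 + (d1 a / r + r * v2 a) / 2 + (d2 a / r + r * v1 a) / 2) \<longlongrightarrow> r * (l1 + l2) / 2) F"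
      by (simp add: algebra_simps add_divide_distrib)
    show "\<forall>\<^sub>F a in F. \<bar>?E - c a\<bar> \<le> (d1 a + d2 a) / 2 + (d1 a / r + r * v2 a) / 2 + (d2 a / r + r * v1 a) / 2"
      using J ev
    proof eventually_elim
      case (elim a)
      have J': "jointly_normal M (Y2 a) (Y1 a) (v2 a) (v1 a) (c a)"
        unfolding jointly_normal_def
      proof (intro allI)
        fix x y
        have "centred_normal M (\<lambda>\<omega>. y * Y1 a \<omega> + x * Y2 a \<omega>) (y\<^sup>2 * v1 a + x\<^sup>2 * v2 a + 2 * y * x * c a)"
          using elim(1) by (simp add: jointly_normal_def)
        thus "centred_normal M (\<lambda>\<omega>. x * Y2 a \<omega> + y * Y1 a \<omega>) (x\<^sup>2 * v2 a + y\<^sup>2 * v1 a + 2 * x * y * c a)"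
          by (simp add: add.commute mult_ac)
      qed
      note Y1 = jointly_normalD[OF elim(1)] and Y2 = jointly_normalD[OF J']
      note [measurable] = Y1(5) Y2(5)
      define U where "U \<omega> = Z1 \<omega> - Y1 a \<omega>" for \<omega>
      define W where "W \<omega> = Z2 \<omega> - Y2 a \<omega>" for \<omega>
      have [measurable]: "U \<in> borel_measurable M" "W \<in> borel_measurable M" unfolding U_def[abs_def] W_def[abs_def] by measurable
      have iU: "integrable M (\<lambda>\<omega>. (U \<omega>)\<^sup>2)"
        by (rule integrableI_nonneg) (use elim(2) in \<open>auto simp: U_def intro: less_trans\<close>)
      have iW: "integrable M (\<lambda>\<omega>. (W \<omega>)\<^sup>2)"
        by (rule integrableI_nonneg) (use elim(3) in \<open>auto simp: W_def intro: less_trans\<close>)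
      have eU: "expectation (\<lambda>\<omega>. (U \<omega>)\<^sup>2) = d1 a" unfolding d1_def U_def
        by (rule integral_eq_nn_integral) auto
      have eW: "expectation (\<lambda>\<omega>. (W \<omega>)\<^sup>2) = d2 a" unfolding d2_def W_def
        by (rule integral_eq_nn_integral) auto
      note UW = integral_mult_le_of_squares[OF \<open>U \<in> _\<close> \<open>W \<in> _\<close> iU iW zero_less_one]
      note UY = integral_mult_le_of_squares[OF \<open>U \<in> _\<close> Y2(5) iU Y2(1) r]
      note WY = integral_mult_le_of_squares[OF \<open>W \<in> _\<close> Y1(5) iW Y1(1) r]
      have "?E = expectation (\<lambda>\<omega>. U \<omega> * W \<omega> + U \<omega> * Y2 a \<omega> + W \<omega> * Y1 a \<omega> + Y1 a \<omega> * Y2 a \<omega>)"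
        by (simp add: U_def W_def algebra_simps)
      also have "\<dots> = expectation (\<lambda>\<omega>. U \<omega> * W \<omega>) + expectation (\<lambda>\<omega>. U \<omega> * Y2 a \<omega>) + expectation (\<lambda>\<omega>. W \<omega> * Y1 a \<omega>) + c a"
        using UW(1) UY(1) WY(1) Y1(2) by (simp add: Y1(4))
      finally show ?case using UW(2) UY(2) WY(2) unfolding eU eW Y1(3) Y2(3) div_by_1 mult_1_left by linarith
    qed
  qed
  have "\<bar>?E - l\<bar> \<le> e" if "e > 0" for e
  proof -
    define r where "r = 2 * e / (\<bar>l1 + l2\<bar> + 1)"
    have "r > 0" using that by (simp add: r_def)
    have "r * (l1 + l2) / 2 \<le> r * (\<bar>l1 + l2\<bar> + 1) / 2" using \<open>r > 0\<close> by simp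
    also have "\<dots> = e" by (simp add: r_def)
    finally show ?thesis using main[OF \<open>r > 0\<close>] by linarith
  qed
  hence "\<bar>?E - l\<bar> \<le> 0" by (rule field_le_epsilon) simp
  thus ?thesis by simp
qed

text \<open>The covariance kernel of B has no part in u + v, so on [a, t] the covariance is \<rho>(s
  - t) plus bounded terms damped by exp(-\<theta>(s - a)) or exp(-\<theta>(t - a)). They vanish as a
  tends to minus infinity, and the mean-square definition of Z transfers the limit.\<close>

lemma autocov_stationary_fOU:
  assumes B: "two_sided_fBm N H B" and Z: "stationary_fOU N \<theta> B Z" and \<theta>: "\<theta> > 0"
  shows "autocov N Z k = fou_cov \<theta> H (of_int k)"
proof -
  interpret prob_space N using B by (simp add: two_sided_fBm_def)
  have H: "0 < H" "H < 1" using B by (auto simp: two_sided_fBm_def)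
  define Y where "Y r a \<omega> = exp (- \<theta> * r) * young_integral (\<lambda>u. exp (\<theta> * u)) (\<lambda>u. B u \<omega>) a r" for r a \<omega>
  define Q where "Q = fou_cov \<theta> H"
  define c where "c s t a = Q (s - t) - exp (- \<theta> * (s - a)) * Q (a - t) - exp (- \<theta> * (t - a)) * Q (s - a)
      + exp (- \<theta> * (s - a)) * exp (- \<theta> * (t - a)) * Q 0" for s t a
  define h where "h w = \<bar>w\<bar> powr (2 * H)" for w :: real
  define h1 where "h1 w = 1 / 2 * h w" for w
  define g where "g w = - 1 / 2 * h w" for w
  have gh: "growth H h" using growth_abs_powr[of H] H by (simp add: h_def[abs_def])
  have gg: "growth H g" "growth H h1" unfolding g_def[abs_def] h1_def[abs_def] by (rule growth_cmult[OF gh])+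
  \<comment> \<open>The 0 fills the slot for a function of u + v in
    \<open>ou_functional_twice\<close>.\<close>
  define K where "K u v = h1 u + h1 v + 0 + g (u - v)" for u v
  have path: "continuous_on UNIV (\<lambda>t. B t \<omega>)" if "\<omega> \<in> space N" for \<omega>
    using B that by (simp add: two_sided_fBm_def)
  have cont: "continuous_on A (\<lambda>(u, v). K u v)" for A
    unfolding K_def g_def h1_def split_def
    by (intro continuous_intros continuous_on_compose2[OF continuous_abs_powr[OF H(1), folded h_def]]) auto
  have zero: "ou_filter \<theta> (- 1) (ou_filter \<theta> (- 1) (\<lambda>_. 0)) = (\<lambda>_. 0)"
    by (simp add: ou_filter_def laplace_def fun_eq_iff)
  have Qg: "ou_filter \<theta> (- 1) (ou_filter \<theta> 1 g) = Q"
    unfolding g_def[abs_def] ou_filter_cmult_fun Q_def fou_cov_def[abs_def] h_def[abs_def] by simp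
  have J: "jointly_normal N (Y s a) (Y t a) (c s s a) (c t t a) (c s t a)" if s: "a \<le> s" and t: "a \<le> t" for s t a
  proof -
    have twice: "ou_functional \<theta> a s (\<lambda>u. ou_functional \<theta> a t (K u)) = c s t a" if s: "a \<le> s" and t: "a \<le> t" for s t
      unfolding ou_functional_twice[OF \<theta> less_imp_le[OF H(1)] gg(2) gg(2) growth_const[OF less_imp_le[OF H(1)]] gg(1) s t K_def] c_def zero Qg
      by simp
    have "jointly_normal N (\<lambda>\<omega>. ou_functional \<theta> a s (\<lambda>r. B r \<omega>)) (\<lambda>\<omega>. ou_functional \<theta> a t (\<lambda>r. B r \<omega>))
      (ou_functional \<theta> a s (\<lambda>u. ou_functional \<theta> a s (K u))) (ou_functional \<theta> a t (\<lambda>u. ou_functional \<theta> a t (K u)))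
      (ou_functional \<theta> a s (\<lambda>u. ou_functional \<theta> a t (K u)))"
    proof (rule gaussian_process_ou_functional[OF _ _ _ _ cont \<theta> s t])
      show "gaussian_process N {a..} B"
        by (rule gaussian_process_mono[of N UNIV]) (use B in \<open>auto simp: two_sided_fBm_def\<close>)
      show "expectation (B t) = 0" for t using B by (simp add: two_sided_fBm_def)
      show "continuous_on {a..} (\<lambda>t. B t \<omega>)" if "\<omega> \<in> space N" for \<omega>
        using path[OF that] by (rule continuous_on_subset) simp
      show "expectation (\<lambda>\<omega>. B s \<omega> * B t \<omega>) = K s t" for s t
        using B by (simp add: two_sided_fBm_def K_def g_def h1_def h_def algebra_simps)
    qed
    note J = this[unfolded twice[OF s s] twice[OF t t] twice[OF s t]]
    show ?thesis
    proof (rule jointly_normal_cong[OF _ _ J])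
      fix \<omega> assume \<omega>: "\<omega> \<in> space N"
      have "ou_functional \<theta> a r (\<lambda>r. B r \<omega>) = Y r a \<omega>" if "a \<le> r" for r
        unfolding Y_def
        by (rule young_integral_eq_ou_functional[symmetric, OF that]) (rule continuous_on_subset[OF path[OF \<omega>]], auto)
      thus "ou_functional \<theta> a s (\<lambda>r. B r \<omega>) = Y s a \<omega>" "ou_functional \<theta> a t (\<lambda>r. B r \<omega>) = Y t a \<omega>"
        using s t by auto
    qed
  qed
  obtain C where C: "C > 0" "\<And>w. \<bar>Q w\<bar> \<le> C"
  proof -
    have "growth 0 Q" unfolding Q_def
      by (rule growth_mono[OF growth_fou_cov_decay(1)[OF H \<theta>]]) (use H in \<open>auto simp: decay_exponent_def\<close>)
    then obtain C where "C > 0" "\<And>w. \<bar>Q w\<bar> \<le> C * (1 + w\<^sup>2) powr 0" using growthE by blast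
    moreover have "(1 + w\<^sup>2) powr 0 = 1" for w :: real by (simp add: add_nonneg_eq_0_iff)
    ultimately show ?thesis using that[of C] by simp
  qed
  have e0: "((\<lambda>a. exp (- \<theta> * (s - a))) \<longlongrightarrow> 0) at_bot" for s
    using \<theta> by real_asymp
  have eQ: "((\<lambda>a. exp (- \<theta> * (s - a)) * Q (f a)) \<longlongrightarrow> 0) at_bot" for s and f :: "real \<Rightarrow> real"
  proof (rule Lim_null_comparison[OF always_eventually tendsto_mult_left_zero[OF e0[of s], of C]], rule allI)
    fix a show "norm (exp (- \<theta> * (s - a)) * Q (f a)) \<le> exp (- \<theta> * (s - a)) * C"
      using C(2)[of "f a"] by (simp add: abs_mult)
  qed
  have lim: "(c s t \<longlongrightarrow> Q (s - t)) at_bot" for s t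
  proof -
    have "((\<lambda>a. Q (s - t) - exp (- \<theta> * (s - a)) * Q (a - t) - exp (- \<theta> * (t - a)) * Q (s - a)
      + exp (- \<theta> * (s - a)) * exp (- \<theta> * (t - a)) * Q 0) \<longlongrightarrow> Q (s - t) - 0 - 0 + 0 * 0 * Q 0) at_bot"
      by (intro tendsto_intros eQ e0)
    thus ?thesis by (simp add: c_def[abs_def])
  qed
  have Zm: "Z r \<in> borel_measurable N" for r using Z by (simp add: stationary_fOU_def)
  have ZY: "((\<lambda>a. \<integral>\<^sup>+\<omega>. ennreal ((Z r \<omega> - Y r a \<omega>)\<^sup>2) \<partial>N) \<longlongrightarrow> 0) at_bot" for r
    using Z unfolding stationary_fOU_def Y_def by blast
  have "expectation (\<lambda>\<omega>. Z (of_int k) \<omega> * Z 0 \<omega>) = Q (of_int k - 0)"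
  proof (rule expectation_mult_L2_limit[OF trivial_limit_at_bot_linorder Zm Zm ZY ZY _ lim lim lim])
    show "\<forall>\<^sub>F a in at_bot. jointly_normal N (Y (of_int k) a) (Y 0 a) (c (of_int k) (of_int k) a) (c 0 0 a) (c (of_int k) 0 a)"
      using eventually_le_at_bot[of "min (of_int k) 0"] by eventually_elim (auto intro: J)
  qed
  thus ?thesis by (simp add: autocov_def Q_def)
qed

section \<open>The rate for H < 3/4\<close>

lemma infsum_nonzero_int:
  fixes f :: "int \<Rightarrow> real"
  assumes nonneg: "\<And>k. f k \<ge> 0" and s: "summable (\<lambda>k. f (int (Suc k)) + f (- int (Suc k)))"
  shows "f summable_on (UNIV - {0})" "infsum f (UNIV - {0}) = (\<Sum>k. f (int (Suc k)) + f (- int (Suc k)))"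
proof -
  have s1: "summable (\<lambda>k. f (int (Suc k)))" and s2: "summable (\<lambda>k. f (- int (Suc k)))"
    by (rule summable_comparison_test'[OF s, of 0], use nonneg in simp)+
  let ?A = "range (\<lambda>k. int (Suc k))" and ?B = "range (\<lambda>k. - int (Suc k))"
  have "((\<lambda>k. f (int (Suc k))) has_sum (\<Sum>k. f (int (Suc k)))) UNIV"
    "((\<lambda>k. f (- int (Suc k))) has_sum (\<Sum>k. f (- int (Suc k)))) UNIV"
    using nonneg s1 s2 by (auto intro!: norm_summable_imp_has_sum summable_sums)
  hence "(f has_sum (\<Sum>k. f (int (Suc k)))) ?A" "(f has_sum (\<Sum>k. f (- int (Suc k)))) ?B"
    by (subst has_sum_reindex; simp add: inj_def comp_def)+
  moreover have "?A \<inter> ?B = {}" by auto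
  ultimately have "(f has_sum ((\<Sum>k. f (int (Suc k))) + (\<Sum>k. f (- int (Suc k))))) (?A \<union> ?B)"
    by (rule has_sum_Un_disjoint)
  moreover have "?A \<union> ?B = UNIV - {0}"
  proof -
    have "k \<in> ?A \<union> ?B" if "k \<noteq> 0" for k
    proof (cases "k > 0")
      case True
      hence "k = int (Suc (nat (k - 1)))" by simp
      thus ?thesis by blast
    next
      case False
      hence "k = - int (Suc (nat (- k - 1)))" using that by simp
      thus ?thesis by blast
    qed
    thus ?thesis by auto
  qed
  ultimately have "(f has_sum (\<Sum>k. f (int (Suc k)) + f (- int (Suc k)))) (UNIV - {0})"
    by (simp only: suminf_add[OF s1 s2])
  thus "f summable_on (UNIV - {0})" "infsum f (UNIV - {0}) = (\<Sum>k. f (int (Suc k)) + f (- int (Suc k)))"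
    by (auto simp: summable_on_def infsumI)
qed

text \<open>For H \<le> 1/2 both exponents exceed 1 and the sums stay bounded, which leaves 1/n. For
  H > 1/2 both lie in (0, 1); the square and the single sum are each O(n^(2-4\<gamma>)), and
  division by n gives n^(1-4\<gamma>) = n^(4H-3).\<close>

lemma zeta_sums_le_psi:
  assumes H: "0 < H" "H < 3 / 4"
  defines "\<gamma> \<equiv> decay_exponent H"
  obtains K where "K > 0" "\<And>n. n \<ge> 1 \<Longrightarrow> ((zeta_sum (2 * \<gamma>) n)\<^sup>2 + zeta_sum (4 * \<gamma> - 1) n) / real n \<le> K * psi H n"
proof (cases "H \<le> 1 / 2")
  case True
  have g: "2 * \<gamma> > 1" "4 * \<gamma> - 1 > 1" using True by (auto simp: \<gamma>_def decay_exponent_def)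
  define K where "K = (1 + 1 / (2 * \<gamma> - 1))\<^sup>2 + (1 + 1 / (4 * \<gamma> - 1 - 1))"
  have "((zeta_sum (2 * \<gamma>) n)\<^sup>2 + zeta_sum (4 * \<gamma> - 1) n) / real n \<le> K * psi H n" if n: "n \<ge> 1" for n
  proof -
    have "zeta_sum (2 * \<gamma>) n \<ge> 1" by (rule zeta_sum_ge_1[OF n])
    hence "(zeta_sum (2 * \<gamma>) n)\<^sup>2 \<le> (1 + 1 / (2 * \<gamma> - 1))\<^sup>2"
      using zeta_sum_bounded[OF g(1)] by (intro power_mono) auto
    hence "(zeta_sum (2 * \<gamma>) n)\<^sup>2 + zeta_sum (4 * \<gamma> - 1) n \<le> K"
      unfolding K_def using zeta_sum_bounded[OF g(2)] by (rule add_mono)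
    moreover have "psi H n = 1 / real n"
    \<comment> \<open>At H = 1/2 \<open>psi\<close> already takes its second branch, whose exponent
      4H - 3 is then -1.\<close>
    proof (cases "H = 1 / 2")
      case True
      have e: "4 * H - 3 = - 1" using True by simp
      have "psi H n = real n powr (4 * H - 3)" using True by (simp add: psi_def)
      also have "\<dots> = 1 / real n" unfolding e by (simp add: powr_minus divide_inverse)
      finally show ?thesis .
    qed (use True in \<open>simp add: psi_def\<close>)
    ultimately show ?thesis by (simp add: divide_right_mono)
  qed
  moreover have "K > 0" unfolding K_def using g by (intro add_nonneg_pos) (auto intro: add_pos_pos)
  ultimately show ?thesis using that by blast
next
  case False
  have \<gamma>: "\<gamma> = 1 - H" using False by (simp add: \<gamma>_def decay_exponent_def)
  have g: "0 < 2 * \<gamma>" "2 * \<gamma> < 1" "0 < 4 * \<gamma> - 1" "4 * \<gamma> - 1 < 1" using False H by (auto simp: \<gamma>)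
  define K where "K = (1 / (1 - 2 * \<gamma>))\<^sup>2 + 1 / (1 - (4 * \<gamma> - 1))"
  have "((zeta_sum (2 * \<gamma>) n)\<^sup>2 + zeta_sum (4 * \<gamma> - 1) n) / real n \<le> K * psi H n" if n: "n \<ge> 1" for n
  proof -
    have "zeta_sum (2 * \<gamma>) n \<ge> 1" by (rule zeta_sum_ge_1[OF n])
    hence "(zeta_sum (2 * \<gamma>) n)\<^sup>2 \<le> (real n powr (1 - 2 * \<gamma>) / (1 - 2 * \<gamma>))\<^sup>2"
      using zeta_sum_le_powr[OF g(1,2)] by (intro power_mono) auto
    also have "\<dots> = (1 / (1 - 2 * \<gamma>))\<^sup>2 * real n powr (2 - 4 * \<gamma>)"
    proof -
      have "(real n powr (1 - 2 * \<gamma>))\<^sup>2 = real n powr (1 - 2 * \<gamma>) * real n powr (1 - 2 * \<gamma>)"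
        by (rule power2_eq_square)
      also have "\<dots> = real n powr (2 - 4 * \<gamma>)" by (simp flip: powr_add)
      finally show ?thesis by (simp add: power_divide)
    qed
    finally have "(zeta_sum (2 * \<gamma>) n)\<^sup>2 + zeta_sum (4 * \<gamma> - 1) n \<le> K * real n powr (2 - 4 * \<gamma>)"
      using zeta_sum_le_powr[OF g(3,4), of n] by (simp add: K_def distrib_right)
    hence "((zeta_sum (2 * \<gamma>) n)\<^sup>2 + zeta_sum (4 * \<gamma> - 1) n) / real n \<le> K * real n powr (2 - 4 * \<gamma>) / real n"
      by (rule divide_right_mono) simp
    also have "\<dots> = K * (real n powr (2 - 4 * \<gamma>) / real n powr 1)" using n by simp
    also have "real n powr (2 - 4 * \<gamma>) / real n powr 1 = real n powr (2 - 4 * \<gamma> - 1)" by (rule powr_diff[symmetric])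
    also have "\<dots> = psi H n" using False by (simp add: psi_def \<gamma>)
    finally show ?thesis .
  qed
  moreover have "K > 0" unfolding K_def using g by (intro add_nonneg_pos) auto
  ultimately show ?thesis using that by blast
qed

lemma psi_tendsto_0:
  assumes "0 < H" "H < 3 / 4"
  shows "psi H \<longlonglongrightarrow> 0"
proof (cases "H < 1 / 2")
  case True
  have "(\<lambda>n. 1 / real n) \<longlonglongrightarrow> 0" by real_asymp
  thus ?thesis using True by (simp add: psi_def[abs_def])
next
  case False
  have "4 * H - 3 < 0" using assms by simp
  hence "(\<lambda>n. real n powr (4 * H - 3)) \<longlonglongrightarrow> 0"
    by (intro tendsto_neg_powr filterlim_real_sequentially)
  thus ?thesis using False by (simp add: psi_def[abs_def])
qed

lemma sub_fou_quadratic_variation_rate: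
  assumes S: "sub_fBm M H S" and \<theta>: "\<theta> > 0" and H: "H < 3 / 4"
  defines "q \<equiv> \<lambda>k. (fou_cov \<theta> H (real (Suc k)))\<^sup>2 + (fou_cov \<theta> H (- real (Suc k)))\<^sup>2"
  shows "summable q"
    and "\<exists>C>0. \<forall>n\<ge>1. \<bar>integral\<^sup>L M (\<lambda>\<omega>. (V M (OU \<theta> S) n \<omega>)\<^sup>2)
           - (2 * (fou_cov \<theta> H 0)\<^sup>2 + 2 * suminf q)\<bar> \<le> C * psi H n"
proof -
  have H0: "0 < H" "H < 1" using S by (auto simp: sub_fBm_def)
  define \<gamma> where "\<gamma> = decay_exponent H"
  let ?\<rho> = "fou_cov \<theta> H" and ?R = "sub_fou_cov \<theta> H"
  have s: "4 * \<gamma> > 1" and \<gamma>: "\<gamma> > 0" using H by (auto simp: \<gamma>_def decay_exponent_def)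
  obtain C where C: "C > 0" and \<rho>: "\<And>w. \<bar>?\<rho> w\<bar> \<le> C * (1 + w\<^sup>2) powr (- \<gamma>)"
    and R: "\<And>s t. 0 \<le> s \<Longrightarrow> 0 \<le> t \<Longrightarrow> \<bar>?R s t - ?\<rho> (s - t)\<bar> \<le> C * (1 + (s + t)\<^sup>2) powr (- \<gamma>)"
    using sub_fou_cov_decay[OF H0 \<theta>] unfolding \<gamma>_def by blast
  define g where "g k = (?\<rho> (real k))\<^sup>2 + (?\<rho> (- real k))\<^sup>2" for k
  have g: "0 \<le> g k \<and> g k \<le> 2 * C\<^sup>2 * real k powr (- (4 * \<gamma>))" if k: "k \<ge> 1" for k
  proof -
    have "(?\<rho> w)\<^sup>2 \<le> C\<^sup>2 * real k powr (- (4 * \<gamma>))" if "w\<^sup>2 = (real k)\<^sup>2" for w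
    proof -
      have "\<bar>?\<rho> w\<bar> \<le> C * (1 + (real k)\<^sup>2) powr (- \<gamma>)" using \<rho>[of w] that by simp
      also have "\<dots> \<le> C * real k powr (- (2 * \<gamma>))"
        using C k \<gamma> by (intro mult_left_mono powr_bracket_le) auto
      finally have "\<bar>?\<rho> w\<bar>\<^sup>2 \<le> (C * real k powr (- (2 * \<gamma>)))\<^sup>2" by (rule power_mono) simp
      also have "\<dots> = C\<^sup>2 * (real k powr (- (2 * \<gamma>)) * real k powr (- (2 * \<gamma>)))"
        by (simp add: power_mult_distrib power2_eq_square)
      finally show ?thesis by (simp flip: powr_add)
    qed
    from this[of "real k"] this[of "- real k"] show ?thesis by (simp add: g_def)
  qed
  have q: "q = (\<lambda>k. g (Suc k))" by (simp add: q_def g_def)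
  note ces = cesaro_tail_bound[OF s g]
  show sq: "summable q" unfolding q by (rule ces(1))
  obtain K where K: "K > 0" "\<And>n. n \<ge> 1 \<Longrightarrow> ((zeta_sum (2 * \<gamma>) n)\<^sup>2 + zeta_sum (4 * \<gamma> - 1) n) / real n \<le> K * psi H n"
    using zeta_sums_le_psi[OF H0(1) H] unfolding \<gamma>_def by blast
  \<comment> \<open>The second moment carries 2/n. This doubles the 9 C^2 of the perturbation and
    the 2 C^2 that bounds the two squares in \<open>g\<close>.\<close>
  define A where "A = 18 * C\<^sup>2 + 4 * C\<^sup>2 * (1 + 1 / (4 * \<gamma> - 1))"
  have A: "A > 0" unfolding A_def using C s by (intro add_pos_nonneg) auto
  have "\<bar>integral\<^sup>L M (\<lambda>\<omega>. (V M (OU \<theta> S) n \<omega>)\<^sup>2) - (2 * (?\<rho> 0)\<^sup>2 + 2 * suminf q)\<bar> \<le> (A * K) * psi H n" if n: "n \<ge> 1" for n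
  proof -
    define Z2 where "Z2 = (zeta_sum (2 * \<gamma>) n)\<^sup>2"
    define Z4 where "Z4 = zeta_sum (4 * \<gamma> - 1) n"
    define R2 where "R2 = (\<Sum>i=1..n. \<Sum>j=1..n. (?R (real i) (real j))\<^sup>2)"
    define \<rho>2 where "\<rho>2 = (\<Sum>i=1..n. \<Sum>j=1..n. (?\<rho> (real i - real j))\<^sup>2)"
    define G where "G = (\<Sum>m<n. \<Sum>k=1..m. g k)"
    have 1: "\<bar>R2 - \<rho>2\<bar> \<le> 9 * C\<^sup>2 * Z2"
      unfolding R2_def \<rho>2_def Z2_def by (rule sum_squares_perturbation[OF \<gamma> C \<rho> R n])
    have 2: "\<bar>G / real n - suminf q\<bar> \<le> 2 * C\<^sup>2 * (1 + 1 / (4 * \<gamma> - 1)) * Z4 / real n"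
      unfolding G_def q Z4_def by (rule ces(2)[OF _ n])
    have "\<rho>2 = real n * (?\<rho> 0)\<^sup>2 + G"
      unfolding \<rho>2_def G_def g_def by (rule sum_differences)
    hence 3: "\<rho>2 / real n = (?\<rho> 0)\<^sup>2 + G / real n" using n by (simp add: field_simps)
    have 4: "\<bar>R2 / real n - \<rho>2 / real n\<bar> \<le> 9 * C\<^sup>2 * Z2 / real n"
      using divide_right_mono[OF 1, of "real n"] by (simp add: abs_divide flip: diff_divide_distrib)
    have "integral\<^sup>L M (\<lambda>\<omega>. (V M (OU \<theta> S) n \<omega>)\<^sup>2) = 2 * (R2 / real n)"
      unfolding second_moment_V[OF S \<theta> n] R2_def by simp
    hence "\<bar>integral\<^sup>L M (\<lambda>\<omega>. (V M (OU \<theta> S) n \<omega>)\<^sup>2) - (2 * (?\<rho> 0)\<^sup>2 + 2 * suminf q)\<bar>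
       \<le> 2 * (9 * C\<^sup>2 * Z2 / real n) + 2 * (2 * C\<^sup>2 * (1 + 1 / (4 * \<gamma> - 1)) * Z4 / real n)"
      using 2 3 4 by linarith
    also have "\<dots> = (18 * C\<^sup>2 * Z2 + 4 * C\<^sup>2 * (1 + 1 / (4 * \<gamma> - 1)) * Z4) / real n"
      by (simp add: add_divide_distrib)
    also have "\<dots> \<le> (A * Z2 + A * Z4) / real n"
    proof (intro divide_right_mono add_mono mult_right_mono)
      show "Z2 \<ge> 0" "Z4 \<ge> 0" unfolding Z2_def Z4_def using zeta_sum_ge_1[OF n, of "4 * \<gamma> - 1"] by auto
    qed (use s in \<open>auto simp: A_def\<close>)
    also have "\<dots> = A * ((Z2 + Z4) / real n)" by (simp add: distrib_left)
    also have "\<dots> \<le> A * (K * psi H n)" unfolding Z2_def Z4_def by (rule mult_left_mono[OF K(2)[OF n]]) (use A in simp)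
    finally show ?thesis by simp
  qed
  thus "\<exists>C>0. \<forall>n\<ge>1. \<bar>integral\<^sup>L M (\<lambda>\<omega>. (V M (OU \<theta> S) n \<omega>)\<^sup>2)
           - (2 * (fou_cov \<theta> H 0)\<^sup>2 + 2 * suminf q)\<bar> \<le> C * psi H n"
    using A K(1) by (intro exI[of _ "A * K"]) auto
qed

section \<open>The critical case H = 3/4\<close>

lemma sum_harm: "(\<Sum>m<n. harm m :: real) = real n * harm n - real n"
proof (induction n)
  case (Suc n)
  have "real (Suc n) * harm (Suc n) = real (Suc n) * harm n + 1"
    by (simp add: harm_Suc distrib_left del: of_nat_Suc)
  thus ?case using Suc by (simp add: algebra_simps)
qed simp

text \<open>The difference decreases from its value 1 at n = 1.\<close>

lemma harm_minus_ln_bounds: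
  assumes "n \<ge> 1"
  shows "0 \<le> harm n - ln (real n)" "harm n - ln (real n) \<le> 1"
proof -
  have "ln (real n) \<le> ln (real n + 1)" using assms by simp
  thus "0 \<le> harm n - ln (real n)" using ln_le_harm[of n] by linarith
  have "harm (Suc (n - 1)) - ln (Suc (n - 1)) \<le> harm (Suc 0) - ln (real (Suc 0))"
    using decseq_harm_diff_ln by (rule decseqD) simp
  thus "harm n - ln (real n) \<le> 1" using assms by (simp add: harm_expand)
qed

text \<open>The square of the leading term is d^2 (1 + w^2)^(-1/2). Its product with the remainder,
  and the replacement of (1 + w^2)^(-1/2) by 1/k, both cost O(k^(-2)). As this is summable, the
  logarithm comes from the harmonic sum alone.\<close>

lemma fou_cov_square_critical:
  assumes \<theta>: "\<theta> > 0"
  obtains C where "C > 0" "\<And>w k. k \<ge> 1 \<Longrightarrow> \<bar>w\<bar> = real k \<Longrightarrow>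
    \<bar>(fou_cov \<theta> (3 / 4) w)\<^sup>2 - 9 / (64 * \<theta> ^ 4) / real k\<bar> \<le> C * real k powr (- 2)"
proof -
  \<comment> \<open>The coefficient H (2H - 1) / \<theta>^2 of \<open>growth_fou_cov\<close> at H =
    3/4.\<close>
  define d where "d = 3 / (8 * \<theta>\<^sup>2)"
  have d: "d > 0" "d\<^sup>2 = 9 / (64 * \<theta> ^ 4)" using \<theta> by (auto simp: d_def power_divide power_mult_distrib)
  let ?p = "\<lambda>b w::real. (1 + w\<^sup>2) powr b"
  have "growth (- (3 / 4)) (\<lambda>w. fou_cov \<theta> (3 / 4) w - d * ?p (- (1 / 4)) w)"
    using growth_fou_cov(1)[OF _ _ \<theta>, of "3 / 4"] by (simp add: d_def)
  then obtain C where C: "C > 0" "\<And>w. \<bar>fou_cov \<theta> (3 / 4) w - d * ?p (- (1 / 4)) w\<bar> \<le> C * ?p (- (3 / 4)) w"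
    using growthE by blast
  have "\<bar>(fou_cov \<theta> (3 / 4) w)\<^sup>2 - 9 / (64 * \<theta> ^ 4) / real k\<bar> \<le> (C * (2 * d + C) + d\<^sup>2) * real k powr (- 2)"
    if k: "k \<ge> 1" and w: "\<bar>w\<bar> = real k" for w k
  proof -
    define e where "e = fou_cov \<theta> (3 / 4) w - d * ?p (- (1 / 4)) w"
    have w2: "w\<^sup>2 = (real k)\<^sup>2" using w by (metis power2_abs)
    have e: "\<bar>e\<bar> \<le> C * ?p (- (3 / 4)) w" unfolding e_def by (rule C)
    have le: "?p (- (3 / 4)) w \<le> ?p (- (1 / 4)) w" by (rule powr_mono) auto
    have "\<bar>2 * d * ?p (- (1 / 4)) w + e\<bar> \<le> 2 * d * ?p (- (1 / 4)) w + C * ?p (- (1 / 4)) w"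
    proof -
      have "C * ?p (- (3 / 4)) w \<le> C * ?p (- (1 / 4)) w" using C(1) by (intro mult_left_mono[OF le]) simp
      moreover have "0 \<le> 2 * d * ?p (- (1 / 4)) w" using d(1) by simp
      ultimately show ?thesis using e by linarith
    qed
    hence b: "\<bar>2 * d * ?p (- (1 / 4)) w + e\<bar> \<le> (2 * d + C) * ?p (- (1 / 4)) w" by (simp add: distrib_right)
    have pm: "?p (- (3 / 4)) w * ?p (- (1 / 4)) w = ?p (- 1) w"
      "(?p (- (1 / 4)) w)\<^sup>2 = ?p (- (1 / 2)) w"
      by (simp_all add: power2_eq_square flip: powr_add)
    have "(fou_cov \<theta> (3 / 4) w)\<^sup>2 - d\<^sup>2 * ?p (- (1 / 2)) w = e * (2 * d * ?p (- (1 / 4)) w + e)"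
      unfolding pm(2)[symmetric] by (simp add: e_def power2_eq_square algebra_simps)
    hence "\<bar>(fou_cov \<theta> (3 / 4) w)\<^sup>2 - d\<^sup>2 * ?p (- (1 / 2)) w\<bar> = \<bar>e\<bar> * \<bar>2 * d * ?p (- (1 / 4)) w + e\<bar>"
      by (simp add: abs_mult)
    also have "\<dots> \<le> (C * ?p (- (3 / 4)) w) * ((2 * d + C) * ?p (- (1 / 4)) w)"
      using C(1) by (intro mult_mono e b) auto
    also have "\<dots> = C * (2 * d + C) * ?p (- 1) w" unfolding pm(1)[symmetric] by simp
    also have "\<dots> \<le> C * (2 * d + C) * real k powr (- 2)"
      using powr_bracket_le[of 1 k] k C(1) d(1) by (intro mult_left_mono) (auto simp: w2)
    finally have 1: "\<bar>(fou_cov \<theta> (3 / 4) w)\<^sup>2 - d\<^sup>2 * ?p (- (1 / 2)) w\<bar> \<le> C * (2 * d + C) * real k powr (- 2)" .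
    have k2: "real k powr (- 2) = 1 / (real k * real k)"
    proof -
      have "real k powr (- 2) = inverse (real k powr 2)" by (rule powr_minus)
      also have "real k powr 2 = real k * real k" by (simp add: power2_eq_square)
      finally show ?thesis by (simp add: inverse_eq_divide)
    qed
    \<comment> \<open>From k \<le> sqrt(1 + k^2) \<le> k + 1 this lies between 1/(k + 1) and 1/k,
      which differ by at most 1/k^2.\<close>
    have "?p (- (1 / 2)) w = 1 / sqrt (1 + (real k)\<^sup>2)"
      unfolding w2 powr_minus[of _ "1 / 2"] by (simp add: powr_half_sqrt inverse_eq_divide)
    moreover have "sqrt (1 + (real k)\<^sup>2) \<le> 1 + real k"
      by (rule real_le_lsqrt) (auto simp: power2_eq_square algebra_simps)
    moreover have "real k \<le> sqrt (1 + (real k)\<^sup>2)" by (rule real_le_rsqrt) simp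
    ultimately have "1 / (1 + real k) \<le> ?p (- (1 / 2)) w" "?p (- (1 / 2)) w \<le> 1 / real k"
      using k by (auto intro!: divide_left_mono mult_pos_pos add_pos_nonneg)
    moreover have "1 / real k - 1 / (1 + real k) \<le> real k powr (- 2)"
    proof -
      have "1 / real k - 1 / (1 + real k) = 1 / (real k * (1 + real k))" using k by (simp add: field_simps)
      also have "\<dots> \<le> 1 / (real k * real k)" using k by (intro divide_left_mono mult_left_mono mult_pos_pos) auto
      finally show ?thesis unfolding k2 .
    qed
    ultimately have "\<bar>?p (- (1 / 2)) w - 1 / real k\<bar> \<le> real k powr (- 2)" by linarith
    hence "d\<^sup>2 * \<bar>?p (- (1 / 2)) w - 1 / real k\<bar> \<le> d\<^sup>2 * real k powr (- 2)" by (rule mult_left_mono) simp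
    moreover have "d\<^sup>2 * ?p (- (1 / 2)) w - d\<^sup>2 / real k = d\<^sup>2 * (?p (- (1 / 2)) w - 1 / real k)"
      by (simp add: right_diff_distrib)
    ultimately have 2: "\<bar>d\<^sup>2 * ?p (- (1 / 2)) w - d\<^sup>2 / real k\<bar> \<le> d\<^sup>2 * real k powr (- 2)"
      by (simp only: abs_mult abs_power2)
    show ?thesis using 1 2 unfolding d(2)[symmetric] distrib_right by linarith
  qed
  moreover have "C * (2 * d + C) + d\<^sup>2 > 0" using C(1) d(1) by (intro add_pos_nonneg mult_pos_pos) auto
  ultimately show ?thesis using that by blast
qed

text \<open>Here \<gamma> = 1/4 and \<open>zeta_sum (1/2) n\<close> is at most 2 sqrt n, so the
  nonstationary error stays bounded after division by n. The stationary double sum is 2 a (n harm n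
  - n) + O(n), and the factor 2/n makes it 4 a ln n + O(1).\<close>

lemma sub_fou_quadratic_variation_critical:
  assumes S: "sub_fBm M (3 / 4) S" and \<theta>: "\<theta> > 0"
  obtains K where "K > 0"
    "\<And>n. n \<ge> 1 \<Longrightarrow> \<bar>integral\<^sup>L M (\<lambda>\<omega>. (V M (OU \<theta> S) n \<omega>)\<^sup>2) - 9 / (16 * \<theta> ^ 4) * ln (real n)\<bar> \<le> K"
proof -
  let ?\<rho> = "fou_cov \<theta> (3 / 4)" and ?R = "sub_fou_cov \<theta> (3 / 4)"
  define a where "a = 9 / (64 * \<theta> ^ 4)"
  have a: "a \<ge> 0" by (simp add: a_def)
  have \<gamma>: "decay_exponent (3 / 4) = 1 / 4" by (simp add: decay_exponent_def)
  obtain C where C: "C > 0" and \<rho>: "\<And>w. \<bar>?\<rho> w\<bar> \<le> C * (1 + w\<^sup>2) powr (- (1 / 4))"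
    and R: "\<And>s t. 0 \<le> s \<Longrightarrow> 0 \<le> t \<Longrightarrow> \<bar>?R s t - ?\<rho> (s - t)\<bar> \<le> C * (1 + (s + t)\<^sup>2) powr (- (1 / 4))"
    using sub_fou_cov_decay[OF _ _ \<theta>, of "3 / 4"] unfolding \<gamma> by auto
  obtain D where D: "D > 0" and sq: "\<And>w k. k \<ge> 1 \<Longrightarrow> \<bar>w\<bar> = real k \<Longrightarrow> \<bar>(?\<rho> w)\<^sup>2 - a / real k\<bar> \<le> D * real k powr (- 2)"
    using fou_cov_square_critical[OF \<theta>] unfolding a_def by blast
  define g where "g k = (?\<rho> (real k))\<^sup>2 + (?\<rho> (- real k))\<^sup>2" for k
  \<comment> \<open>Twice the error bounds below: 36 C^2 from the perturbation, the diagonal, and 4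
    D from the summable remainder. Replacing harm n - 1 by ln n costs at most 2 a before doubling,
    which 8 a covers.\<close>
  define K where "K = 72 * C\<^sup>2 + 2 * (?\<rho> 0)\<^sup>2 + 8 * D + 8 * a"
  have "\<bar>integral\<^sup>L M (\<lambda>\<omega>. (V M (OU \<theta> S) n \<omega>)\<^sup>2) - 9 / (16 * \<theta> ^ 4) * ln (real n)\<bar> \<le> K" if n: "n \<ge> 1" for n
  proof -
    define R2 where "R2 = (\<Sum>i=1..n. \<Sum>j=1..n. (?R (real i) (real j))\<^sup>2)"
    define \<rho>2 where "\<rho>2 = (\<Sum>i=1..n. \<Sum>j=1..n. (?\<rho> (real i - real j))\<^sup>2)"
    define G where "G = (\<Sum>m<n. \<Sum>k=1..m. g k)"
    have "\<bar>R2 - \<rho>2\<bar> \<le> 9 * C\<^sup>2 * (zeta_sum (2 * (1 / 4)) n)\<^sup>2"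
      unfolding R2_def \<rho>2_def by (rule sum_squares_perturbation[OF _ C \<rho> R n]) simp
    also have "\<dots> \<le> 9 * C\<^sup>2 * (4 * real n)"
    proof (rule mult_left_mono)
      have "zeta_sum (1 / 2) n \<le> real n powr (1 / 2) / (1 / 2)" using zeta_sum_le_powr[of "1 / 2" n] by simp
      hence "zeta_sum (1 / 2) n \<le> 2 * sqrt (real n)" by (simp add: powr_half_sqrt)
      hence "(zeta_sum (1 / 2) n)\<^sup>2 \<le> (2 * sqrt (real n))\<^sup>2"
        using zeta_sum_ge_1[OF n, of "1 / 2"] by (intro power_mono) auto
      thus "(zeta_sum (2 * (1 / 4)) n)\<^sup>2 \<le> 4 * real n" by (simp add: power_mult_distrib)
    qed simp
    finally have "\<bar>R2 - \<rho>2\<bar> / real n \<le> 9 * C\<^sup>2 * (4 * real n) / real n" by (rule divide_right_mono) simp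
    hence 1: "\<bar>R2 / real n - \<rho>2 / real n\<bar> \<le> 36 * C\<^sup>2" using n by (simp add: abs_divide flip: diff_divide_distrib)
    have "\<rho>2 = real n * (?\<rho> 0)\<^sup>2 + G"
      unfolding \<rho>2_def G_def g_def by (rule sum_differences)
    hence 2: "\<rho>2 / real n = (?\<rho> 0)\<^sup>2 + G / real n" using n by (simp add: field_simps)
    have inner: "\<bar>(\<Sum>k=1..m. g k) - 2 * a * harm m\<bar> \<le> 4 * D" for m
    proof -
      have "(\<Sum>k=1..m. g k) - 2 * a * harm m = (\<Sum>k=1..m. g k - 2 * (a / real k))"
        by (simp add: harm_def sum_subtractf sum_distrib_left divide_inverse mult.assoc)
      also have "\<bar>\<dots>\<bar> \<le> (\<Sum>k=1..m. 2 * D * real k powr (- 2))"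
      proof (rule order_trans[OF sum_abs sum_mono])
        fix k assume "k \<in> {1..m}"
        hence "k \<ge> 1" by simp
        from sq[OF this, of "real k"] sq[OF this, of "- real k"]
        show "\<bar>g k - 2 * (a / real k)\<bar> \<le> 2 * D * real k powr (- 2)" unfolding g_def by (simp add: abs_le_iff)
      qed
      also have "\<dots> = 2 * D * zeta_sum 2 m" by (simp add: zeta_sum_def sum_distrib_left)
      also have "\<dots> \<le> 2 * D * 2" using zeta_sum_bounded[of 2 m] D by (intro mult_left_mono) auto
      finally show ?thesis by simp
    qed
    have "G - 2 * a * (real n * harm n - real n) = (\<Sum>m<n. (\<Sum>k=1..m. g k) - 2 * a * harm m)"
      unfolding G_def sum_harm[symmetric] by (simp add: sum_subtractf sum_distrib_left)
    also have "\<bar>\<dots>\<bar> \<le> (\<Sum>m<n. 4 * D)" by (rule order_trans[OF sum_abs sum_mono[OF inner]])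
    finally have "\<bar>G - 2 * a * (real n * harm n - real n)\<bar> / real n \<le> (real n * (4 * D)) / real n"
      by (intro divide_right_mono) auto
    hence "\<bar>(G - 2 * a * (real n * harm n - real n)) / real n\<bar> \<le> 4 * D" using n by (simp add: abs_divide)
    moreover have "(G - 2 * a * (real n * harm n - real n)) / real n = G / real n - 2 * a * (harm n - 1)"
      using n by (simp add: field_simps)
    ultimately have 3: "\<bar>G / real n - 2 * a * (harm n - 1)\<bar> \<le> 4 * D" by simp
    have "\<bar>harm n - 1 - ln (real n)\<bar> \<le> 1" using harm_minus_ln_bounds[OF n] by linarith
    hence "2 * a * \<bar>harm n - 1 - ln (real n)\<bar> \<le> 2 * a * 1" using a by (intro mult_left_mono) auto
    hence "\<bar>2 * a * (harm n - 1 - ln (real n))\<bar> \<le> 2 * a" using a by (simp add: abs_mult)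
    moreover have "2 * a * (harm n - 1 - ln (real n)) = 2 * a * (harm n - 1) - 2 * a * ln (real n)"
      by (rule right_diff_distrib)
    ultimately have 4: "\<bar>2 * a * (harm n - 1) - 2 * a * ln (real n)\<bar> \<le> 2 * a" by simp
    have e: "9 / (16 * \<theta> ^ 4) * ln (real n) = 2 * (2 * a * ln (real n))" by (simp add: a_def)
    have E: "integral\<^sup>L M (\<lambda>\<omega>. (V M (OU \<theta> S) n \<omega>)\<^sup>2) = 2 * (R2 / real n)"
      unfolding second_moment_V[OF S \<theta> n] R2_def by simp
    have "(?\<rho> 0)\<^sup>2 \<ge> 0" by simp
    thus ?thesis unfolding e E K_def using 1 2 3 4 a D by linarith
  qed
  moreover have "K > 0" unfolding K_def using C D a by (intro add_pos_nonneg add_nonneg_pos) auto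
  ultimately show ?thesis using that by blast
qed

text \<open>M and N are unrelated probability spaces: Z enters only through its autocovariance,
  which \<open>autocov_stationary_fOU\<close> replaces by the explicit function
  \<open>fou_cov\<close>.\<close>

theorem proposition10:
  fixes M :: "'a measure" and N :: "'b measure"
    and S :: "real \<Rightarrow> 'a \<Rightarrow> real" and B Z :: "real \<Rightarrow> 'b \<Rightarrow> real"
    and \<theta> H :: real
  assumes "\<theta> > 0" and "sub_fBm M H S"
  shows "(0 < H \<and> H < 3 / 4 \<and> two_sided_fBm N H B \<and> stationary_fOU N \<theta> B Z \<longrightarrow>
            (\<lambda>i. (autocov N Z i)\<^sup>2) summable_on (UNIV - {0}) \<and>
            (\<exists>C>0. \<forall>n\<ge>1. \<bar>integral\<^sup>L M (\<lambda>\<omega>. (V M (OU \<theta> S) n \<omega>)\<^sup>2) - sigma_sq (autocov N Z)\<bar>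
                             \<le> C * psi H n) \<and>
            ((\<lambda>n. integral\<^sup>L M (\<lambda>\<omega>. (V M (OU \<theta> S) n \<omega>)\<^sup>2)) \<longlonglongrightarrow> sigma_sq (autocov N Z)) \<and>
            sigma_sq (autocov N Z) > 0) \<and>
         (H = 3 / 4 \<longrightarrow>
            (\<exists>C>0. \<forall>n>1. \<bar>integral\<^sup>L M (\<lambda>\<omega>. (V M (OU \<theta> S) n \<omega>)\<^sup>2) / ln (real n) - 9 / (16 * \<theta> ^ 4)\<bar>
                             \<le> C * inverse (ln (real n))))"
proof (intro conjI impI)
  assume A: "0 < H \<and> H < 3 / 4 \<and> two_sided_fBm N H B \<and> stationary_fOU N \<theta> B Z"
  let ?f = "\<lambda>i. (autocov N Z i)\<^sup>2" and ?E = "\<lambda>n. integral\<^sup>L M (\<lambda>\<omega>. (V M (OU \<theta> S) n \<omega>)\<^sup>2)"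
  have H: "0 < H" "H < 3 / 4" and BZ: "two_sided_fBm N H B" "stationary_fOU N \<theta> B Z" using A by auto
  have ac: "autocov N Z k = fou_cov \<theta> H (of_int k)" for k
    by (rule autocov_stationary_fOU[OF BZ assms(1)])
  \<comment> \<open>Pairing k with -k turns the sum over the nonzero integers into the one-sided
    series of the rate lemma.\<close>
  have q: "(\<lambda>k. ?f (int (Suc k)) + ?f (- int (Suc k))) =
      (\<lambda>k. (fou_cov \<theta> H (real (Suc k)))\<^sup>2 + (fou_cov \<theta> H (- real (Suc k)))\<^sup>2)"
    by (simp only: ac of_int_minus of_int_of_nat_eq)
  have sm: "summable (\<lambda>k. ?f (int (Suc k)) + ?f (- int (Suc k)))"
    unfolding q by (rule sub_fou_quadratic_variation_rate(1)[OF assms(2,1) H(2)])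
  note inf = infsum_nonzero_int[of ?f, OF zero_le_power2 sm]
  show "?f summable_on (UNIV - {0})" by (rule inf(1))
  have sigma: "sigma_sq (autocov N Z) = 2 * (fou_cov \<theta> H 0)\<^sup>2
      + 2 * (\<Sum>k. (fou_cov \<theta> H (real (Suc k)))\<^sup>2 + (fou_cov \<theta> H (- real (Suc k)))\<^sup>2)"
    unfolding sigma_sq_def inf(2) q by (simp add: ac)
  show rate: "\<exists>C>0. \<forall>n\<ge>1. \<bar>?E n - sigma_sq (autocov N Z)\<bar> \<le> C * psi H n"
    unfolding sigma by (rule sub_fou_quadratic_variation_rate(2)[OF assms(2,1) H(2)])
  then obtain C where C: "\<And>n. n \<ge> 1 \<Longrightarrow> \<bar>?E n - sigma_sq (autocov N Z)\<bar> \<le> C * psi H n" by blast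
  have "(\<lambda>n. ?E n - sigma_sq (autocov N Z)) \<longlonglongrightarrow> 0"
  proof (rule Lim_null_comparison)
    show "\<forall>\<^sub>F n in sequentially. norm (?E n - sigma_sq (autocov N Z)) \<le> C * psi H n"
      using eventually_ge_at_top[of 1] by eventually_elim (simp add: C)
    show "(\<lambda>n. C * psi H n) \<longlonglongrightarrow> 0"
      using tendsto_mult_right_zero[OF psi_tendsto_0[OF H]] by simp
  qed
  thus "?E \<longlonglongrightarrow> sigma_sq (autocov N Z)" by (simp add: LIM_zero_iff)
  \<comment> \<open>The other lags contribute nonnegative squares, so strict positivity rests on lag
    0 alone.\<close>
  have "0 \<le> (\<Sum>k. ?f (int (Suc k)) + ?f (- int (Suc k)))" by (rule suminf_nonneg[OF sm]) simp
  moreover have "(fou_cov \<theta> H 0)\<^sup>2 > 0" using fou_cov_0_pos[OF assms(1) H(1)] by simp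
  ultimately show "sigma_sq (autocov N Z) > 0" unfolding sigma q by linarith
next
  assume H: "H = 3 / 4"
  obtain K where K: "K > 0"
    "\<And>n. n \<ge> 1 \<Longrightarrow> \<bar>integral\<^sup>L M (\<lambda>\<omega>. (V M (OU \<theta> S) n \<omega>)\<^sup>2) - 9 / (16 * \<theta> ^ 4) * ln (real n)\<bar> \<le> K"
    using sub_fou_quadratic_variation_critical[OF assms(2)[unfolded H] assms(1)] by blast
  show "\<exists>C>0. \<forall>n>1. \<bar>integral\<^sup>L M (\<lambda>\<omega>. (V M (OU \<theta> S) n \<omega>)\<^sup>2) / ln (real n) - 9 / (16 * \<theta> ^ 4)\<bar>
                             \<le> C * inverse (ln (real n))"
  proof (intro exI[of _ K] conjI allI impI K(1))
    fix n :: nat assume n: "n > 1"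
    define E where "E = integral\<^sup>L M (\<lambda>\<omega>. (V M (OU \<theta> S) n \<omega>)\<^sup>2)"
    define c where "c = 9 / (16 * \<theta> ^ 4)"
    have ln: "ln (real n) > 0" using n by simp
    have "\<bar>E - c * ln (real n)\<bar> / ln (real n) \<le> K / ln (real n)"
      using K(2)[of n] n ln unfolding E_def c_def by (intro divide_right_mono) auto
    moreover have "E / ln (real n) - c = (E - c * ln (real n)) / ln (real n)" using ln by (simp add: field_simps)
    hence "\<bar>E / ln (real n) - c\<bar> = \<bar>E - c * ln (real n)\<bar> / ln (real n)" using ln by (simp add: abs_divide)
    ultimately show "\<bar>E / ln (real n) - c\<bar> \<le> K * inverse (ln (real n))"
      by (simp only: divide_inverse)
  qed
qed

end
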